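(* Let $n\ge 2$, let $\mathfrak{q}=\mathfrak{q}(x)$ be an arbitrary smooth function on an open interval, and let $u,v$ be linearly independent solutions of $y_{xx}+\mathfrak{q}(x)y=0$ with $uv'-u'v=1$, the interval being chosen so that $u$ has no zeros on it. Let $\Delta_n\equiv\Delta_n(x,y^{(n)})=0$ be the transformed version, written with leading coefficient one, of the trivial equation $w^{(n)}=0$ under the change of coordinates $$z=\int\frac{1}{u^2}\,dx,\qquad w=\alpha\,u^{1-n}\,y ,$$ where $\alpha\neq 0$ is an arbitrary constant. For even $n$, let $\mathscr{L}_n$ be the transformed version, under the same change of coordinates, of the Lagrangian $L_n=\frac{(-1)^{n/2}}{2}\big(w^{(n/2)}\big)^2$ of $w^{(n)}=0$, that is, $\mathscr{L}_n(x,y^{(n/2)})=L_n(z,w^{(n/2)})\,z_x$. Let $\mathcal{S}_{div}$ be the divergence symmetry algebra of $\Delta_n=0$ and, for even $n$, let $\mathcal{S}_{var}$ be its variational symmetry algebra with respect to $\mathscr{L}_n$. Then: (a) For $n$ odd, $\mathcal{S}_{div}=\langle V_0,\dots,V_{n-1},W_y\rangle$. That is, $\mathcal{S}_{div}=\mathcal{A}_n\dotplus\mathbb{R}W_y$. (b) For $n$ even, $\mathcal{S}_{div}=\mathcal{A}_n\dotplus\mathfrak{s}$, and with respect to the Lagrangian $\mathscr{L}_n$ one has $\mathcal{S}_{var}=\langle V_0,\dots,V_{\frac{n-2}{2}}\rangle\dotplus\langle F_n,G_n\rangle$.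
   Context: The equation $\Delta_n[y]=0$ is a linear ODE of order $n$ in normal form $y^{(n)}+A_n^2y^{(n-2)}+\dots+A_n^ny=0$ (no term in $y^{(n-1)}$) of maximal symmetry, i.e. reducible by a point transformation to $w^{(n)}=0$, and it depends on the single arbitrary function $\mathfrak{q}$. Its expression is $\Delta_n[y]=\alpha^{-1}u^{-(n+1)}\,\frac{d^n}{dz^n}\big(\alpha u^{1-n}y\big)$ with $\frac{d}{dz}=u^2\frac{d}{dx}$; equivalently, its solution space has basis $s_k=u^{n-k-1}v^k$, $0\le k\le n-1$. Vector fields (primes are $d/dx$): $V_k=u^{n-(k+1)}v^k\,\partial_y$ for $0\le k\le n-1$; $W_y=y\,\partial_y$; $F_n=u^2\partial_x+(n-1)uu'y\,\partial_y$; $G_n=2uv\,\partial_x+(n-1)(uv'+u'v)y\,\partial_y$; $H_n=-v^2\partial_x-(n-1)vv'y\,\partial_y$. These are Lie point symmetries of $\Delta_n[y]=0$. $\langle X_1,\dots,X_r\rangle$ denotes the real Lie algebra generated by the listed vector fields; $\mathcal{A}_n=\langle V_0,\dots,V_{n-1}\rangle$ (abelian, dimension $n$); $\mathfrak{s}=\langle F_n,G_n,H_n\rangle\cong\mathfrak{sl}(2,\mathbb{R})$; $\dotplus$ denotes direct sum of vector spaces. For a vector field $\mathbf{v}=\xi(x,y)\partial_x+\psi(x,y)\partial_y$, its characteristic is $Q=\psi-\xi y_x$. Let $D_P$ denote the Fréchet derivative of a differential function $P$ and $D_P^*$ its formal adjoint. A Lie point symmetry $\mathbf{v}$ of $\Delta=0$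 is a divergence symmetry if $D_\Delta^*(Q)+D_Q^*(\Delta)=0$ identically (equivalently, the Euler operator applied to $Q\Delta$ vanishes identically). If $\Delta=0$ is equivalent to the Euler–Lagrange equation of a Lagrangian $L$, a Lie point symmetry $\mathbf{v}$ is a variational symmetry with respect to $L$ if $\mathrm{pr}\,\mathbf{v}(L)+L\,D_x\xi=0$ identically, where $\mathrm{pr}\,\mathbf{v}$ is the prolongation of $\mathbf{v}$ and $D_x$ the total derivative. $\mathcal{S}_{div}$ and $\mathcal{S}_{var}$ are the Lie algebras of all divergence, respectively variational, Lie point symmetries of $\Delta_n=0$. *)

theory Defs
  imports "HOL-Analysis.Analysis" "HOL-Library.Groups_Big_Fun"
begin

primrec Ck_on :: "nat \<Rightarrow> ('a::euclidean_space \<Rightarrow> 'b::real_normed_vector) \<Rightarrow> 'a set \<Rightarrow> bool" where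
  "Ck_on 0 f S \<longleftrightarrow> continuous_on S f"
| "Ck_on (Suc k) f S \<longleftrightarrow>
     (\<forall>x\<in>S. f differentiable at x) \<and>
     (\<forall>b\<in>Basis. Ck_on k (\<lambda>x. frechet_derivative f (at x) b) S)"

definition smooth_on :: "('a::euclidean_space \<Rightarrow> 'b::real_normed_vector) \<Rightarrow> 'a set \<Rightarrow> bool" where
  "smooth_on f S \<longleftrightarrow> (\<forall>k. Ck_on k f S)"

definition solves_source_eq :: "real set \<Rightarrow> (real \<Rightarrow> real) \<Rightarrow> (real \<Rightarrow> real) \<Rightarrow> bool" where
  "solves_source_eq I q u \<longleftrightarrow>
     (\<forall>x\<in>I. (u has_real_derivative deriv u x) (at x) \<and>
            (deriv u has_real_derivative - (q x * u x)) (at x))"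

definition lin_indep_on :: "real set \<Rightarrow> (real \<Rightarrow> real) \<Rightarrow> (real \<Rightarrow> real) \<Rightarrow> bool" where
  "lin_indep_on I u v \<longleftrightarrow> (\<forall>a b. (\<forall>x\<in>I. a * u x + b * v x = 0) \<longrightarrow> a = 0 \<and> b = 0)"

text \<open>
  A differential function \<open>P\<close> is evaluated at a point \<open>x\<close> and a jet \<open>j\<close>, where \<open>j k\<close> is the
  coordinate \<open>y\<^sup>(\<^sup>k\<^sup>)\<close>. All differential functions considered depend on finitely many
  jet coordinates, so that every \<open>Sum_any\<close> below is a finite sum. (\<open>Sum_any\<close> is the sum over the
  indices with a non-zero summand; it would be \<open>0\<close> if there were infinitely many of them.)
\<close>

type_synonym diff_fun = "real \<Rightarrow> (nat \<Rightarrow> real) \<Rightarrow> real"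

definition partial_x :: "diff_fun \<Rightarrow> diff_fun" where
  "partial_x P = (\<lambda>x j. deriv (\<lambda>t. P t j) x)"

definition partial_jet :: "nat \<Rightarrow> diff_fun \<Rightarrow> diff_fun" where
  "partial_jet k P = (\<lambda>x j. deriv (\<lambda>t. P x (j(k := t))) (j k))"

definition total_deriv :: "diff_fun \<Rightarrow> diff_fun" where
  "total_deriv P =
     (\<lambda>x j. partial_x P x j + Sum_any (\<lambda>k. j (Suc k) * partial_jet k P x j))"

text \<open>
  The differential operator \<open>\<Sum>\<^sub>k c\<^sub>k D\<^sub>x\<^sup>k\<close> is represented by its coefficients
  \<open>c\<close>; its formal adjoint is \<open>R \<mapsto> \<Sum>\<^sub>k (- D\<^sub>x)\<^sup>k (c\<^sub>k R)\<close>.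
\<close>

definition operator_apply :: "(nat \<Rightarrow> diff_fun) \<Rightarrow> diff_fun \<Rightarrow> diff_fun" where
  "operator_apply c R = (\<lambda>x j. Sum_any (\<lambda>k. c k x j * (total_deriv ^^ k) R x j))"

definition operator_adjoint :: "(nat \<Rightarrow> diff_fun) \<Rightarrow> diff_fun \<Rightarrow> diff_fun" where
  "operator_adjoint c R =
     (\<lambda>x j. Sum_any (\<lambda>k. ((\<lambda>P x j. - total_deriv P x j) ^^ k) (\<lambda>x j. c k x j * R x j) x j))"

definition frechet_coeffs :: "diff_fun \<Rightarrow> nat \<Rightarrow> diff_fun" where
  "frechet_coeffs P = (\<lambda>k. partial_jet k P)"

definition frechet_deriv :: "diff_fun \<Rightarrow> diff_fun \<Rightarrow> diff_fun" where
  "frechet_deriv P = operator_apply (frechet_coeffs P)"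

definition frechet_adjoint :: "diff_fun \<Rightarrow> diff_fun \<Rightarrow> diff_fun" where
  "frechet_adjoint P = operator_adjoint (frechet_coeffs P)"

text \<open>
  The value of a vector field at \<open>(x, y)\<close> is the pair of its components
  \<open>(\<xi>(x, y), \<psi>(x, y))\<close>. Vector fields over \<open>I\<close> are extended by zero outside \<open>I \<times> \<real>\<close>, so that
  equality of functions is equality of vector fields over \<open>I\<close>.
\<close>

type_synonym vfield = "real \<times> real \<Rightarrow> real \<times> real"

definition vfields :: "real set \<Rightarrow> vfield set" where
  "vfields I = {X. smooth_on X (I \<times> UNIV) \<and> (\<forall>x y. x \<notin> I \<longrightarrow> X (x, y) = 0)}"

definition mk_vfield ::
  "real set \<Rightarrow> (real \<Rightarrow> real \<Rightarrow> real) \<Rightarrow> (real \<Rightarrow> real \<Rightarrow> real) \<Rightarrow> vfield" where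
  "mk_vfield I \<xi> \<psi> = (\<lambda>(x, y). if x \<in> I then (\<xi> x y, \<psi> x y) else 0)"

definition vf_zero :: vfield where
  "vf_zero = (\<lambda>p. 0)"

definition vf_add :: "vfield \<Rightarrow> vfield \<Rightarrow> vfield" where
  "vf_add X Y = (\<lambda>p. X p + Y p)"

definition vf_scale :: "real \<Rightarrow> vfield \<Rightarrow> vfield" where
  "vf_scale c X = (\<lambda>p. c *\<^sub>R X p)"

text \<open>
  The derivatives below are unspecified where a field extended by zero fails to be differentiable
  at the boundary of \<open>I \<times> \<real>\<close>; the bracket is still zero there, since both fields vanish.
\<close>

definition vf_apply :: "vfield \<Rightarrow> vfield \<Rightarrow> vfield" where
  "vf_apply X Y = (\<lambda>(x, y).
     fst (X (x, y)) *\<^sub>R vector_derivative (\<lambda>t. Y (t, y)) (at x) +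
     snd (X (x, y)) *\<^sub>R vector_derivative (\<lambda>t. Y (x, t)) (at y))"

definition vf_bracket :: "vfield \<Rightarrow> vfield \<Rightarrow> vfield" where
  "vf_bracket X Y = (\<lambda>p. vf_apply X Y p - vf_apply Y X p)"

inductive_set lie_span :: "vfield set \<Rightarrow> vfield set" for S :: "vfield set" where
  gen: "X \<in> S \<Longrightarrow> X \<in> lie_span S"
| zero: "vf_zero \<in> lie_span S"
| add: "X \<in> lie_span S \<Longrightarrow> Y \<in> lie_span S \<Longrightarrow> vf_add X Y \<in> lie_span S"
| scale: "X \<in> lie_span S \<Longrightarrow> vf_scale c X \<in> lie_span S"
| bracket: "X \<in> lie_span S \<Longrightarrow> Y \<in> lie_span S \<Longrightarrow> vf_bracket X Y \<in> lie_span S"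

text \<open>For linear subspaces \<open>A\<close> and \<open>B\<close>, \<open>S\<close> is the direct sum of the vector spaces \<open>A\<close> and \<open>B\<close>.\<close>

definition is_direct_sum :: "vfield set \<Rightarrow> vfield set \<Rightarrow> vfield set \<Rightarrow> bool" where
  "is_direct_sum S A B \<longleftrightarrow> S = {vf_add X Y | X Y. X \<in> A \<and> Y \<in> B} \<and> A \<inter> B = {vf_zero}"

definition vf_xi :: "vfield \<Rightarrow> diff_fun" where
  "vf_xi X = (\<lambda>x j. fst (X (x, j 0)))"

definition vf_psi :: "vfield \<Rightarrow> diff_fun" where
  "vf_psi X = (\<lambda>x j. snd (X (x, j 0)))"

definition characteristic :: "vfield \<Rightarrow> diff_fun" where
  "characteristic X = (\<lambda>x j. vf_psi X x j - vf_xi X x j * j 1)"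

text \<open>
  The coefficient of \<open>\<partial>/\<partial>y\<^sup>(\<^sup>k\<^sup>)\<close> in the prolongation of a vector field with characteristic \<open>Q\<close>
  is \<open>D\<^sub>x\<^sup>k Q + \<xi> y\<^sup>(\<^sup>k\<^sup>+\<^sup>1\<^sup>)\<close>.
\<close>

definition prolong :: "vfield \<Rightarrow> diff_fun \<Rightarrow> diff_fun" where
  "prolong X P = (\<lambda>x j.
     vf_xi X x j * partial_x P x j +
     Sum_any (\<lambda>k. ((total_deriv ^^ k) (characteristic X) x j + vf_xi X x j * j (Suc k))
                   * partial_jet k P x j))"

definition point_symmetries :: "real set \<Rightarrow> diff_fun \<Rightarrow> vfield set" where
  "point_symmetries I \<Delta> =
     {X \<in> vfields I. \<forall>x\<in>I. \<forall>j. \<Delta> x j = 0 \<longrightarrow> prolong X \<Delta> x j = 0}"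

definition divergence_symmetries :: "real set \<Rightarrow> diff_fun \<Rightarrow> vfield set" where
  "divergence_symmetries I \<Delta> =
     {X \<in> point_symmetries I \<Delta>. \<forall>x\<in>I. \<forall>j.
        frechet_adjoint \<Delta> (characteristic X) x j + frechet_adjoint (characteristic X) \<Delta> x j = 0}"

definition variational_symmetries :: "real set \<Rightarrow> diff_fun \<Rightarrow> diff_fun \<Rightarrow> vfield set" where
  "variational_symmetries I \<Delta> L =
     {X \<in> point_symmetries I \<Delta>. \<forall>x\<in>I. \<forall>j.
        prolong X L x j + L x j * total_deriv (vf_xi X) x j = 0}"

text \<open>
  Under \<open>z = Z(x, y)\<close>, \<open>w = W(x, y)\<close> the jet coordinate \<open>w\<^sup>(\<^sup>k\<^sup>)\<close> (derivatives with respect to \<open>z\<close>)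
  becomes \<open>(D\<^sub>x Z)\<^sup>-\<^sup>1 D\<^sub>x\<close> iterated \<open>k\<close> times on \<open>W\<close>.
\<close>

definition transformed_jet :: "diff_fun \<Rightarrow> diff_fun \<Rightarrow> nat \<Rightarrow> diff_fun" where
  "transformed_jet Z W k = ((\<lambda>P x j. total_deriv P x j / total_deriv Z x j) ^^ k) W"

definition transform_fun :: "diff_fun \<Rightarrow> diff_fun \<Rightarrow> diff_fun \<Rightarrow> diff_fun" where
  "transform_fun Z W P = (\<lambda>x j. P (Z x j) (\<lambda>k. transformed_jet Z W k x j))"

definition transform_lagrangian :: "diff_fun \<Rightarrow> diff_fun \<Rightarrow> diff_fun \<Rightarrow> diff_fun" where
  "transform_lagrangian Z W L = (\<lambda>x j. transform_fun Z W L x j * total_deriv Z x j)"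

definition monic :: "nat \<Rightarrow> diff_fun \<Rightarrow> diff_fun" where
  "monic n P = (\<lambda>x j. P x j / partial_jet n P x j)"

definition new_z :: "(real \<Rightarrow> real) \<Rightarrow> diff_fun" where
  "new_z z = (\<lambda>x j. z x)"

definition new_w :: "nat \<Rightarrow> real \<Rightarrow> (real \<Rightarrow> real) \<Rightarrow> diff_fun" where
  "new_w n \<alpha> u = (\<lambda>x j. \<alpha> * u x powi (1 - int n) * j 0)"

definition Delta :: "nat \<Rightarrow> real \<Rightarrow> (real \<Rightarrow> real) \<Rightarrow> (real \<Rightarrow> real) \<Rightarrow> diff_fun" where
  "Delta n \<alpha> u z = monic n (transform_fun (new_z z) (new_w n \<alpha> u) (\<lambda>z w. w n))"

definition Lagrangian :: "nat \<Rightarrow> real \<Rightarrow> (real \<Rightarrow> real) \<Rightarrow> (real \<Rightarrow> real) \<Rightarrow> diff_fun" where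
  "Lagrangian n \<alpha> u z =
     transform_lagrangian (new_z z) (new_w n \<alpha> u)
       (\<lambda>z w. (-1) ^ (n div 2) / 2 * (w (n div 2))\<^sup>2)"

definition vf_V :: "real set \<Rightarrow> nat \<Rightarrow> (real \<Rightarrow> real) \<Rightarrow> (real \<Rightarrow> real) \<Rightarrow> nat \<Rightarrow> vfield" where
  "vf_V I n u v k = mk_vfield I (\<lambda>x y. 0) (\<lambda>x y. u x ^ (n - (k + 1)) * v x ^ k)"

definition vf_W :: "real set \<Rightarrow> vfield" where
  "vf_W I = mk_vfield I (\<lambda>x y. 0) (\<lambda>x y. y)"

definition vf_F :: "real set \<Rightarrow> nat \<Rightarrow> (real \<Rightarrow> real) \<Rightarrow> vfield" where
  "vf_F I n u = mk_vfield I (\<lambda>x y. (u x)\<^sup>2) (\<lambda>x y. (real n - 1) * u x * deriv u x * y)"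

definition vf_G :: "real set \<Rightarrow> nat \<Rightarrow> (real \<Rightarrow> real) \<Rightarrow> (real \<Rightarrow> real) \<Rightarrow> vfield" where
  "vf_G I n u v = mk_vfield I (\<lambda>x y. 2 * u x * v x)
     (\<lambda>x y. (real n - 1) * (u x * deriv v x + deriv u x * v x) * y)"

definition vf_H :: "real set \<Rightarrow> nat \<Rightarrow> (real \<Rightarrow> real) \<Rightarrow> vfield" where
  "vf_H I n v = mk_vfield I (\<lambda>x y. - (v x)\<^sup>2) (\<lambda>x y. - ((real n - 1) * v x * deriv v x * y))"

definition alg_A :: "real set \<Rightarrow> nat \<Rightarrow> (real \<Rightarrow> real) \<Rightarrow> (real \<Rightarrow> real) \<Rightarrow> vfield set" where
  "alg_A I n u v = lie_span {vf_V I n u v k | k. k \<le> n - 1}"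

definition alg_s :: "real set \<Rightarrow> nat \<Rightarrow> (real \<Rightarrow> real) \<Rightarrow> (real \<Rightarrow> real) \<Rightarrow> vfield set" where
  "alg_s I n u v = lie_span {vf_F I n u, vf_G I n u v, vf_H I n v}"

end

theory Submission
  imports Defs
begin

text \<open>
  In the coordinates \<open>z = \<integral> u\<^sup>-\<^sup>2 dx\<close>, \<open>w = \<alpha> u\<^sup>1\<^sup>-\<^sup>n y\<close> the equation is \<open>w\<^sup>(\<^sup>n\<^sup>) = 0\<close>, and both symmetry conditions
  become conditions on \<open>D\<^sub>z\<^sup>k Q\<close>, where \<open>D\<^sub>z = u\<^sup>2 D\<^sub>x\<close> and \<open>Q = \<psi> - \<xi> w'\<close> is the characteristic of a vector
  field \<open>\<xi> \<partial>\<^sub>z + \<psi> \<partial>\<^sub>w\<close>. The operator \<open>\<alpha>\<^sup>-\<^sup>1 u\<^sup>-\<^sup>n\<^sup>-\<^sup>1 D\<^sub>z\<^sup>n \<alpha> u\<^sup>1\<^sup>-\<^sup>n\<close> is a palindromic product of powers of \<open>u\<close>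
  and \<open>D\<^sub>x\<close>, so its adjoint is \<open>(- 1)\<^sup>n\<close> times itself (\<open>adjoint_T\<close>). Hence (\<open>divergence_condition\<close>) a field
  is a divergence symmetry only if
  \<open>(- 1)\<^sup>n D\<^sub>z\<^sup>n Q + \<xi> w\<^sup>(\<^sup>n\<^sup>+\<^sup>1\<^sup>) + (\<partial>\<psi>/\<partial>w + \<partial>\<xi>/\<partial>z) w\<^sup>(\<^sup>n\<^sup>) = 0\<close>, and, for \<open>n = 2 m\<close>, a variational
  symmetry only if \<open>D\<^sub>z\<^sup>m Q + \<xi> w\<^sup>(\<^sup>m\<^sup>+\<^sup>1\<^sup>) + w\<^sup>(\<^sup>m\<^sup>) D\<^sub>z \<xi> / 2 = 0\<close> wherever \<open>w\<^sup>(\<^sup>m\<^sup>) \<noteq> 0\<close>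
  (\<open>variational_condition\<close>).

  These conditions alone, without a prior classification of the point symmetries, determine the field.
  The leading terms (\<open>Dz_iter_first_order\<close>) give \<open>\<partial>\<xi>/\<partial>w = 0\<close>, and even \<open>\<xi> = 0\<close> for odd \<open>n\<close>, and show that
  \<open>\<psi> = A(z) w + B(z)\<close>. The conditions are then linear in the jet of \<open>w\<close>, and comparison of coefficients
  (\<open>affine_coefficients\<close>) gives \<open>B\<^sup>(\<^sup>n\<^sup>) = 0\<close> and \<open>A' = 0\<close> for odd \<open>n\<close>; \<open>B\<^sup>(\<^sup>n\<^sup>) = 0\<close>, \<open>A = (n - 1) \<xi>' / 2\<close> and
  \<open>\<xi>''' = 0\<close> for even \<open>n\<close>; and \<open>B\<^sup>(\<^sup>m\<^sup>) = 0\<close>, \<open>A = (n - 1) \<xi>' / 2\<close> and \<open>\<xi>'' = 0\<close> in the variational case. As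
  \<open>z = v / u\<close> up to a constant, the polynomials \<open>1, z, z\<^sup>2\<close> for \<open>\<xi>\<close> correspond to \<open>F, G, H\<close>, and the powers of
  \<open>z\<close> for \<open>B\<close> to the fields \<open>V\<^sub>k\<close>. Conversely, all these fields satisfy the conditions and are point symmetries
  by a finite Leibniz expansion (\<open>sym_field_zw_char_iter\<close>).

  The calculation takes place in the algebra \<open>jet_alg I\<close> of polynomials in the derivatives of \<open>y\<close> whose
  coefficients are smooth functions of \<open>(x, y)\<close>, on which the total derivative is a derivation.
\<close>

section \<open>Smooth functions of one and two variables\<close>

lemma Ck_on_cong_imp:
  assumes "open S" "\<And>x. x \<in> S \<Longrightarrow> f x = g x" "Ck_on k f S"
  shows "Ck_on k g S"
  using assms(2,3)
proof (induction k arbitrary: f g)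
  case 0
  then show ?case using continuous_on_cong[of S S f g] by simp
next
  case (Suc k)
  have d: "(g has_derivative frechet_derivative f (at x)) (at x)" if "x \<in> S" for x
  proof -
    have "(f has_derivative frechet_derivative f (at x)) (at x)"
      using Suc.prems(2) that frechet_derivative_works by auto
    then show ?thesis
      using has_derivative_transform_within_open[OF _ assms(1) that] Suc.prems(1) by blast
  qed
  have eq: "frechet_derivative g (at x) = frechet_derivative f (at x)" if "x \<in> S" for x
    using frechet_derivative_at[OF d[OF that]] by simp
  show ?case
    using Suc.IH[of "\<lambda>x. frechet_derivative f (at x) b" "\<lambda>x. frechet_derivative g (at x) b" for b]
      Suc.prems(2) d eq by (auto simp: differentiable_def)
qed

lemma Ck_on_SucI:
  assumes "open S" "\<And>x. x \<in> S \<Longrightarrow> (f has_derivative f' x) (at x)"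
    and "\<And>b. b \<in> Basis \<Longrightarrow> Ck_on k (\<lambda>x. f' x b) S"
  shows "Ck_on (Suc k) f S"
proof -
  have eq: "frechet_derivative f (at x) = f' x" if "x \<in> S" for x
    using frechet_derivative_at[OF assms(2)[OF that]] by simp
  have "Ck_on k (\<lambda>x. frechet_derivative f (at x) b) S" if "b \<in> Basis" for b
    using Ck_on_cong_imp[OF assms(1) _ assms(3)[OF that], of "\<lambda>x. frechet_derivative f (at x) b"] eq
    by simp
  then show ?thesis using assms(2) by (auto simp: differentiable_def)
qed

lemma Ck_on_has_derivative:
  assumes "Ck_on (Suc k) f S" "x \<in> S"
  shows "(f has_derivative frechet_derivative f (at x)) (at x)"
  using assms frechet_derivative_works by auto

lemma Ck_on_Suc_imp: "Ck_on (Suc k) f S \<Longrightarrow> Ck_on k f S"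
proof (induction k arbitrary: f)
  case 0
  then show ?case
    using differentiable_imp_continuous_within by (auto intro!: continuous_at_imp_continuous_on)
next
  case (Suc k)
  then show ?case using Ck_on.simps(2)[of k f S] Ck_on.simps(2)[of "Suc k" f S] by blast
qed

lemma Ck_on_const: "Ck_on k (\<lambda>x. c) S"
  by (induction k arbitrary: c) (auto simp: frechet_derivative_const)

lemma Ck_on_add:
  assumes "open S" "Ck_on k f S" "Ck_on k g S"
  shows "Ck_on k (\<lambda>x. f x + g x) S"
  using assms(2,3)
proof (induction k arbitrary: f g)
  case 0
  then show ?case by (simp add: continuous_on_add)
next
  case (Suc k)
  show ?case
    by (rule Ck_on_SucI[OF assms(1) has_derivative_add[OF Ck_on_has_derivative[OF Suc.prems(1)]
            Ck_on_has_derivative[OF Suc.prems(2)]]])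
      (use Suc in auto)
qed

lemma Ck_on_bounded_linear:
  assumes "open S" "bounded_linear L" "Ck_on k f S"
  shows "Ck_on k (\<lambda>x. L (f x)) S"
  using assms(3)
proof (induction k arbitrary: f)
  case 0
  then show ?case using assms(2) by (simp add: bounded_linear.continuous_on)
next
  case (Suc k)
  show ?case
    by (rule Ck_on_SucI[OF assms(1) bounded_linear.has_derivative[OF assms(2)
            Ck_on_has_derivative[OF Suc.prems(1)]]])
      (use Suc in auto)
qed

lemma Ck_on_mult:
  fixes f g :: "'a::euclidean_space \<Rightarrow> real"
  assumes "open S" "Ck_on k f S" "Ck_on k g S"
  shows "Ck_on k (\<lambda>x. f x * g x) S"
  using assms(2,3)
proof (induction k arbitrary: f g)
  case 0
  then show ?case by (simp add: continuous_on_mult)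
next
  case (Suc k)
  show ?case
    by (rule Ck_on_SucI[OF assms(1) has_derivative_mult[OF Ck_on_has_derivative[OF Suc.prems(1)]
            Ck_on_has_derivative[OF Suc.prems(2)]]])
      (use Suc.prems Ck_on_Suc_imp[OF Suc.prems(1)] Ck_on_Suc_imp[OF Suc.prems(2)]
        in \<open>auto intro!: Ck_on_add[OF assms(1)] Suc.IH\<close>)
qed

lemma Basis_real_pair: "(Basis :: (real \<times> real) set) = {(1, 0), (0, 1)}"
  by (auto simp: Basis_prod_def)

text \<open>
  Smooth functions of the independent variable are identified with smooth functions of
  \<open>(x, y)\<close> that do not depend on \<open>y\<close>.
\<close>

definition smooth2 :: "real set \<Rightarrow> (real \<times> real \<Rightarrow> real) \<Rightarrow> bool" where
  "smooth2 I a \<longleftrightarrow> smooth_on a (I \<times> UNIV)"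

definition smooth1 :: "real set \<Rightarrow> (real \<Rightarrow> real) \<Rightarrow> bool" where
  "smooth1 I h \<longleftrightarrow> smooth2 I (\<lambda>p. h (fst p))"

text \<open>
  The partial derivatives \<open>\<partial>a/\<partial>x\<close> and \<open>\<partial>a/\<partial>y\<close>.
\<close>

definition dx :: "(real \<times> real \<Rightarrow> real) \<Rightarrow> real \<times> real \<Rightarrow> real" where
  "dx a p = frechet_derivative a (at p) (1, 0)"

definition dy :: "(real \<times> real \<Rightarrow> real) \<Rightarrow> real \<times> real \<Rightarrow> real" where
  "dy a p = frechet_derivative a (at p) (0, 1)"

lemma smooth2_differentiable:
  assumes "smooth2 I a" "x \<in> I"
  shows "(a has_derivative (\<lambda>h. fst h * dx a (x, y) + snd h * dy a (x, y))) (at (x, y))"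
proof -
  have "Ck_on (Suc 0) a (I \<times> UNIV)" using assms unfolding smooth2_def smooth_on_def by blast
  then have d: "(a has_derivative frechet_derivative a (at (x, y))) (at (x, y))"
    by (rule Ck_on_has_derivative) (use assms(2) in simp)
  then have l: "linear (frechet_derivative a (at (x, y)))" by (rule has_derivative_linear)
  have "frechet_derivative a (at (x, y)) h = fst h * dx a (x, y) + snd h * dy a (x, y)" for h
  proof -
    have "h = fst h *\<^sub>R (1, 0) + snd h *\<^sub>R (0, 1)" by (cases h) simp
    then have "frechet_derivative a (at (x, y)) h =
        fst h *\<^sub>R frechet_derivative a (at (x, y)) (1, 0) + snd h *\<^sub>R frechet_derivative a (at (x, y)) (0, 1)"
      using linear_add[OF l] linear_scale[OF l] by metis
    then show ?thesis by (simp add: dx_def dy_def)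
  qed
  then have "frechet_derivative a (at (x, y)) = (\<lambda>h. fst h * dx a (x, y) + snd h * dy a (x, y))"
    by (rule ext)
  with d show ?thesis by simp
qed

lemma smooth2_dx: "smooth2 I a \<Longrightarrow> smooth2 I (dx a)"
  unfolding smooth2_def smooth_on_def
proof
  fix k assume "\<forall>k. Ck_on k a (I \<times> UNIV)"
  then have "Ck_on (Suc k) a (I \<times> UNIV)" by blast
  then have "Ck_on k (\<lambda>p. frechet_derivative a (at p) (1, 0)) (I \<times> UNIV)"
    by (simp add: Basis_real_pair)
  then show "Ck_on k (dx a) (I \<times> UNIV)" by (simp add: dx_def[abs_def])
qed

lemma smooth2_dy: "smooth2 I a \<Longrightarrow> smooth2 I (dy a)"
  unfolding smooth2_def smooth_on_def
proof
  fix k assume "\<forall>k. Ck_on k a (I \<times> UNIV)"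
  then have "Ck_on (Suc k) a (I \<times> UNIV)" by blast
  then have "Ck_on k (\<lambda>p. frechet_derivative a (at p) (0, 1)) (I \<times> UNIV)"
    by (simp add: Basis_real_pair)
  then show "Ck_on k (dy a) (I \<times> UNIV)" by (simp add: dy_def[abs_def])
qed

lemma smooth2_dx_at:
  assumes "smooth2 I a" "x \<in> I"
  shows "((\<lambda>t. a (t, y)) has_real_derivative dx a (x, y)) (at x)"
proof -
  have "((\<lambda>t. (t, y)) has_derivative (\<lambda>h. (h, 0))) (at x)" by (auto intro!: derivative_eq_intros)
  from has_derivative_compose[OF this smooth2_differentiable[OF assms]]
  show ?thesis by (simp add: has_field_derivative_def mult_commute_abs)
qed

lemma smooth2_dy_at:
  assumes "smooth2 I a" "x \<in> I"
  shows "((\<lambda>t. a (x, t)) has_real_derivative dy a (x, y)) (at y)"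
proof -
  have "((\<lambda>t. (x, t)) has_derivative (\<lambda>h. (0, h))) (at y)" by (auto intro!: derivative_eq_intros)
  from has_derivative_compose[OF this smooth2_differentiable[OF assms]]
  show ?thesis by (simp add: has_field_derivative_def mult_commute_abs)
qed

lemma open_strip: "open I \<Longrightarrow> open (I \<times> (UNIV :: real set))"
  by (simp add: open_Times)

lemma smooth2_cong:
  assumes "open I" "\<And>x y. x \<in> I \<Longrightarrow> a (x, y) = b (x, y)" "smooth2 I a"
  shows "smooth2 I b"
  using assms(3) Ck_on_cong_imp[OF open_strip[OF assms(1)], of a b] assms(2)
  unfolding smooth2_def smooth_on_def by auto

lemma smooth1_cong:
  assumes "open I" "\<And>x. x \<in> I \<Longrightarrow> f x = g x" "smooth1 I f"
  shows "smooth1 I g"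
  using smooth2_cong[OF assms(1), of "\<lambda>p. f (fst p)" "\<lambda>p. g (fst p)"] assms unfolding smooth1_def by auto

lemma smooth2_const: "smooth2 I (\<lambda>p. c)"
  by (simp add: smooth2_def smooth_on_def Ck_on_const)

lemma smooth2_add: "open I \<Longrightarrow> smooth2 I a \<Longrightarrow> smooth2 I b \<Longrightarrow> smooth2 I (\<lambda>p. a p + b p)"
  by (simp add: smooth2_def smooth_on_def Ck_on_add open_strip)

lemma smooth2_mult: "open I \<Longrightarrow> smooth2 I a \<Longrightarrow> smooth2 I b \<Longrightarrow> smooth2 I (\<lambda>p. a p * b p)"
  by (simp add: smooth2_def smooth_on_def Ck_on_mult open_strip)

lemma smooth2_cmult: "open I \<Longrightarrow> smooth2 I a \<Longrightarrow> smooth2 I (\<lambda>p. c * a p)"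
  by (intro smooth2_mult smooth2_const)

lemma smooth2_uminus: "open I \<Longrightarrow> smooth2 I a \<Longrightarrow> smooth2 I (\<lambda>p. - a p)"
  using smooth2_cmult[of I a "-1"] by simp

lemma smooth2_diff: "open I \<Longrightarrow> smooth2 I a \<Longrightarrow> smooth2 I b \<Longrightarrow> smooth2 I (\<lambda>p. a p - b p)"
  using smooth2_add[OF _ _ smooth2_uminus, of I a b] by simp

lemma smooth2_power: "open I \<Longrightarrow> smooth2 I a \<Longrightarrow> smooth2 I (\<lambda>p. a p ^ k)"
  by (induction k) (simp_all add: smooth2_const smooth2_mult)

lemma smooth2_SucI:
  fixes a ax ay :: "real \<times> real \<Rightarrow> real"
  assumes "open I"
    and "\<And>x y. x \<in> I \<Longrightarrow> (a has_derivative (\<lambda>h. fst h * ax (x, y) + snd h * ay (x, y))) (at (x, y))"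
    and "Ck_on k ax (I \<times> UNIV)" "Ck_on k ay (I \<times> UNIV)"
  shows "Ck_on (Suc k) a (I \<times> UNIV)"
  by (rule Ck_on_SucI[OF open_strip[OF assms(1)], of _ "\<lambda>p h. fst h * ax p + snd h * ay p"])
    (use assms in \<open>auto simp: Basis_real_pair\<close>)

lemma smooth2_snd: "open I \<Longrightarrow> smooth2 I snd"
  unfolding smooth2_def smooth_on_def
proof
  fix k assume "open I"
  show "Ck_on k snd (I \<times> (UNIV :: real set))"
  proof (cases k)
    case 0
    then show ?thesis by (simp add: continuous_on_snd)
  next
    case (Suc l)
    show ?thesis unfolding Suc
      by (rule smooth2_SucI[OF \<open>open I\<close>, of _ "\<lambda>p. 0" "\<lambda>p. 1"])
        (auto intro!: derivative_eq_intros Ck_on_const)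
  qed
qed

lemma fst_has_derivative:
  assumes "(h has_real_derivative h') (at x)"
  shows "((\<lambda>p. h (fst p)) has_derivative (\<lambda>k. fst k * h' + snd k * 0)) (at (x, y))"
proof -
  have "(fst has_derivative fst) (at (x, y))" by (auto intro!: derivative_eq_intros)
  from has_derivative_compose[OF this, of h "(*) h'"] assms
  show ?thesis by (simp add: has_field_derivative_def mult.commute)
qed

lemma smooth1_SucI:
  assumes "open I" "\<And>x. x \<in> I \<Longrightarrow> (h has_real_derivative h' x) (at x)"
    and "Ck_on k (\<lambda>p. h' (fst p)) (I \<times> (UNIV :: real set))"
  shows "Ck_on (Suc k) (\<lambda>p. h (fst p)) (I \<times> (UNIV :: real set))"
  by (rule smooth2_SucI[OF assms(1), of _ "\<lambda>p. h' (fst p)" "\<lambda>p. 0"])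
    (use fst_has_derivative[OF assms(2)] assms(3) in \<open>auto simp: Ck_on_const\<close>)

lemma smooth1_differentiable:
  assumes "smooth1 I h" "x \<in> I"
  shows "(h has_real_derivative deriv h x) (at x)"
proof -
  have "(h has_real_derivative dx (\<lambda>p. h (fst p)) (x, 0)) (at x)"
    using smooth2_dx_at[OF assms(1)[unfolded smooth1_def] assms(2), of 0] by simp
  then show ?thesis using DERIV_imp_deriv by metis
qed

lemma smooth1_deriv:
  assumes "open I" "smooth1 I h"
  shows "smooth1 I (deriv h)"
proof -
  have "dx (\<lambda>p. h (fst p)) (x, y) = deriv h x" if "x \<in> I" for x y
    using DERIV_imp_deriv[OF smooth2_dx_at[OF assms(2)[unfolded smooth1_def] that, of y]] by simp
  then show ?thesis
    using smooth2_cong[OF assms(1) _ smooth2_dx[OF assms(2)[unfolded smooth1_def]],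
        of "\<lambda>p. deriv h (fst p)"] unfolding smooth1_def by simp
qed

lemma smooth1_const: "smooth1 I (\<lambda>p. c)"
  by (simp add: smooth1_def smooth2_const)

lemma smooth1_add: "open I \<Longrightarrow> smooth1 I a \<Longrightarrow> smooth1 I b \<Longrightarrow> smooth1 I (\<lambda>x. a x + b x)"
  by (simp add: smooth1_def smooth2_add)

lemma smooth1_mult: "open I \<Longrightarrow> smooth1 I a \<Longrightarrow> smooth1 I b \<Longrightarrow> smooth1 I (\<lambda>x. a x * b x)"
  by (simp add: smooth1_def smooth2_mult)

lemma smooth1_diff: "open I \<Longrightarrow> smooth1 I a \<Longrightarrow> smooth1 I b \<Longrightarrow> smooth1 I (\<lambda>x. a x - b x)"
  by (simp add: smooth1_def smooth2_diff)

lemma smooth1_uminus: "open I \<Longrightarrow> smooth1 I a \<Longrightarrow> smooth1 I (\<lambda>x. - a x)"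
  by (simp add: smooth1_def smooth2_uminus)

lemma smooth1_power: "open I \<Longrightarrow> smooth1 I a \<Longrightarrow> smooth1 I (\<lambda>x. a x ^ k)"
  by (simp add: smooth1_def smooth2_power)

lemma smooth1_sum:
  assumes "open I" "\<And>i. i \<in> A \<Longrightarrow> smooth1 I (a i)"
  shows "smooth1 I (\<lambda>x. \<Sum>i\<in>A. a i x)"
  using assms(2)
  by (induction A rule: infinite_finite_induct) (simp_all add: smooth1_const smooth1_add[OF assms(1)])

lemma smooth1_imp_smooth2: "smooth1 I h \<Longrightarrow> smooth2 I (\<lambda>p. h (fst p))"
  by (simp add: smooth1_def)

lemma smooth1_inverse:
  assumes "open I" "smooth1 I h" "\<And>x. x \<in> I \<Longrightarrow> h x \<noteq> 0"
  shows "smooth1 I (\<lambda>x. inverse (h x))"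
  unfolding smooth1_def smooth2_def smooth_on_def
proof
  fix k
  show "Ck_on k (\<lambda>p. inverse (h (fst p))) (I \<times> (UNIV :: real set))"
  proof (induction k)
    case 0
    have "Ck_on 0 (\<lambda>p. h (fst p)) (I \<times> (UNIV :: real set))"
      using assms(2) unfolding smooth1_def smooth2_def smooth_on_def by blast
    then show ?case using assms(3) by (auto intro!: continuous_on_inverse)
  next
    case (Suc k)
    show ?case
    proof (rule smooth1_SucI[OF assms(1), where h' = "\<lambda>x. - deriv h x * (inverse (h x) * inverse (h x))"])
      fix x assume "x \<in> I"
      then show "((\<lambda>x. inverse (h x)) has_real_derivative - deriv h x * (inverse (h x) * inverse (h x))) (at x)"
        using smooth1_differentiable[OF assms(2)] assms(3)
        by (auto intro!: derivative_eq_intros simp: power2_eq_square)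
    next
      have "Ck_on k (\<lambda>p. - deriv h (fst p)) (I \<times> (UNIV :: real set))"
        using smooth1_uminus[OF assms(1) smooth1_deriv[OF assms(1,2)]]
        unfolding smooth1_def smooth2_def smooth_on_def by blast
      then show "Ck_on k (\<lambda>p. - deriv h (fst p) * (inverse (h (fst p)) * inverse (h (fst p)))) (I \<times> (UNIV :: real set))"
        by (intro Ck_on_mult open_strip assms(1) Suc.IH)
    qed
  qed
qed

lemma smooth_on_imp_smooth1:
  assumes "open I" "smooth_on q I"
  shows "smooth1 I q"
proof -
  have "Ck_on k q I \<Longrightarrow> Ck_on k (\<lambda>p. q (fst p)) (I \<times> (UNIV :: real set))" for k
  proof (induction k arbitrary: q)
    case 0
    then show ?case
      by (auto intro!: continuous_on_compose2[of I q _ fst] continuous_intros)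
  next
    case (Suc k)
    have d: "(q has_real_derivative frechet_derivative q (at x) 1) (at x)" if "x \<in> I" for x
    proof -
      have d: "(q has_derivative frechet_derivative q (at x)) (at x)"
        using Ck_on_has_derivative[OF Suc.prems that] .
      have "frechet_derivative q (at x) h = frechet_derivative q (at x) 1 * h" for h
        using linear_scale[OF has_derivative_linear[OF d], of h 1] by simp
      then have "frechet_derivative q (at x) = (*) (frechet_derivative q (at x) 1)" by (rule ext)
      with d show ?thesis by (simp add: has_field_derivative_def)
    qed
    show ?case
      by (rule smooth1_SucI[OF assms(1) d Suc.IH]) (use Suc.prems in auto)
  qed
  then show ?thesis using assms(2) unfolding smooth1_def smooth2_def smooth_on_def by blast
qed

lemma solution_smooth1:
  assumes "open I" "smooth1 I q" "solves_source_eq I q u"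
  shows "smooth1 I u"
proof -
  have du: "x \<in> I \<Longrightarrow> (u has_real_derivative deriv u x) (at x)"
    and ddu: "x \<in> I \<Longrightarrow> (deriv u has_real_derivative - q x * u x) (at x)" for x
    using assms(3) unfolding solves_source_eq_def by auto
  have mq: "Ck_on k (\<lambda>p. - q (fst p)) (I \<times> (UNIV :: real set))" for k
    using smooth1_uminus[OF assms(1,2)] unfolding smooth1_def smooth2_def smooth_on_def by blast
  have "Ck_on k (\<lambda>p. u (fst p)) (I \<times> (UNIV :: real set)) \<and>
        Ck_on k (\<lambda>p. deriv u (fst p)) (I \<times> (UNIV :: real set))" for k
  proof (induction k)
    case 0
    have "continuous_on I u" "continuous_on I (deriv u)"
      using du ddu by (meson DERIV_isCont continuous_at_imp_continuous_on)+
    then show ?case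
      by (auto intro!: continuous_on_compose2[of I _ _ fst] continuous_intros)
  next
    case (Suc k)
    then show ?case
      using smooth1_SucI[OF assms(1) du] smooth1_SucI[OF assms(1) ddu]
        Ck_on_mult[OF open_strip[OF assms(1)] mq, of k "\<lambda>p. u (fst p)"] by auto
  qed
  then show ?thesis unfolding smooth1_def smooth2_def smooth_on_def by blast
qed

lemma smooth2_restrict:
  assumes "open I" "smooth2 I a"
  shows "smooth1 I (\<lambda>x. a (x, c))"
proof -
  have "smooth2 I a \<Longrightarrow> Ck_on k (\<lambda>p. a (fst p, c)) (I \<times> (UNIV :: real set))" for k
  proof (induction k arbitrary: a)
    case 0
    then have "continuous_on (I \<times> UNIV) a" unfolding smooth2_def smooth_on_def using Ck_on.simps(1) by blast
    then show ?case
      by (auto intro!: continuous_on_compose2[of "I \<times> UNIV" a] continuous_intros)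
  next
    case (Suc k)
    show ?case
      using smooth1_SucI[OF assms(1) smooth2_dx_at[OF Suc.prems] Suc.IH[OF smooth2_dx[OF Suc.prems]]] .
  qed
  then show ?thesis using assms(2) unfolding smooth1_def smooth2_def smooth_on_def by blast
qed

text \<open>
  The components of a vector field along \<open>x\<close> and \<open>y\<close>.
\<close>

abbreviation xcomp :: "vfield \<Rightarrow> real \<times> real \<Rightarrow> real" where
  "xcomp X \<equiv> \<lambda>q. fst (X q)"

abbreviation ycomp :: "vfield \<Rightarrow> real \<times> real \<Rightarrow> real" where
  "ycomp X \<equiv> \<lambda>q. snd (X q)"

lemma smooth_on_pair:
  assumes "open I"
  shows "smooth_on X (I \<times> (UNIV :: real set)) \<longleftrightarrow> smooth2 I (xcomp X) \<and> smooth2 I (ycomp X)"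
    (is "?l \<longleftrightarrow> ?r")
proof
  assume ?l
  then show ?r unfolding smooth2_def smooth_on_def
    using Ck_on_bounded_linear[OF open_strip[OF assms] bounded_linear_fst]
      Ck_on_bounded_linear[OF open_strip[OF assms] bounded_linear_snd] by blast
next
  assume ?r
  then have c: "Ck_on k (\<lambda>p. fst (X p) *\<^sub>R (1 :: real, 0 :: real) + snd (X p) *\<^sub>R (0, 1)) (I \<times> UNIV)" for k
    unfolding smooth2_def smooth_on_def
    using Ck_on_bounded_linear[OF open_strip[OF assms] bounded_linear_scaleR_left]
    by (intro Ck_on_add open_strip assms) blast+
  have e: "(\<lambda>p. fst (X p) *\<^sub>R (1 :: real, 0 :: real) + snd (X p) *\<^sub>R (0, 1)) = X"
    by (rule ext) simp
  have "Ck_on k X (I \<times> UNIV)" for k using c[of k] unfolding e .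
  then show ?l unfolding smooth_on_def by blast
qed

section \<open>The algebra of differential functions\<close>

text \<open>
  The differential functions generated by smooth functions of \<open>(x, y)\<close> over \<open>I\<close> and by the jet
  coordinates: polynomials in \<open>y', y'', \<dots>\<close> with coefficients that are smooth in \<open>(x, y)\<close>.
  Nothing is required of their values for \<open>x \<notin> I\<close>.
\<close>

inductive_set jet_alg :: "real set \<Rightarrow> diff_fun set" for I :: "real set" where
  base: "smooth2 I a \<Longrightarrow> (\<lambda>x j. a (x, j 0)) \<in> jet_alg I"
| coord: "(\<lambda>x j. j k) \<in> jet_alg I"
| add: "P \<in> jet_alg I \<Longrightarrow> Q \<in> jet_alg I \<Longrightarrow> (\<lambda>x j. P x j + Q x j) \<in> jet_alg I"
| mult: "P \<in> jet_alg I \<Longrightarrow> Q \<in> jet_alg I \<Longrightarrow> (\<lambda>x j. P x j * Q x j) \<in> jet_alg I"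

text \<open>
  \<open>P\<close> depends on no jet coordinate of order greater than \<open>N\<close>.
\<close>

definition order_le :: "nat \<Rightarrow> diff_fun \<Rightarrow> bool" where
  "order_le N P \<longleftrightarrow> (\<forall>x j j'. (\<forall>k\<le>N. j k = j' k) \<longrightarrow> P x j = P x j')"

lemma order_leD: "order_le N P \<Longrightarrow> (\<And>k. k \<le> N \<Longrightarrow> j k = j' k) \<Longrightarrow> P x j = P x j'"
  unfolding order_le_def by blast

lemma order_le_mono: "order_le N P \<Longrightarrow> N \<le> M \<Longrightarrow> order_le M P"
  unfolding order_le_def by (meson order_trans)

lemma order_le_add: "order_le N P \<Longrightarrow> order_le N Q \<Longrightarrow> order_le N (\<lambda>x j. P x j + Q x j)"
  unfolding order_le_def by metis

lemma order_le_diff: "order_le N P \<Longrightarrow> order_le N Q \<Longrightarrow> order_le N (\<lambda>x j. P x j - Q x j)"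
  unfolding order_le_def by metis

lemma order_le_mult: "order_le N P \<Longrightarrow> order_le N Q \<Longrightarrow> order_le N (\<lambda>x j. P x j * Q x j)"
  unfolding order_le_def by metis

lemma order_le_fun: "order_le N (\<lambda>x j. h x)"
  unfolding order_le_def by simp

lemma order_le_base: "order_le N (\<lambda>x j. a (x, j 0))"
  unfolding order_le_def by simp

lemma order_le_coord: "k \<le> N \<Longrightarrow> order_le N (\<lambda>x j. j k)"
  unfolding order_le_def by simp

lemma order_le_sum:
  "(\<And>i. i \<in> A \<Longrightarrow> order_le N (P i)) \<Longrightarrow> order_le N (\<lambda>x j. \<Sum>i\<in>A. P i x j)"
  unfolding order_le_def by (auto intro!: sum.cong)

lemma order_le_common:
  assumes "order_le M P" "order_le N Q"
  obtains K where "order_le K P" "order_le K Q"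
  using order_le_mono[OF assms(1), of "max M N"] order_le_mono[OF assms(2), of "max M N"] that by simp

lemma jet_alg_order: "P \<in> jet_alg I \<Longrightarrow> \<exists>N. order_le N P"
proof (induction rule: jet_alg.induct)
  case (base a)
  show ?case by (intro exI[of _ 0] order_le_base)
next
  case (coord k)
  show ?case by (intro exI[of _ k] order_le_coord) simp
next
  case (add P Q)
  then obtain M N where "order_le M P" "order_le N Q" by blast
  then obtain K where "order_le K P" "order_le K Q" by (rule order_le_common)
  then show ?case by (intro exI[of _ K] order_le_add)
next
  case (mult P Q)
  then obtain M N where "order_le M P" "order_le N Q" by blast
  then obtain K where "order_le K P" "order_le K Q" by (rule order_le_common)
  then show ?case by (intro exI[of _ K] order_le_mult)
qed

lemma partial_jet_eq_0: "order_le N P \<Longrightarrow> N < k \<Longrightarrow> partial_jet k P x j = 0"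
proof -
  assume P: "order_le N P" and "N < k"
  then have "P x (j(k := t)) = P x j" for t by (intro order_leD[OF P]) auto
  then show ?thesis by (simp add: partial_jet_def)
qed

lemma total_deriv_eq_sum:
  assumes "order_le N P"
  shows "total_deriv P x j = partial_x P x j + (\<Sum>k\<le>N. j (Suc k) * partial_jet k P x j)"
proof -
  have "{k. j (Suc k) * partial_jet k P x j \<noteq> 0} \<subseteq> {..N}"
    using partial_jet_eq_0[OF assms] by (auto simp: not_le[symmetric])
  then show ?thesis unfolding total_deriv_def by (simp add: Sum_any.expand_superset)
qed

lemma order_le_partial_x: "order_le N P \<Longrightarrow> order_le N (partial_x P)"
proof -
  assume P: "order_le N P"
  have "(\<lambda>t. P t j) = (\<lambda>t. P t j')" if "\<forall>k\<le>N. j k = j' k" for j j'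
    using that by (intro ext order_leD[OF P]) simp
  then show ?thesis unfolding order_le_def partial_x_def by metis
qed

lemma order_le_partial_jet: "order_le N P \<Longrightarrow> order_le N (partial_jet k P)"
proof -
  assume P: "order_le N P"
  show ?thesis
  proof (cases "k \<le> N")
    case False
    then show ?thesis using partial_jet_eq_0[OF P] unfolding order_le_def by simp
  next
    case True
    have "(\<lambda>t. P x (j(k := t))) = (\<lambda>t. P x (j'(k := t)))" if "\<forall>k\<le>N. j k = j' k" for x j j'
      using that by (intro ext order_leD[OF P]) simp
    then show ?thesis unfolding order_le_def partial_jet_def using True by metis
  qed
qed

locale open_interval =
  fixes I :: "real set"
  assumes open_I: "open I"
begin

text \<open>
  The values of \<open>deriv\<close> in the definition of the formal partial derivatives are genuine derivatives
  on \<open>jet_alg I\<close> over \<open>I\<close>; hence these obey the sum and product rules there.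
\<close>

lemma jet_alg_partial_x:
  assumes "P \<in> jet_alg I" "x \<in> I"
  shows "((\<lambda>t. P t j) has_real_derivative partial_x P x j) (at x)"
proof -
  have "\<exists>d. ((\<lambda>t. P t j) has_real_derivative d) (at x)"
    using assms(1)
  proof (induction rule: jet_alg.induct)
    case (base a)
    show ?case by (rule exI, rule smooth2_dx_at[OF base assms(2)])
  next
    case (coord k)
    then show ?case by (auto intro: DERIV_const)
  next
    case (add P Q)
    then show ?case by (elim exE) (rule exI, rule DERIV_add)
  next
    case (mult P Q)
    then show ?case by (elim exE) (rule exI, rule DERIV_mult)
  qed
  then show ?thesis unfolding partial_x_def using DERIV_imp_deriv by metis
qed

lemma jet_alg_partial_jet:
  assumes "P \<in> jet_alg I" "x \<in> I"
  shows "((\<lambda>t. P x (j(k := t))) has_real_derivative partial_jet k P x j) (at (j k))"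
proof -
  have "\<exists>d. ((\<lambda>t. P x (j(k := t))) has_real_derivative d) (at (j k))"
    using assms(1)
  proof (induction rule: jet_alg.induct)
    case (base a)
    then show ?case
      using smooth2_dy_at[OF base assms(2)] by (cases "k = 0") (auto intro: DERIV_const)
  next
    case (coord l)
    then show ?case by (cases "k = l") (auto intro: DERIV_const DERIV_ident)
  next
    case (add P Q)
    then show ?case by (elim exE) (rule exI, rule DERIV_add)
  next
    case (mult P Q)
    then show ?case by (elim exE) (rule exI, rule DERIV_mult)
  qed
  then show ?thesis unfolding partial_jet_def using DERIV_imp_deriv by metis
qed

lemma partial_x_add:
  assumes "P \<in> jet_alg I" "Q \<in> jet_alg I" "x \<in> I"
  shows "partial_x (\<lambda>x j. P x j + Q x j) x j = partial_x P x j + partial_x Q x j"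
  using DERIV_imp_deriv[OF DERIV_add[OF jet_alg_partial_x[OF assms(1,3)] jet_alg_partial_x[OF assms(2,3)]]]
  unfolding partial_x_def .

lemma partial_x_mult:
  assumes "P \<in> jet_alg I" "Q \<in> jet_alg I" "x \<in> I"
  shows "partial_x (\<lambda>x j. P x j * Q x j) x j = partial_x P x j * Q x j + partial_x Q x j * P x j"
  using DERIV_imp_deriv[OF DERIV_mult[OF jet_alg_partial_x[OF assms(1,3)] jet_alg_partial_x[OF assms(2,3)]]]
  unfolding partial_x_def .

lemma partial_jet_add:
  assumes "P \<in> jet_alg I" "Q \<in> jet_alg I" "x \<in> I"
  shows "partial_jet k (\<lambda>x j. P x j + Q x j) x j = partial_jet k P x j + partial_jet k Q x j"
  using DERIV_imp_deriv[OF DERIV_add[OF jet_alg_partial_jet[OF assms(1,3), of j k]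
        jet_alg_partial_jet[OF assms(2,3), of j k]]]
  unfolding partial_jet_def .

lemma partial_jet_mult:
  assumes "P \<in> jet_alg I" "Q \<in> jet_alg I" "x \<in> I"
  shows "partial_jet k (\<lambda>x j. P x j * Q x j) x j = partial_jet k P x j * Q x j + partial_jet k Q x j * P x j"
  using DERIV_imp_deriv[OF DERIV_mult[OF jet_alg_partial_jet[OF assms(1,3), of j k]
        jet_alg_partial_jet[OF assms(2,3), of j k]]]
  unfolding partial_jet_def by simp

text \<open>
  The total derivative, set to zero outside \<open>I\<close>. It is then a derivation of \<open>jet_alg I\<close> in the sense
  of equality of functions, and it does not see the values of its argument outside \<open>I\<close>.
\<close>

definition D :: "diff_fun \<Rightarrow> diff_fun" where
  "D P = (\<lambda>x j. if x \<in> I then total_deriv P x j else 0)"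

lemma D_inside: "x \<in> I \<Longrightarrow> D P x j = total_deriv P x j"
  by (simp add: D_def)

lemma D_outside: "x \<notin> I \<Longrightarrow> D P x j = 0"
  by (simp add: D_def)

lemma partial_x_cong:
  assumes "\<And>x j. x \<in> I \<Longrightarrow> P x j = Q x j" "x \<in> I"
  shows "partial_x P x j = partial_x Q x j"
proof -
  have "\<forall>\<^sub>F t in nhds x. P t j = Q t j"
    using eventually_nhds_in_open[OF open_I assms(2)] by (rule eventually_mono) (rule assms(1))
  then show ?thesis unfolding partial_x_def by (rule deriv_cong_ev) simp
qed

lemma partial_jet_cong:
  assumes "\<And>x j. x \<in> I \<Longrightarrow> P x j = Q x j" "x \<in> I"
  shows "partial_jet k P x j = partial_jet k Q x j"
  unfolding partial_jet_def using assms by simp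

lemma total_deriv_cong:
  assumes "\<And>x j. x \<in> I \<Longrightarrow> P x j = Q x j" "x \<in> I"
  shows "total_deriv P x j = total_deriv Q x j"
  unfolding total_deriv_def
  by (simp add: partial_x_cong[of P Q, OF assms] partial_jet_cong[of P Q, OF assms])

lemma D_cong:
  assumes "\<And>x j. x \<in> I \<Longrightarrow> P x j = Q x j"
  shows "D P = D Q"
  unfolding D_def by (intro ext) (simp add: total_deriv_cong[of P Q, OF assms])

lemma D_eq_sum:
  assumes "order_le N P" "x \<in> I"
  shows "D P x j = partial_x P x j + (\<Sum>k\<le>N. j (Suc k) * partial_jet k P x j)"
  using total_deriv_eq_sum[OF assms(1)] assms(2) by (simp add: D_def)

lemma order_le_D:
  assumes "order_le N P"
  shows "order_le (Suc N) (D P)"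
proof -
  have "order_le (Suc N) (\<lambda>x j. if x \<in> I then Q x j else 0)" if "order_le (Suc N) Q" for Q
    using that unfolding order_le_def by metis
  moreover have "order_le (Suc N) (\<lambda>x j. partial_x P x j + (\<Sum>k\<le>N. j (Suc k) * partial_jet k P x j))"
    by (intro order_le_add order_le_sum order_le_mult order_le_coord
        order_le_mono[OF order_le_partial_x[OF assms]] order_le_mono[OF order_le_partial_jet[OF assms]]) auto
  ultimately show ?thesis unfolding D_def total_deriv_eq_sum[OF assms] by blast
qed

lemma D_add:
  assumes "P \<in> jet_alg I" "Q \<in> jet_alg I"
  shows "D (\<lambda>x j. P x j + Q x j) = (\<lambda>x j. D P x j + D Q x j)"
proof (intro ext)
  fix x j
  obtain M N where "order_le M P" "order_le N Q" using jet_alg_order assms by blast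
  then obtain K where o: "order_le K P" "order_le K Q" by (rule order_le_common)
  show "D (\<lambda>x j. P x j + Q x j) x j = D P x j + D Q x j"
  proof (cases "x \<in> I")
    case True
    then show ?thesis
      unfolding D_eq_sum[OF order_le_add[OF o] True] D_eq_sum[OF o(1) True] D_eq_sum[OF o(2) True]
      by (simp add: partial_x_add[OF assms] partial_jet_add[OF assms] algebra_simps sum.distrib)
  qed (simp add: D_outside)
qed

lemma D_mult:
  assumes "P \<in> jet_alg I" "Q \<in> jet_alg I"
  shows "D (\<lambda>x j. P x j * Q x j) = (\<lambda>x j. D P x j * Q x j + P x j * D Q x j)"
proof (intro ext)
  fix x j
  obtain M N where "order_le M P" "order_le N Q" using jet_alg_order assms by blast
  then obtain K where o: "order_le K P" "order_le K Q" by (rule order_le_common)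
  show "D (\<lambda>x j. P x j * Q x j) x j = D P x j * Q x j + P x j * D Q x j"
  proof (cases "x \<in> I")
    case True
    then show ?thesis
      unfolding D_eq_sum[OF order_le_mult[OF o] True] D_eq_sum[OF o(1) True] D_eq_sum[OF o(2) True]
      by (simp add: partial_x_mult[OF assms] partial_jet_mult[OF assms] algebra_simps sum.distrib
          sum_distrib_left)
  qed (simp add: D_outside)
qed

lemma D_base:
  assumes "smooth2 I a"
  shows "D (\<lambda>x j. a (x, j 0)) =
    (\<lambda>x j. if x \<in> I then dx a (x, j 0) + dy a (x, j 0) * j 1 else 0)"
proof (intro ext)
  fix x j
  show "D (\<lambda>x j. a (x, j 0)) x j = (if x \<in> I then dx a (x, j 0) + dy a (x, j 0) * j 1 else 0)"
  proof (cases "x \<in> I")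
    case True
    have "partial_x (\<lambda>x j. a (x, j 0)) x j = dx a (x, j 0)"
      using DERIV_imp_deriv[OF smooth2_dx_at[OF assms True]] by (simp add: partial_x_def)
    moreover have "partial_jet 0 (\<lambda>x j. a (x, j 0)) x j = dy a (x, j 0)"
      using DERIV_imp_deriv[OF smooth2_dy_at[OF assms True]] by (simp add: partial_jet_def)
    ultimately show ?thesis using True D_eq_sum[OF order_le_base[of 0 a] True] by simp
  qed (simp add: D_outside)
qed

lemma D_coord: "D (\<lambda>x j. j k) = (\<lambda>x j. if x \<in> I then j (Suc k) else 0)"
proof (intro ext)
  fix x j
  have "partial_jet i (\<lambda>x j. j k) x j = (if i = k then 1 else 0)" for i
    by (cases "i = k") (simp_all add: partial_jet_def)
  then have "(\<Sum>i\<le>k. j (Suc i) * partial_jet i (\<lambda>x j. j k) x j) = j (Suc k)"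
    by (simp add: if_distrib[of "(*) _"] cong: if_cong)
  then show "D (\<lambda>x j. j k) x j = (if x \<in> I then j (Suc k) else 0)"
    using D_eq_sum[OF order_le_coord[of k k], of x j] D_outside[of x]
    by (simp add: partial_x_def)
qed

lemma jet_alg_fun: "smooth1 I h \<Longrightarrow> (\<lambda>x j. h x) \<in> jet_alg I"
  using jet_alg.base[of I "\<lambda>p. h (fst p)"] by (simp add: smooth1_def)

lemma jet_alg_const: "(\<lambda>x j. c) \<in> jet_alg I"
  using jet_alg_fun[OF smooth1_const] .

lemma jet_alg_cmult: "P \<in> jet_alg I \<Longrightarrow> (\<lambda>x j. c * P x j) \<in> jet_alg I"
  by (intro jet_alg.mult jet_alg_const)

lemma jet_alg_uminus: "P \<in> jet_alg I \<Longrightarrow> (\<lambda>x j. - P x j) \<in> jet_alg I"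
  using jet_alg_cmult[of P "-1"] by simp

lemma jet_alg_diff: "P \<in> jet_alg I \<Longrightarrow> Q \<in> jet_alg I \<Longrightarrow> (\<lambda>x j. P x j - Q x j) \<in> jet_alg I"
  using jet_alg.add[OF _ jet_alg_uminus] by fastforce

lemma jet_alg_sum: "(\<And>i. i \<in> A \<Longrightarrow> P i \<in> jet_alg I) \<Longrightarrow> (\<lambda>x j. \<Sum>i\<in>A. P i x j) \<in> jet_alg I"
  by (induction A rule: infinite_finite_induct) (simp_all add: jet_alg_const jet_alg.add)

lemma jet_alg_restrict: "P \<in> jet_alg I \<Longrightarrow> (\<lambda>x j. if x \<in> I then P x j else 0) \<in> jet_alg I"
proof -
  assume "P \<in> jet_alg I"
  moreover have "smooth1 I (\<lambda>x. if x \<in> I then 1 else 0)"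
    by (rule smooth1_cong[OF open_I _ smooth1_const[of I 1]]) simp
  ultimately have "(\<lambda>x j. (if x \<in> I then 1 else 0) * P x j) \<in> jet_alg I"
    by (intro jet_alg.mult jet_alg_fun)
  moreover have "(\<lambda>x j. (if x \<in> I then 1 else 0) * P x j) = (\<lambda>x j. if x \<in> I then P x j else 0)"
    by (intro ext) simp
  ultimately show ?thesis by simp
qed

lemma jet_alg_D: "P \<in> jet_alg I \<Longrightarrow> D P \<in> jet_alg I"
proof (induction rule: jet_alg.induct)
  case (base a)
  then show ?case unfolding D_base[OF base]
    by (intro jet_alg_restrict jet_alg.intros smooth2_dx smooth2_dy)
next
  case (coord k)
  then show ?case unfolding D_coord by (intro jet_alg_restrict jet_alg.intros)
next
  case (add P Q)
  then show ?case by (simp add: D_add jet_alg.add)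
next
  case (mult P Q)
  then show ?case by (simp add: D_mult jet_alg.mult jet_alg.add)
qed

lemma D_fun:
  assumes "smooth1 I h"
  shows "D (\<lambda>x j. h x) = (\<lambda>x j. if x \<in> I then deriv h x else 0)"
proof (intro ext)
  fix x j
  show "D (\<lambda>x j. h x) x j = (if x \<in> I then deriv h x else 0)"
    using D_eq_sum[OF order_le_fun[of 0 h], of x j] D_outside[of x]
    by (auto simp: partial_x_def partial_jet_def)
qed

lemma D_const: "D (\<lambda>x j. c) = (\<lambda>x j. 0)"
  by (intro ext) (simp add: D_fun smooth1_const)

lemma D_cmult: "P \<in> jet_alg I \<Longrightarrow> D (\<lambda>x j. c * P x j) = (\<lambda>x j. c * D P x j)"
  by (simp add: D_mult jet_alg_const D_const)

lemma D_uminus: "P \<in> jet_alg I \<Longrightarrow> D (\<lambda>x j. - P x j) = (\<lambda>x j. - D P x j)"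
  using D_cmult[of P "-1"] by simp

lemma D_diff: "P \<in> jet_alg I \<Longrightarrow> Q \<in> jet_alg I \<Longrightarrow>
    D (\<lambda>x j. P x j - Q x j) = (\<lambda>x j. D P x j - D Q x j)"
  using D_add[OF _ jet_alg_uminus, of P Q] by (simp add: D_uminus)

lemma D_sum: "(\<And>i. i \<in> A \<Longrightarrow> P i \<in> jet_alg I) \<Longrightarrow>
    D (\<lambda>x j. \<Sum>i\<in>A. P i x j) = (\<lambda>x j. \<Sum>i\<in>A. D (P i) x j)"
  by (induction A rule: infinite_finite_induct) (simp_all add: D_const D_add jet_alg_sum)

lemma jet_alg_D_iter: "P \<in> jet_alg I \<Longrightarrow> (D ^^ k) P \<in> jet_alg I"
  by (induction k) (simp_all add: jet_alg_D)

lemma total_deriv_iter: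
  assumes "\<And>x j. x \<in> I \<Longrightarrow> P x j = Q x j" "x \<in> I"
  shows "(total_deriv ^^ k) P x j = (D ^^ k) Q x j"
  using assms(2)
proof (induction k arbitrary: x j)
  case (Suc k)
  have "total_deriv ((total_deriv ^^ k) P) x j = total_deriv ((D ^^ k) Q) x j"
    using Suc.IH Suc.prems by (rule total_deriv_cong)
  then show ?case using Suc.prems by (simp add: D_inside)
qed (simp add: assms(1))

text \<open>
  The formal adjoint of the total derivative.
\<close>

definition neg_D :: "diff_fun \<Rightarrow> diff_fun" where
  "neg_D P = (\<lambda>x j. - D P x j)"

lemma neg_D_inside: "x \<in> I \<Longrightarrow> neg_D P x j = - total_deriv P x j"
  by (simp add: neg_D_def D_def)

lemma neg_total_deriv_iter:
  assumes "\<And>x j. x \<in> I \<Longrightarrow> P x j = Q x j" "x \<in> I"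
  shows "((\<lambda>P x j. - total_deriv P x j) ^^ k) P x j = (neg_D ^^ k) Q x j"
  using assms(2)
proof (induction k arbitrary: x j)
  case (Suc k)
  have "total_deriv (((\<lambda>P x j. - total_deriv P x j) ^^ k) P) x j = total_deriv ((neg_D ^^ k) Q) x j"
    using Suc.IH Suc.prems by (rule total_deriv_cong)
  then show ?case using Suc.prems by (simp add: neg_D_inside)
qed (simp add: assms(1))

lemma neg_D_iter_cong:
  assumes "\<And>x j. x \<in> I \<Longrightarrow> P x j = Q x j" "x \<in> I"
  shows "(neg_D ^^ k) P x j = (neg_D ^^ k) Q x j"
  using neg_total_deriv_iter[of P Q, OF assms] neg_total_deriv_iter[of P P x k j] assms(2) by simp

lemma jet_alg_neg_D: "P \<in> jet_alg I \<Longrightarrow> neg_D P \<in> jet_alg I"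
  unfolding neg_D_def by (intro jet_alg_uminus jet_alg_D)

lemma jet_alg_neg_D_iter: "P \<in> jet_alg I \<Longrightarrow> (neg_D ^^ k) P \<in> jet_alg I"
  by (induction k) (simp_all add: jet_alg_neg_D)

lemma neg_D_iter_add:
  assumes "P \<in> jet_alg I" "Q \<in> jet_alg I"
  shows "(neg_D ^^ k) (\<lambda>x j. P x j + Q x j) = (\<lambda>x j. (neg_D ^^ k) P x j + (neg_D ^^ k) Q x j)"
proof (induction k)
  case (Suc k)
  then show ?case
    by (simp add: neg_D_def[of "\<lambda>x j. (neg_D ^^ k) P x j + (neg_D ^^ k) Q x j"]
        D_add jet_alg_neg_D_iter assms) (simp add: neg_D_def)
qed simp

lemma neg_D_iter_diff:
  assumes "P \<in> jet_alg I" "Q \<in> jet_alg I"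
  shows "(neg_D ^^ k) (\<lambda>x j. P x j - Q x j) = (\<lambda>x j. (neg_D ^^ k) P x j - (neg_D ^^ k) Q x j)"
proof (induction k)
  case (Suc k)
  then show ?case
    by (simp add: neg_D_def[of "\<lambda>x j. (neg_D ^^ k) P x j - (neg_D ^^ k) Q x j"]
        D_diff jet_alg_neg_D_iter assms) (simp add: neg_D_def)
qed simp

lemma neg_D_iter_zero:
  assumes "\<And>x j. x \<in> I \<Longrightarrow> P x j = 0" "x \<in> I"
  shows "(neg_D ^^ k) P x j = 0"
proof -
  have "(neg_D ^^ k) (\<lambda>x j. 0) = (\<lambda>x j. 0)"
    by (induction k) (simp_all add: neg_D_def D_const)
  then show ?thesis using neg_D_iter_cong[of P "\<lambda>x j. 0", OF assms] by simp
qed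

end

section \<open>The derivation adapted to the change of coordinates\<close>

lemma binomial_convolution_Suc:
  fixes a b :: "nat \<Rightarrow> real"
  shows "(\<Sum>i\<le>n. real (n choose i) * (a (Suc i) * b (n - i) + a i * b (Suc (n - i)))) =
         (\<Sum>i\<le>Suc n. real (Suc n choose i) * a i * b (Suc n - i))"
proof -
  have "(\<Sum>i\<le>Suc n. real (Suc n choose i) * a i * b (Suc n - i)) =
      a 0 * b (Suc n) + (\<Sum>i\<le>n. real ((n choose i) + (n choose Suc i)) * a (Suc i) * b (n - i))"
    by (subst sum.atMost_Suc_shift) (simp del: of_nat_add)
  also have "\<dots> = (\<Sum>i\<le>n. real (n choose i) * a (Suc i) * b (n - i)) +
      (a 0 * b (Suc n) + (\<Sum>i\<le>n. real (n choose Suc i) * a (Suc i) * b (n - i)))"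
    by (simp add: algebra_simps sum.distrib)
  also have "a 0 * b (Suc n) + (\<Sum>i\<le>n. real (n choose Suc i) * a (Suc i) * b (n - i)) =
      (\<Sum>i\<le>Suc n. real (n choose i) * a i * b (Suc n - i))"
    by (subst sum.atMost_Suc_shift) simp
  also have "\<dots> = (\<Sum>i\<le>n. real (n choose i) * a i * b (Suc (n - i)))"
    by (auto intro!: sum.cong simp: Suc_diff_le)
  finally show ?thesis by (simp add: algebra_simps sum.distrib)
qed

text \<open>
  The data of the change of coordinates: smooth functions \<open>u, v\<close> with Wronskian \<open>1\<close>, where \<open>u\<close> has
  no zeros.
\<close>

locale source_solutions = open_interval I for I :: "real set" +
  fixes n :: nat and u v :: "real \<Rightarrow> real" and \<alpha> :: real
  assumes n_ge_2: "n \<ge> 2"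
    and convex_I: "convex I"
    and smooth_u: "smooth1 I u" and smooth_v: "smooth1 I v"
    and wronskian: "\<And>x. x \<in> I \<Longrightarrow> u x * deriv v x - deriv u x * v x = 1"
    and u_nonzero: "\<And>x. x \<in> I \<Longrightarrow> u x \<noteq> 0"
    and \<alpha>_nonzero: "\<alpha> \<noteq> 0"
begin

text \<open>The reciprocal of \<open>u\<close>, the multiplier \<open>u\<^sup>1\<^sup>-\<^sup>n\<close>, and \<open>v / u\<close>, a primitive of \<open>u\<^sup>-\<^sup>2\<close>.\<close>

definition iu :: "real \<Rightarrow> real" where "iu x = inverse (u x)"

definition p :: "real \<Rightarrow> real" where "p x = iu x ^ (n - 1)"

definition \<zeta> :: "real \<Rightarrow> real" where "\<zeta> x = v x * iu x"

lemma smooth_iu: "smooth1 I iu"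
  using smooth1_inverse[OF open_I smooth_u u_nonzero] by (simp add: iu_def[abs_def])

lemma smooth_p: "smooth1 I p"
  using smooth1_power[OF open_I smooth_iu] by (simp add: p_def[abs_def])

lemma u_iu: "x \<in> I \<Longrightarrow> u x * iu x = 1"
  using u_nonzero by (simp add: iu_def)

lemma iu_nonzero: "x \<in> I \<Longrightarrow> iu x \<noteq> 0"
  using u_nonzero by (simp add: iu_def)

lemma p_nonzero: "x \<in> I \<Longrightarrow> p x \<noteq> 0"
  using iu_nonzero by (simp add: p_def)

lemma deriv_u: "x \<in> I \<Longrightarrow> (u has_real_derivative deriv u x) (at x)"
  using smooth1_differentiable[OF smooth_u] .

lemma deriv_v: "x \<in> I \<Longrightarrow> (v has_real_derivative deriv v x) (at x)"
  using smooth1_differentiable[OF smooth_v] .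

lemma has_deriv_iu: "x \<in> I \<Longrightarrow> (iu has_real_derivative - deriv u x * iu x ^ 2) (at x)"
  unfolding iu_def[abs_def] using deriv_u u_nonzero
  by (auto intro!: derivative_eq_intros simp: power2_eq_square)

lemma has_deriv_iu_power:
  assumes "x \<in> I"
  shows "((\<lambda>x. iu x ^ k) has_real_derivative - real k * deriv u x * iu x * iu x ^ k) (at x)"
proof -
  have "((\<lambda>x. iu x ^ k) has_real_derivative real k * (- deriv u x * iu x ^ 2) * iu x ^ (k - 1)) (at x)"
    using has_deriv_iu[OF assms] by (auto intro!: derivative_eq_intros)
  also have "real k * (- deriv u x * iu x ^ 2) * iu x ^ (k - 1) = - real k * deriv u x * iu x * iu x ^ k"
    by (cases k) (simp_all add: power2_eq_square algebra_simps)
  finally show ?thesis .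
qed

lemma deriv_p: "x \<in> I \<Longrightarrow> deriv p x = - real (n - 1) * deriv u x * iu x * p x"
  using DERIV_imp_deriv[OF has_deriv_iu_power[of x "n - 1"]] by (simp add: p_def[abs_def])

lemma has_deriv_\<zeta>: "x \<in> I \<Longrightarrow> (\<zeta> has_real_derivative iu x ^ 2) (at x)"
proof -
  assume x: "x \<in> I"
  have "(\<zeta> has_real_derivative (deriv v x * iu x + (- deriv u x * iu x ^ 2) * v x)) (at x)"
    unfolding \<zeta>_def[abs_def] by (rule DERIV_mult[OF deriv_v[OF x] has_deriv_iu[OF x]])
  also have "deriv v x * iu x + (- deriv u x * iu x ^ 2) * v x =
      iu x ^ 2 * (u x * deriv v x - deriv u x * v x)"
    using u_iu[OF x] by algebra
  finally show ?thesis using wronskian[OF x] by simp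
qed

text \<open>
  The total derivative with respect to the new independent variable, and the jet coordinates
  \<open>w, dw/dz, \<dots>\<close> of \<open>w = \<alpha> u\<^sup>1\<^sup>-\<^sup>n y\<close>.
\<close>

definition Dz :: "diff_fun \<Rightarrow> diff_fun" where
  "Dz P = (\<lambda>x j. (u x)\<^sup>2 * D P x j)"

definition T :: "nat \<Rightarrow> diff_fun" where
  "T k = (Dz ^^ k) (\<lambda>x j. \<alpha> * p x * j 0)"

lemma jet_alg_u2: "(\<lambda>x j. (u x)\<^sup>2) \<in> jet_alg I"
  by (intro jet_alg_fun smooth1_power open_I smooth_u)

lemma jet_alg_Dz: "P \<in> jet_alg I \<Longrightarrow> Dz P \<in> jet_alg I"
  unfolding Dz_def by (intro jet_alg.mult jet_alg_D jet_alg_u2)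

lemma jet_alg_Dz_iter: "P \<in> jet_alg I \<Longrightarrow> (Dz ^^ k) P \<in> jet_alg I"
  by (induction k) (simp_all add: jet_alg_Dz)

lemma smooth_\<alpha>p: "smooth1 I (\<lambda>x. \<alpha> * p x)"
  by (intro smooth1_mult open_I smooth1_const smooth_p)

lemma jet_alg_T: "T k \<in> jet_alg I"
  unfolding T_def by (intro jet_alg_Dz_iter jet_alg.mult jet_alg.coord jet_alg_fun smooth_\<alpha>p)

lemma T_Suc: "T (Suc k) = Dz (T k)"
  by (simp add: T_def)

lemma T_add: "(Dz ^^ i) (T k) = T (i + k)"
  by (simp add: T_def funpow_add)

lemma Dz_cong: "(\<And>x j. x \<in> I \<Longrightarrow> P x j = Q x j) \<Longrightarrow> Dz P = Dz Q"
  unfolding Dz_def using D_cong[of P Q] by simp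

lemma Dz_iter_cong:
  assumes "\<And>x j. x \<in> I \<Longrightarrow> P x j = Q x j" "x \<in> I"
  shows "(Dz ^^ k) P x j = (Dz ^^ k) Q x j"
proof (cases k)
  case (Suc l)
  then show ?thesis using Dz_cong[of P Q] assms(1) by (simp add: funpow_swap1)
qed (simp add: assms)

lemma Dz_add: "P \<in> jet_alg I \<Longrightarrow> Q \<in> jet_alg I \<Longrightarrow>
    Dz (\<lambda>x j. P x j + Q x j) = (\<lambda>x j. Dz P x j + Dz Q x j)"
  by (simp add: Dz_def D_add algebra_simps)

lemma Dz_mult: "P \<in> jet_alg I \<Longrightarrow> Q \<in> jet_alg I \<Longrightarrow>
    Dz (\<lambda>x j. P x j * Q x j) = (\<lambda>x j. Dz P x j * Q x j + P x j * Dz Q x j)"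
  by (simp add: Dz_def D_mult algebra_simps)

lemma Dz_cmult: "P \<in> jet_alg I \<Longrightarrow> Dz (\<lambda>x j. c * P x j) = (\<lambda>x j. c * Dz P x j)"
  by (simp add: Dz_def D_cmult algebra_simps)

lemma Dz_sum: "(\<And>i. i \<in> A \<Longrightarrow> P i \<in> jet_alg I) \<Longrightarrow>
    Dz (\<lambda>x j. \<Sum>i\<in>A. P i x j) = (\<lambda>x j. \<Sum>i\<in>A. Dz (P i) x j)"
  by (simp add: Dz_def D_sum sum_distrib_left)

lemma Dz_iter_add:
  assumes "P \<in> jet_alg I" "Q \<in> jet_alg I"
  shows "(Dz ^^ k) (\<lambda>x j. P x j + Q x j) = (\<lambda>x j. (Dz ^^ k) P x j + (Dz ^^ k) Q x j)"
  by (induction k) (simp_all add: Dz_add jet_alg_Dz_iter assms)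

lemma Dz_iter_cmult:
  assumes "P \<in> jet_alg I"
  shows "(Dz ^^ k) (\<lambda>x j. c * P x j) = (\<lambda>x j. c * (Dz ^^ k) P x j)"
  by (induction k) (simp_all add: Dz_cmult jet_alg_Dz_iter assms)

lemma Dz_iter_mult:
  assumes "P \<in> jet_alg I" "Q \<in> jet_alg I"
  shows "(Dz ^^ k) (\<lambda>x j. P x j * Q x j) =
    (\<lambda>x j. \<Sum>i\<le>k. real (k choose i) * (Dz ^^ i) P x j * (Dz ^^ (k - i)) Q x j)"
proof (induction k)
  case (Suc k)
  have "(Dz ^^ Suc k) (\<lambda>x j. P x j * Q x j) =
      Dz (\<lambda>x j. \<Sum>i\<le>k. real (k choose i) * ((Dz ^^ i) P x j * (Dz ^^ (k - i)) Q x j))"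
    using Suc.IH by (simp add: mult.assoc)
  also have "\<dots> = (\<lambda>x j. \<Sum>i\<le>k. real (k choose i) *
      ((Dz ^^ Suc i) P x j * (Dz ^^ (k - i)) Q x j + (Dz ^^ i) P x j * (Dz ^^ Suc (k - i)) Q x j))"
    by (simp add: Dz_sum Dz_cmult Dz_mult jet_alg_cmult jet_alg.mult jet_alg_Dz_iter assms)
  also have "\<dots> = (\<lambda>x j. \<Sum>i\<le>Suc k. real (Suc k choose i) * (Dz ^^ i) P x j * (Dz ^^ (Suc k - i)) Q x j)"
    using binomial_convolution_Suc[of k "\<lambda>i. (Dz ^^ i) P x j" "\<lambda>i. (Dz ^^ i) Q x j" for x j]
    by (intro ext) simp
  finally show ?case .
qed simp

text \<open>The restriction of \<open>Dz\<close> to functions of the independent variable.\<close>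

definition dz :: "(real \<Rightarrow> real) \<Rightarrow> real \<Rightarrow> real" where
  "dz h = (\<lambda>x. if x \<in> I then (u x)\<^sup>2 * deriv h x else 0)"

lemma smooth_dz: "smooth1 I h \<Longrightarrow> smooth1 I (dz h)"
proof -
  assume "smooth1 I h"
  then have "smooth1 I (\<lambda>x. (u x)\<^sup>2 * deriv h x)"
    by (intro smooth1_mult smooth1_power smooth1_deriv open_I smooth_u)
  then show ?thesis by (rule smooth1_cong[OF open_I, rotated]) (simp add: dz_def)
qed

lemma smooth_dz_iter: "smooth1 I h \<Longrightarrow> smooth1 I ((dz ^^ k) h)"
  by (induction k) (simp_all add: smooth_dz)

lemma Dz_fun: "smooth1 I h \<Longrightarrow> Dz (\<lambda>x j. h x) = (\<lambda>x j. dz h x)"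
  by (intro ext) (simp add: Dz_def dz_def D_fun)

lemma Dz_iter_fun: "smooth1 I h \<Longrightarrow> (Dz ^^ k) (\<lambda>x j. h x) = (\<lambda>x j. (dz ^^ k) h x)"
  by (induction k) (simp_all add: Dz_fun smooth_dz_iter)

lemma dz_eq:
  assumes "x \<in> I" "(h has_real_derivative h') (at x)"
  shows "dz h x = (u x)\<^sup>2 * h'"
  using DERIV_imp_deriv[OF assms(2)] assms(1) by (simp add: dz_def)

lemma order_le_Dz: "order_le N P \<Longrightarrow> order_le (Suc N) (Dz P)"
  unfolding Dz_def by (intro order_le_mult order_le_fun order_le_D)

lemma order_le_Dz_iter: "order_le N P \<Longrightarrow> order_le (N + k) ((Dz ^^ k) P)"
  by (induction k) (simp_all add: order_le_Dz)

lemma order_le_T: "order_le k (T k)"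
proof -
  have "order_le 0 (\<lambda>x j. \<alpha> * p x * j 0)"
    by (intro order_le_mult order_le_fun order_le_coord) simp
  from order_le_Dz_iter[OF this, of k] show ?thesis by (simp add: T_def)
qed

section \<open>Coefficients and adjoint of the transformed derivative\<close>

text \<open>The coefficient of \<open>D\<^sup>i\<close> in the differential operator \<open>R \<mapsto> (u\<^sup>2 D)\<^sup>k (\<alpha> u\<^sup>1\<^sup>-\<^sup>n R)\<close>.\<close>

fun tc :: "nat \<Rightarrow> nat \<Rightarrow> real \<Rightarrow> real" where
  "tc 0 i = (\<lambda>x. if i = 0 then \<alpha> * p x else 0)"
| "tc (Suc k) i = (\<lambda>x. (u x)\<^sup>2 * (deriv (tc k i) x + (if i = 0 then 0 else tc k (i - 1) x)))"

lemma smooth_tc: "smooth1 I (tc k i)"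
proof (induction k arbitrary: i)
  case 0
  then show ?case by (cases "i = 0") (simp_all add: smooth_\<alpha>p smooth1_const)
next
  case (Suc k)
  then show ?case
    by (cases "i = 0")
      (auto intro!: smooth1_mult smooth1_add smooth1_deriv smooth1_power open_I smooth_u)
qed

lemma deriv_zero_on:
  assumes "\<And>x. x \<in> I \<Longrightarrow> h x = 0" "x \<in> I"
  shows "deriv h x = 0"
proof -
  have "(h has_real_derivative 0) (at x)"
    by (rule has_field_derivative_transform_within_open[OF DERIV_const[of 0] open_I assms(2)])
      (simp add: assms(1))
  then show ?thesis by (rule DERIV_imp_deriv)
qed

lemma tc_zero: "k < i \<Longrightarrow> x \<in> I \<Longrightarrow> tc k i x = 0"
proof (induction k arbitrary: i x)
  case (Suc k)
  then have "deriv (tc k i) x = 0" by (intro deriv_zero_on) auto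
  moreover have "tc k (i - 1) x = 0" using Suc by simp
  ultimately show ?case by simp
qed simp

lemma tc_lead: "x \<in> I \<Longrightarrow> tc k k x = \<alpha> * p x * (u x ^ 2) ^ k"
proof (induction k)
  case (Suc k)
  have "deriv (tc k (Suc k)) x = 0" using Suc.prems by (intro deriv_zero_on tc_zero) auto
  then show ?case using Suc by simp
qed simp

lemma tc_lead_nonzero: "x \<in> I \<Longrightarrow> tc k k x \<noteq> 0"
  using tc_lead u_nonzero p_nonzero \<alpha>_nonzero by simp

lemma Dz_iter_expand:
  assumes "R \<in> jet_alg I" "x \<in> I"
  shows "(Dz ^^ k) (\<lambda>x j. \<alpha> * p x * R x j) x j = (\<Sum>i\<le>k. tc k i x * (D ^^ i) R x j)"
  using assms(2)
proof (induction k arbitrary: x j)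
  case (Suc k)
  have "(Dz ^^ Suc k) (\<lambda>x j. \<alpha> * p x * R x j) x j =
      Dz (\<lambda>x j. \<Sum>i\<le>k. tc k i x * (D ^^ i) R x j) x j"
    using Dz_cong[of "(Dz ^^ k) (\<lambda>x j. \<alpha> * p x * R x j)" "\<lambda>x j. \<Sum>i\<le>k. tc k i x * (D ^^ i) R x j"]
      Suc.IH by simp
  also have "\<dots> = (\<Sum>i\<le>k. (u x)\<^sup>2 * (deriv (tc k i) x * (D ^^ i) R x j + tc k i x * (D ^^ Suc i) R x j))"
    using Suc.prems
    by (simp add: Dz_def D_sum D_mult D_fun smooth_tc jet_alg_fun jet_alg.mult jet_alg_D_iter assms(1)
        sum_distrib_left)
  also have "\<dots> = (\<Sum>i\<le>k. (u x)\<^sup>2 * deriv (tc k i) x * (D ^^ i) R x j) +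
      (\<Sum>i\<le>k. (u x)\<^sup>2 * tc k i x * (D ^^ Suc i) R x j)"
    by (simp add: algebra_simps sum.distrib)
  also have "(\<Sum>i\<le>k. (u x)\<^sup>2 * deriv (tc k i) x * (D ^^ i) R x j) =
      (\<Sum>i\<le>Suc k. (u x)\<^sup>2 * deriv (tc k i) x * (D ^^ i) R x j)"
    using deriv_zero_on[of "tc k (Suc k)" x] tc_zero[of k "Suc k"] Suc.prems by simp
  also have "(\<Sum>i\<le>k. (u x)\<^sup>2 * tc k i x * (D ^^ Suc i) R x j) =
      (\<Sum>i\<le>Suc k. (u x)\<^sup>2 * (if i = 0 then 0 else tc k (i - 1) x) * (D ^^ i) R x j)"
    by (subst sum.atMost_Suc_shift) simp
  also have "(\<Sum>i\<le>Suc k. (u x)\<^sup>2 * deriv (tc k i) x * (D ^^ i) R x j) + \<dots> =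
      (\<Sum>i\<le>Suc k. tc (Suc k) i x * (D ^^ i) R x j)"
    by (simp only: sum.distrib[symmetric]) (auto intro!: sum.cong simp: algebra_simps)
  finally show ?case .
qed simp

lemma D_iter_coord: "x \<in> I \<Longrightarrow> (D ^^ i) (\<lambda>x j. j 0) x j = j i"
proof (induction i arbitrary: x j)
  case (Suc i)
  have "D ((D ^^ i) (\<lambda>x j. j 0)) = D (\<lambda>x j. j i)" using Suc.IH by (intro D_cong) simp
  then show ?case using Suc.prems by (simp add: D_coord)
qed simp

lemma T_expand: "x \<in> I \<Longrightarrow> T k x j = (\<Sum>i\<le>k. tc k i x * j i)"
  unfolding T_def using Dz_iter_expand[OF jet_alg.coord] D_iter_coord by simp

text \<open>
  The leading coefficient of \<open>T k\<close> has no zeros, so \<open>T k\<close> takes every value when only the jet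
  coordinate of order \<open>k\<close> is varied.
\<close>

lemma T_update:
  assumes "x \<in> I"
  obtains t where "T k x (j(k := t)) = s"
proof
  define r where "r = (\<Sum>i<k. tc k i x * j i)"
  have split: "(\<Sum>i\<le>k. f i) = (\<Sum>i<k. f i) + f k" for f :: "nat \<Rightarrow> real"
    by (simp add: lessThan_Suc_atMost[symmetric])
  show "T k x (j(k := (s - r) / tc k k x)) = s"
    using tc_lead_nonzero[OF assms] by (simp add: T_expand[OF assms] split r_def)
qed

text \<open>The \<open>T k\<close> are coordinates on the jets over a point.\<close>

lemma T_coordinates:
  assumes "x \<in> I"
  obtains j where "\<And>k. k \<le> N \<Longrightarrow> T k x j = s k"
proof -
  have "\<exists>j. \<forall>k\<le>N. T k x j = s k"
  proof (induction N)
    case 0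
    show ?case using T_update[OF assms, of 0 "\<lambda>_. 0" "s 0"] by auto
  next
    case (Suc N)
    then obtain j where j: "\<forall>k\<le>N. T k x j = s k" by blast
    obtain t where t: "T (Suc N) x (j(Suc N := t)) = s (Suc N)" using T_update[OF assms] .
    have "T k x (j(Suc N := t)) = T k x j" if "k \<le> N" for k
      by (rule order_leD[OF order_le_T]) (use that in auto)
    then show ?case using j t by (metis le_Suc_eq)
  qed
  then show thesis using that by blast
qed

text \<open>
  The operator \<open>(u\<^sup>2 D)\<^sup>k u\<^sup>1\<^sup>-\<^sup>n\<close> is a composition of multiplications and derivations, so its
  formal adjoint is the composition of their adjoints in the opposite order.
\<close>

lemma adjoint_Suc:
  assumes "R \<in> jet_alg I" "x \<in> I"
  defines "S \<equiv> \<lambda>x j. (u x)\<^sup>2 * R x j"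
  shows "(\<Sum>i\<le>Suc k. (neg_D ^^ i) (\<lambda>x j. tc (Suc k) i x * R x j) x j) =
         (\<Sum>i\<le>k. (neg_D ^^ i) (\<lambda>x j. tc k i x * neg_D S x j) x j)"
proof -
  have S: "S \<in> jet_alg I" unfolding S_def by (intro jet_alg.mult jet_alg_u2 assms)
  note tc_alg = jet_alg_fun[OF smooth_tc]
  define A where "A i = (neg_D ^^ i) (\<lambda>x j. tc k i x * neg_D S x j) x j" for i
  define B where "B i = (neg_D ^^ Suc i) (\<lambda>x j. tc k i x * S x j) x j" for i
  have step: "(neg_D ^^ i) (\<lambda>x j. tc (Suc k) i x * R x j) x j = A i - B i + (if i = 0 then 0 else B (i - 1))" for i
  proof -
    have 1: "tc (Suc k) i x * R x j = tc k i x * neg_D S x j - neg_D (\<lambda>x j. tc k i x * S x j) x j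
        + (if i = 0 then 0 else tc k (i - 1) x) * S x j" if "x \<in> I" for x j
      using that by (simp add: neg_D_def D_mult D_fun tc_alg smooth_tc S, simp add: S_def algebra_simps)
    have "(neg_D ^^ i) (\<lambda>x j. tc (Suc k) i x * R x j) x j =
        (neg_D ^^ i) (\<lambda>x j. tc k i x * neg_D S x j - neg_D (\<lambda>x j. tc k i x * S x j) x j
        + (if i = 0 then 0 else tc k (i - 1) x) * S x j) x j"
      by (rule neg_D_iter_cong[OF 1 assms(2)])
    also have "\<dots> = A i - (neg_D ^^ i) (neg_D (\<lambda>x j. tc k i x * S x j)) x j
        + (neg_D ^^ i) (\<lambda>x j. (if i = 0 then 0 else tc k (i - 1) x) * S x j) x j"
      unfolding A_def
      by (cases "i = 0") (simp_all add: neg_D_iter_add neg_D_iter_diff jet_alg_diff jet_alg.mult tc_alg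
          jet_alg_neg_D S jet_alg_const)
    also have "\<dots> = A i - B i + (if i = 0 then 0 else B (i - 1))"
      by (cases i) (simp_all add: B_def funpow_swap1)
    finally show ?thesis .
  qed
  have zero: "A (Suc k) = 0" "B (Suc k) = 0"
    unfolding A_def B_def by (rule neg_D_iter_zero[OF _ assms(2)], simp add: tc_zero)+
  have "(\<Sum>i\<le>Suc k. A i - B i + (if i = 0 then 0 else B (i - 1))) =
      (\<Sum>i\<le>Suc k. A i) - (\<Sum>i\<le>Suc k. B i) + (\<Sum>i\<le>k. B i)"
    by (simp only: sum.distrib sum_subtractf) (subst (3) sum.atMost_Suc_shift, simp)
  then show ?thesis unfolding step using zero by (simp add: A_def)
qed

lemma adjoint_T:
  assumes "R \<in> jet_alg I" "x \<in> I"
  shows "(\<Sum>i\<le>k. (neg_D ^^ i) (\<lambda>x j. tc k i x * R x j) x j) =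
         (- 1) ^ k * \<alpha> * p x * (iu x)\<^sup>2 * (Dz ^^ k) (\<lambda>x j. (u x)\<^sup>2 * R x j) x j"
  using assms(1)
proof (induction k arbitrary: R)
  case 0
  then show ?case using u_iu[OF assms(2)] by (simp add: power_mult_distrib[symmetric] mult.commute)
next
  case (Suc k)
  have S: "(\<lambda>x j. (u x)\<^sup>2 * R x j) \<in> jet_alg I" by (intro jet_alg.mult jet_alg_u2 Suc.prems)
  have "(\<lambda>x j. (u x)\<^sup>2 * neg_D (\<lambda>x j. (u x)\<^sup>2 * R x j) x j) = (\<lambda>x j. (- 1) * Dz (\<lambda>x j. (u x)\<^sup>2 * R x j) x j)"
    by (intro ext) (simp add: neg_D_def Dz_def)
  then have "(Dz ^^ k) (\<lambda>x j. (u x)\<^sup>2 * neg_D (\<lambda>x j. (u x)\<^sup>2 * R x j) x j) =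
      (\<lambda>x j. (- 1) * (Dz ^^ Suc k) (\<lambda>x j. (u x)\<^sup>2 * R x j) x j)"
    using Dz_iter_cmult[OF jet_alg_Dz[OF S], of k "- 1"] by (simp only: funpow_Suc_right o_apply)
  then show ?case
    unfolding adjoint_Suc[OF Suc.prems assms(2)] Suc.IH[OF jet_alg_neg_D[OF S]] by simp
qed

end

section \<open>Leading terms of iterated total derivatives\<close>

text \<open>
  A function of \<open>(x, y)\<close> as a differential function of order zero.
\<close>

definition lift :: "(real \<times> real \<Rightarrow> real) \<Rightarrow> diff_fun" where
  "lift a = (\<lambda>x j. a (x, j 0))"

lemma order_le_lift: "order_le N (lift a)"
  unfolding lift_def by (rule order_le_base)

lemma jet_alg_lift: "smooth2 I a \<Longrightarrow> lift a \<in> jet_alg I"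
  unfolding lift_def by (rule jet_alg.base)

context source_solutions
begin

text \<open>
  For \<open>a\<close> a function of \<open>(x, y)\<close>, \<open>d_w a\<close> is its partial derivative with respect to the new dependent
  variable \<open>w\<close>, and \<open>d_z a\<close> its partial derivative with respect to the new independent variable at
  constant \<open>w\<close>.
\<close>

definition d_w :: "(real \<times> real \<Rightarrow> real) \<Rightarrow> real \<times> real \<Rightarrow> real" where
  "d_w a = (\<lambda>q. dy a q * inverse (\<alpha> * p (fst q)))"

definition d_z :: "(real \<times> real \<Rightarrow> real) \<Rightarrow> real \<times> real \<Rightarrow> real" where
  "d_z a = (\<lambda>q. if fst q \<in> I then
     (u (fst q))\<^sup>2 * (dx a q + dy a q * (real (n - 1) * deriv u (fst q) * iu (fst q) * snd q)) else 0)"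

lemma smooth_d_w: "smooth2 I a \<Longrightarrow> smooth2 I (d_w a)"
proof -
  assume a: "smooth2 I a"
  have "smooth1 I (\<lambda>x. inverse (\<alpha> * p x))"
    using smooth1_inverse[OF open_I smooth_\<alpha>p] \<alpha>_nonzero p_nonzero by simp
  then show ?thesis unfolding d_w_def
    by (intro smooth2_mult open_I smooth2_dy a smooth1_imp_smooth2)
qed

lemma smooth_d_z: "smooth2 I a \<Longrightarrow> smooth2 I (d_z a)"
proof -
  assume a: "smooth2 I a"
  have u2: "smooth2 I (\<lambda>q. (u (fst q))\<^sup>2)"
    by (intro smooth2_power smooth1_imp_smooth2 smooth_u open_I)
  have c: "smooth2 I (\<lambda>q. real (n - 1) * deriv u (fst q) * iu (fst q) * snd q)"
    by (intro smooth2_mult smooth2_const smooth1_imp_smooth2 smooth1_deriv smooth_u smooth_iu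
        smooth2_snd open_I)
  have "smooth2 I (\<lambda>q. (u (fst q))\<^sup>2 * (dx a q + dy a q * (real (n - 1) * deriv u (fst q) * iu (fst q) * snd q)))"
    by (intro smooth2_mult[OF open_I u2] smooth2_add[OF open_I smooth2_dx[OF a]]
        smooth2_mult[OF open_I smooth2_dy[OF a] c])
  then show ?thesis by (rule smooth2_cong[OF open_I, rotated]) (simp add: d_z_def)
qed

lemma iu2_u2: "x \<in> I \<Longrightarrow> (iu x)\<^sup>2 * ((u x)\<^sup>2 * c) = c"
  using u_iu[of x] by (simp only: mult.assoc[symmetric] power_mult_distrib[symmetric]
      mult.commute[of "iu x" "u x"] power_one mult_1)

lemma T_0: "T 0 x j = \<alpha> * p x * j 0"
  by (simp add: T_def)

lemma T_1:
  assumes "x \<in> I"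
  shows "T 1 x j = (u x)\<^sup>2 * (\<alpha> * p x * j 1 + \<alpha> * deriv p x * j 0)"
proof -
  have d: "deriv (\<lambda>x. \<alpha> * p x) x = \<alpha> * deriv p x"
    by (rule DERIV_imp_deriv[OF DERIV_cmult[OF smooth1_differentiable[OF smooth_p assms]]])
  have "T 1 x j = Dz (\<lambda>x j. \<alpha> * p x * j 0) x j" by (simp add: T_def)
  also have "\<dots> = (u x)\<^sup>2 * (\<alpha> * p x * j 1 + \<alpha> * deriv p x * j 0)"
    using assms d
    by (simp add: Dz_def D_mult[OF jet_alg_fun[OF smooth_\<alpha>p] jet_alg.coord] D_fun[OF smooth_\<alpha>p] D_coord)
  finally show ?thesis .
qed

lemma T_Suc_outside: "x \<notin> I \<Longrightarrow> T (Suc k) x j = 0"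
  by (simp add: T_Suc Dz_def D_outside)

lemma Dz_lift:
  assumes "smooth2 I a"
  shows "Dz (lift a) = (\<lambda>x j. lift (d_w a) x j * T 1 x j + lift (d_z a) x j)"
proof (intro ext)
  fix x j
  show "Dz (lift a) x j = lift (d_w a) x j * T 1 x j + lift (d_z a) x j"
  proof (cases "x \<in> I")
    case True
    define c where "c = \<alpha> * p x"
    have c: "c \<noteq> 0" using True \<alpha>_nonzero p_nonzero by (simp add: c_def)
    have cp: "\<alpha> * deriv p x = - real (n - 1) * deriv u x * iu x * c"
      using deriv_p[OF True] by (simp add: c_def)
    have "Dz (lift a) x j = (u x)\<^sup>2 * (dx a (x, j 0) + dy a (x, j 0) * j 1)"
      using True by (simp add: Dz_def lift_def D_base[OF assms])
    also have "\<dots> = dy a (x, j 0) * inverse c * ((u x)\<^sup>2 * (c * j 1 + - real (n - 1) * deriv u x * iu x * c * j 0))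
        + (u x)\<^sup>2 * (dx a (x, j 0) + dy a (x, j 0) * (real (n - 1) * deriv u x * iu x * j 0))"
      using c by (simp add: field_simps)
    finally show ?thesis
      unfolding T_1[OF True] lift_def d_w_def fst_conv cp c_def[symmetric]
      using True by (simp add: d_z_def)
  next
    case False
    then show ?thesis using T_Suc_outside[of x 0 j] by (simp add: Dz_def D_outside lift_def d_z_def)
  qed
qed

lemma Dz_iter_lift:
  assumes "smooth2 I a"
  shows "\<exists>R. R \<in> jet_alg I \<and> order_le k R \<and>
    (Dz ^^ Suc k) (lift a) = (\<lambda>x j. lift (d_w a) x j * T (Suc k) x j + R x j)"
proof (induction k)
  case 0
  show ?case
    by (rule exI[of _ "lift (d_z a)"])
      (simp add: Dz_lift[OF assms] jet_alg_lift smooth_d_z assms order_le_lift)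
next
  case (Suc k)
  then obtain R where R: "R \<in> jet_alg I" "order_le k R"
    and eq: "(Dz ^^ Suc k) (lift a) = (\<lambda>x j. lift (d_w a) x j * T (Suc k) x j + R x j)" by blast
  have G: "lift (d_w a) \<in> jet_alg I" by (intro jet_alg_lift smooth_d_w assms)
  have "(Dz ^^ Suc (Suc k)) (lift a) = Dz (\<lambda>x j. lift (d_w a) x j * T (Suc k) x j + R x j)"
    using eq by simp
  also have "\<dots> = (\<lambda>x j. lift (d_w a) x j * T (Suc (Suc k)) x j +
      (Dz (lift (d_w a)) x j * T (Suc k) x j + Dz R x j))"
    by (intro ext) (simp add: Dz_add Dz_mult jet_alg.mult G R jet_alg_T T_Suc[symmetric])
  finally have "(Dz ^^ Suc (Suc k)) (lift a) = \<dots>" .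
  moreover have "order_le (Suc k) (\<lambda>x j. Dz (lift (d_w a)) x j * T (Suc k) x j + Dz R x j)"
    by (intro order_le_add order_le_mult order_le_T order_le_Dz R
        order_le_mono[OF order_le_Dz[OF order_le_lift[of 0]]]) simp
  moreover have "(\<lambda>x j. Dz (lift (d_w a)) x j * T (Suc k) x j + Dz R x j) \<in> jet_alg I"
    by (intro jet_alg.add jet_alg.mult jet_alg_Dz G R jet_alg_T)
  ultimately show ?case by blast
qed

text \<open>
  The two highest-order terms of the iterated total derivative of a differential function that is
  affine in the first derivative. The nonlinear parts of the determining equations are read off
  from them.
\<close>

lemma Dz_iter_first_order:
  fixes m :: nat
  assumes a: "smooth2 I a" and b: "smooth2 I b"
  defines "N \<equiv> Suc (Suc m)"
  shows "\<exists>R. order_le (Suc m) R \<and>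
    (Dz ^^ N) (\<lambda>x j. lift a x j + lift b x j * T 1 x j) =
    (\<lambda>x j. lift b x j * T (Suc N) x j +
      (real (N + 1) * lift (d_w b) x j * T 1 x j + (lift (d_w a) x j + real N * lift (d_z b) x j)) * T N x j
      + R x j)"
proof -
  obtain R1 where R1: "order_le (Suc m) R1"
    and e1: "(Dz ^^ N) (lift a) = (\<lambda>x j. lift (d_w a) x j * T N x j + R1 x j)"
    using Dz_iter_lift[OF a, of "Suc m"] unfolding N_def by blast
  obtain R2 where R2: "order_le (Suc m) R2"
    and e2: "(Dz ^^ N) (lift b) = (\<lambda>x j. lift (d_w b) x j * T N x j + R2 x j)"
    using Dz_iter_lift[OF b, of "Suc m"] unfolding N_def by blast
  define M where "M x j = (\<Sum>i<m. real (N choose (i + 2)) * (Dz ^^ (i + 2)) (lift b) x j * T (m - i + 1) x j)"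
    for x j
  have split: "(\<Sum>i\<le>N. f i) = f 0 + f 1 + (\<Sum>i<m. f (i + 2)) + f N" for f :: "nat \<Rightarrow> real"
  proof -
    have "(\<Sum>i\<le>N. f i) = (\<Sum>i\<le>Suc m. f i) + f N" by (simp add: N_def)
    also have "(\<Sum>i\<le>Suc m. f i) = f 0 + (\<Sum>i\<le>m. f (Suc i))" by (rule sum.atMost_Suc_shift)
    also have "(\<Sum>i\<le>m. f (Suc i)) = f 1 + (\<Sum>i<m. f (i + 2))" by (subst sum.atMost_shift) simp
    finally show ?thesis by simp
  qed
  have oM: "order_le (Suc m) M"
    unfolding M_def
  proof (intro order_le_sum order_le_mult order_le_fun)
    fix i assume i: "i \<in> {..<m}"
    then show "order_le (Suc m) ((Dz ^^ (i + 2)) (lift b))"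
      using order_le_mono[OF order_le_Dz_iter[OF order_le_lift[of 0], of "i + 2"]] by simp
    show "order_le (Suc m) (T (m - i + 1))" using i by (intro order_le_mono[OF order_le_T]) simp
  qed
  define R where "R x j = R1 x j + M x j + R2 x j * T 1 x j" for x j
  have T_shift: "(Dz ^^ k) (T 1) = T (Suc k)" for k using T_add[of k 1] by simp
  have "order_le (Suc m) R" unfolding R_def
    by (intro order_le_add order_le_mult R1 R2 oM order_le_mono[OF order_le_T]) simp
  moreover have "(Dz ^^ N) (\<lambda>x j. lift a x j + lift b x j * T 1 x j) =
    (\<lambda>x j. lift b x j * T (Suc N) x j +
      (real (N + 1) * lift (d_w b) x j * T 1 x j + (lift (d_w a) x j + real N * lift (d_z b) x j)) * T N x j
      + R x j)"
  proof (intro ext)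
    fix x j
    have "(Dz ^^ N) (\<lambda>x j. lift a x j + lift b x j * T 1 x j) x j =
        (Dz ^^ N) (lift a) x j + (\<Sum>i\<le>N. real (N choose i) * (Dz ^^ i) (lift b) x j * T (Suc (N - i)) x j)"
      by (simp add: Dz_iter_add Dz_iter_mult jet_alg.mult jet_alg_lift a b jet_alg_T T_shift[unfolded One_nat_def])
    also have "(\<Sum>i\<le>N. real (N choose i) * (Dz ^^ i) (lift b) x j * T (Suc (N - i)) x j) =
        lift b x j * T (Suc N) x j + real N * Dz (lift b) x j * T N x j + M x j + (Dz ^^ N) (lift b) x j * T 1 x j"
    proof -
      have "Suc (N - (i + 2)) = m - i + 1" for i by (simp add: N_def)
      moreover have "Suc (N - 1) = N" by (simp add: N_def)
      ultimately show ?thesis by (simp only: split M_def) simp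
    qed
    finally show "(Dz ^^ N) (\<lambda>x j. lift a x j + lift b x j * T 1 x j) x j = lift b x j * T (Suc N) x j +
      (real (N + 1) * lift (d_w b) x j * T 1 x j + (lift (d_w a) x j + real N * lift (d_z b) x j)) * T N x j
      + R x j"
      unfolding e1 e2 R_def Dz_lift[OF b] by (simp add: algebra_simps)
  qed
  ultimately show ?thesis by blast
qed

text \<open>
  A polynomial identity may be split with respect to the highest jet coordinate. It suffices that it
  holds where this coordinate does not vanish, which is what the factor \<open>T m\<close> of the variational
  condition leaves.
\<close>

lemma top_coefficient_zero:
  assumes "x \<in> I" "order_le k K" "order_le k R"
    and zero: "\<And>j. T (Suc k) x j \<noteq> 0 \<Longrightarrow> K x j * T (Suc k) x j + R x j = 0"
  shows "K x j = 0 \<and> R x j = 0"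
proof -
  obtain t1 where t1: "T (Suc k) x (j(Suc k := t1)) = 1" using T_update[OF assms(1)] .
  obtain t2 where t2: "T (Suc k) x (j(Suc k := t2)) = 2" using T_update[OF assms(1)] .
  have "K x (j(Suc k := t)) = K x j" "R x (j(Suc k := t)) = R x j" for t
    by (rule order_leD[OF assms(2)], simp) (rule order_leD[OF assms(3)], simp)
  then show ?thesis using zero[of "j(Suc k := t1)"] zero[of "j(Suc k := t2)"] t1 t2 by simp
qed

lemma first_order_coefficients_zero:
  assumes "x \<in> I" and "\<And>j. T 1 x j \<noteq> 0 \<Longrightarrow> c (x, j 0) * T 1 x j + d (x, j 0) = 0"
  shows "c (x, y) = 0 \<and> d (x, y) = 0"
  using top_coefficient_zero[OF assms(1) order_le_lift[of 0 c] order_le_lift[of 0 d], of "\<lambda>k. y"] assms(2)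
  by (simp add: lift_def)

section \<open>Vector fields in the new coordinates\<close>

text \<open>
  Let \<open>a\<close> and \<open>b\<close> be the components of a vector field along \<open>x\<close> and \<open>y\<close>. In the new coordinates its
  components are \<open>- z_neg a\<close> along \<open>z\<close> and \<open>w_comp a b\<close> along \<open>w\<close>. Its characteristics in the old and
  the new coordinates are \<open>xy_char a b\<close> and \<open>zw_char a b\<close>.
\<close>

definition z_neg :: "(real \<times> real \<Rightarrow> real) \<Rightarrow> real \<times> real \<Rightarrow> real" where
  "z_neg a = (\<lambda>q. - (a q * (iu (fst q))\<^sup>2))"

definition w_comp :: "(real \<times> real \<Rightarrow> real) \<Rightarrow> (real \<times> real \<Rightarrow> real) \<Rightarrow> real \<times> real \<Rightarrow> real" where
  "w_comp a b = (\<lambda>q. \<alpha> * p (fst q) * b q + \<alpha> * deriv p (fst q) * a q * snd q)"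

definition zw_char :: "(real \<times> real \<Rightarrow> real) \<Rightarrow> (real \<times> real \<Rightarrow> real) \<Rightarrow> diff_fun" where
  "zw_char a b = (\<lambda>x j. lift (w_comp a b) x j + lift (z_neg a) x j * T 1 x j)"

definition xy_char :: "(real \<times> real \<Rightarrow> real) \<Rightarrow> (real \<times> real \<Rightarrow> real) \<Rightarrow> diff_fun" where
  "xy_char a b = (\<lambda>x j. b (x, j 0) - a (x, j 0) * j 1)"

lemma smooth_z_neg: "smooth2 I a \<Longrightarrow> smooth2 I (z_neg a)"
  unfolding z_neg_def
  by (intro smooth2_uminus smooth2_mult smooth2_power open_I smooth1_imp_smooth2 smooth_iu)

lemma smooth_w_comp: "smooth2 I a \<Longrightarrow> smooth2 I b \<Longrightarrow> smooth2 I (w_comp a b)"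
  unfolding w_comp_def
  by (intro smooth2_mult smooth2_add smooth2_const smooth2_snd open_I smooth1_imp_smooth2 smooth_p
      smooth1_deriv)

lemma jet_alg_xy_char: "smooth2 I a \<Longrightarrow> smooth2 I b \<Longrightarrow> xy_char a b \<in> jet_alg I"
  unfolding xy_char_def by (intro jet_alg_diff jet_alg.mult jet_alg.base jet_alg.coord)

lemma order_le_xy_char: "order_le 1 (xy_char a b)"
  unfolding xy_char_def by (intro order_le_diff order_le_mult order_le_base order_le_coord) simp

text \<open>
  Characteristics transform like the dependent variable: they differ by the factor
  \<open>\<partial>w/\<partial>y = \<alpha> u\<^sup>1\<^sup>-\<^sup>n\<close>.
\<close>

lemma xy_char_eq_zw_char:
  assumes "x \<in> I"
  shows "\<alpha> * p x * xy_char a b x j = zw_char a b x j"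
proof -
  have "(iu x)\<^sup>2 * (u x)\<^sup>2 = 1" using u_iu[OF assms] by algebra
  then show ?thesis unfolding zw_char_def T_1[OF assms] lift_def z_neg_def w_comp_def xy_char_def fst_conv snd_conv
    by algebra
qed

lemma characteristic_eq: "characteristic X = xy_char (xcomp X) (ycomp X)"
  by (simp add: characteristic_def xy_char_def vf_psi_def vf_xi_def)

lemma iu_power_eq: "iu x ^ (n + 1) = (iu x)\<^sup>2 * p x"
  using n_ge_2 by (simp add: p_def power_add[symmetric])

lemma Dz_iter_xy_char: "x \<in> I \<Longrightarrow> (Dz ^^ k) (\<lambda>x j. \<alpha> * p x * xy_char a b x j) x j = (Dz ^^ k) (zw_char a b) x j"
  by (rule Dz_iter_cong[OF xy_char_eq_zw_char])

lemma dy_w_comp: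
  assumes "smooth2 I a" "smooth2 I b" "x \<in> I"
  shows "dy (w_comp a b) (x, y) = \<alpha> * p x * dy b (x, y) + \<alpha> * deriv p x * (dy a (x, y) * y + a (x, y))"
proof -
  have "((\<lambda>t. w_comp a b (x, t)) has_real_derivative
      \<alpha> * p x * dy b (x, y) + \<alpha> * deriv p x * (dy a (x, y) * y + a (x, y))) (at y)"
    unfolding w_comp_def
    using smooth2_dy_at[OF assms(1,3), of y] smooth2_dy_at[OF assms(2,3), of y]
    by (auto intro!: derivative_eq_intros simp: algebra_simps)
  then show ?thesis using smooth2_dy_at[OF smooth_w_comp[OF assms(1,2)] assms(3)] DERIV_unique by blast
qed

lemma dy_z_neg:
  assumes "smooth2 I a" "x \<in> I"
  shows "dy (z_neg a) (x, y) = - (dy a (x, y) * (iu x)\<^sup>2)"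
proof -
  have "((\<lambda>t. z_neg a (x, t)) has_real_derivative - (dy a (x, y) * (iu x)\<^sup>2)) (at y)"
    unfolding z_neg_def using smooth2_dy_at[OF assms, of y]
    by (auto intro!: derivative_eq_intros)
  then show ?thesis using smooth2_dy_at[OF smooth_z_neg[OF assms(1)] assms(2)] DERIV_unique by blast
qed

lemma dx_z_neg:
  assumes "smooth2 I a" "x \<in> I"
  shows "dx (z_neg a) (x, y) = - (dx a (x, y) * (iu x)\<^sup>2 - 2 * deriv u x * iu x * (iu x)\<^sup>2 * a (x, y))"
proof -
  have "((\<lambda>t. z_neg a (t, y)) has_real_derivative
      - (dx a (x, y) * (iu x)\<^sup>2 + (- real 2 * deriv u x * iu x * (iu x)\<^sup>2) * a (x, y))) (at x)"
    unfolding z_neg_def fst_conv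
    by (intro DERIV_minus DERIV_mult smooth2_dx_at[OF assms] has_deriv_iu_power[OF assms(2)])
  then have "dx (z_neg a) (x, y) = - (dx a (x, y) * (iu x)\<^sup>2 + (- real 2 * deriv u x * iu x * (iu x)\<^sup>2) * a (x, y))"
    using smooth2_dx_at[OF smooth_z_neg[OF assms(1)] assms(2)] DERIV_unique by blast
  then show ?thesis by simp
qed

text \<open>
  The coefficient of \<open>w\<^sup>(\<^sup>n\<^sup>)\<close> in the divergence condition is the divergence of the vector field in
  the coordinates \<open>(z, w)\<close>.
\<close>

lemma divergence_coefficient:
  assumes "smooth2 I a" "smooth2 I b" "x \<in> I"
  shows "dy b (x, y) + dx a (x, y) - real (n + 1) * deriv u x * iu x * a (x, y) =
    d_w (w_comp a b) (x, y) - d_z (z_neg a) (x, y)"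
proof -
  define c where "c = \<alpha> * p x"
  have c: "c \<noteq> 0" using assms(3) \<alpha>_nonzero p_nonzero by (simp add: c_def)
  have n: "real (n + 1) = real (n - 1) + 2" using n_ge_2 by simp
  have cp: "\<alpha> * deriv p x = - real (n - 1) * deriv u x * iu x * c"
    using deriv_p[OF assms(3)] by (simp add: c_def)
  have ui: "u x * iu x = 1" by (rule u_iu[OF assms(3)])
  have "d_w (w_comp a b) (x, y) = dy b (x, y) - real (n - 1) * deriv u x * iu x * (dy a (x, y) * y + a (x, y))"
    unfolding d_w_def dy_w_comp[OF assms] cp fst_conv c_def[symmetric] using c by (simp add: field_simps)
  moreover have "d_z (z_neg a) (x, y) = - dx a (x, y) + 2 * deriv u x * iu x * a (x, y)
      - dy a (x, y) * (real (n - 1) * deriv u x * iu x * y)"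
    using assms(3) unfolding d_z_def dx_z_neg[OF assms(1,3)] dy_z_neg[OF assms(1,3)] fst_conv snd_conv
    using ui by simp algebra
  ultimately show ?thesis unfolding n by (simp add: algebra_simps)
qed

end

section \<open>Symmetry conditions in the new coordinates\<close>

context open_interval
begin

text \<open>
  The prolongation is \<open>\<xi> D\<close> plus the Frechet derivative in the direction of the characteristic.
\<close>

lemma prolong_eq:
  assumes "\<And>x j. x \<in> I \<Longrightarrow> F x j = P x j" "order_le N P" "x \<in> I"
  shows "prolong X F x j = fst (X (x, j 0)) * D P x j +
    (\<Sum>k\<le>N. (D ^^ k) (characteristic X) x j * partial_jet k P x j)"
proof -
  have "Sum_any (\<lambda>k. ((total_deriv ^^ k) (characteristic X) x j + vf_xi X x j * j (Suc k)) * partial_jet k F x j)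
      = (\<Sum>k\<le>N. ((D ^^ k) (characteristic X) x j + vf_xi X x j * j (Suc k)) * partial_jet k P x j)"
  proof -
    have "((total_deriv ^^ k) (characteristic X) x j + vf_xi X x j * j (Suc k)) * partial_jet k F x j
        = ((D ^^ k) (characteristic X) x j + vf_xi X x j * j (Suc k)) * partial_jet k P x j" for k
      using total_deriv_iter[of "characteristic X" "characteristic X" x k j] assms(3)
        partial_jet_cong[of F P x k j, OF assms(1)] by simp
    moreover have "{k. ((D ^^ k) (characteristic X) x j + vf_xi X x j * j (Suc k)) * partial_jet k P x j \<noteq> 0} \<subseteq> {..N}"
      using partial_jet_eq_0[OF assms(2)] by (auto simp: not_le[symmetric])
    ultimately show ?thesis by (simp add: Sum_any.expand_superset)
  qed
  moreover have "partial_x F x j = partial_x P x j" by (rule partial_x_cong[OF assms(1,3)])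
  ultimately show ?thesis
    unfolding prolong_def D_eq_sum[OF assms(2,3)]
    by (simp add: vf_xi_def algebra_simps sum.distrib sum_distrib_left)
qed

lemma frechet_adjoint_eq:
  assumes "\<And>x j. x \<in> I \<Longrightarrow> F x j = P x j" "\<And>x j. x \<in> I \<Longrightarrow> R x j = S x j" "order_le N P" "x \<in> I"
  shows "frechet_adjoint F R x j = (\<Sum>k\<le>N. (neg_D ^^ k) (\<lambda>x j. partial_jet k P x j * S x j) x j)"
proof -
  have *: "((\<lambda>P x j. - total_deriv P x j) ^^ k) (\<lambda>x j. frechet_coeffs F k x j * R x j) x j
      = (neg_D ^^ k) (\<lambda>x j. partial_jet k P x j * S x j) x j" for k
    by (rule neg_total_deriv_iter[OF _ assms(4)])
      (simp add: frechet_coeffs_def assms(2) partial_jet_cong[of F P, OF assms(1)])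
  have "(neg_D ^^ k) (\<lambda>x j. partial_jet k P x j * S x j) x j = 0" if "N < k" for k
    by (rule neg_D_iter_zero[OF _ assms(4)]) (simp add: partial_jet_eq_0[OF assms(3) that])
  then have "{k. (neg_D ^^ k) (\<lambda>x j. partial_jet k P x j * S x j) x j \<noteq> 0} \<subseteq> {..N}"
    by (auto simp: not_le[symmetric])
  then show ?thesis
    unfolding frechet_adjoint_def operator_adjoint_def * by (simp add: Sum_any.expand_superset)
qed

end

text \<open>
  The new independent variable \<open>z\<close> differs from \<open>\<zeta>\<close> by a constant on \<open>I\<close>; only its derivative matters.
\<close>

locale coordinate_change = source_solutions +
  fixes z :: "real \<Rightarrow> real"
  assumes deriv_z: "\<And>x. x \<in> I \<Longrightarrow> (z has_real_derivative 1 / (u x)\<^sup>2) (at x)"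
begin

lemma total_deriv_new_z: "x \<in> I \<Longrightarrow> total_deriv (new_z z) x j = (iu x)\<^sup>2"
  using DERIV_imp_deriv[OF deriv_z]
  by (simp add: total_deriv_def partial_x_def partial_jet_def new_z_def iu_def power_inverse divide_inverse)

lemma transformed_jet_eq_T: "x \<in> I \<Longrightarrow> transformed_jet (new_z z) (new_w n \<alpha> u) k x j = T k x j"
proof (induction k arbitrary: x j)
  case 0
  have e: "1 - int n = - int (n - 1)" using n_ge_2 by simp
  show ?case
    by (simp add: transformed_jet_def T_0 new_w_def p_def iu_def e power_int_minus power_inverse)
next
  case (Suc k)
  have "total_deriv (transformed_jet (new_z z) (new_w n \<alpha> u) k) x j = D (T k) x j"
    using total_deriv_cong[of "transformed_jet (new_z z) (new_w n \<alpha> u) k" "T k", OF Suc.IH Suc.prems] Suc.prems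
    by (simp add: D_inside)
  then show ?case
    using total_deriv_new_z[OF Suc.prems]
    by (simp add: transformed_jet_def T_Suc Dz_def iu_def power_inverse divide_inverse)
qed

lemma partial_jet_T:
  assumes "x \<in> I"
  shows "partial_jet i (T k) x j = tc k i x"
proof (cases "i \<le> k")
  case True
  have "T k x (j(i := t)) = (\<Sum>l\<in>{..k} - {i}. tc k l x * j l) + tc k i x * t" for t
  proof -
    have "T k x (j(i := t)) = tc k i x * (j(i := t)) i + (\<Sum>l\<in>{..k} - {i}. tc k l x * (j(i := t)) l)"
      unfolding T_expand[OF assms] by (rule sum.remove) (use True in auto)
    also have "(\<Sum>l\<in>{..k} - {i}. tc k l x * (j(i := t)) l) = (\<Sum>l\<in>{..k} - {i}. tc k l x * j l)"
      by (rule sum.cong) auto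
    finally show ?thesis by (simp only: fun_upd_same add.commute)
  qed
  then have "((\<lambda>t. T k x (j(i := t))) has_real_derivative tc k i x) (at (j i))"
    by (auto intro!: derivative_eq_intros)
  then show ?thesis unfolding partial_jet_def by (rule DERIV_imp_deriv)
next
  case False
  then show ?thesis using partial_jet_eq_0[OF order_le_T] tc_zero assms by simp
qed

text \<open>
  The left-hand side \<open>\<alpha>\<^sup>-\<^sup>1 u\<^sup>-\<^sup>(\<^sup>n\<^sup>+\<^sup>1\<^sup>) w\<^sup>(\<^sup>n\<^sup>)\<close> of the equation in terms of the new jet coordinates.
\<close>

definition Delta_jet :: diff_fun where
  "Delta_jet = (\<lambda>x j. iu x ^ (n + 1) / \<alpha> * T n x j)"

lemma smooth_Delta_jet_factor: "smooth1 I (\<lambda>x. iu x ^ (n + 1) / \<alpha>)"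
  using smooth1_mult[OF open_I smooth1_power[OF open_I smooth_iu, of "n + 1"] smooth1_const[of I "1 / \<alpha>"]]
  by simp

lemma jet_alg_Delta_jet: "Delta_jet \<in> jet_alg I"
  unfolding Delta_jet_def by (intro jet_alg.mult jet_alg_T jet_alg_fun smooth_Delta_jet_factor)

lemma order_le_Delta_jet: "order_le n Delta_jet"
  unfolding Delta_jet_def by (intro order_le_mult order_le_fun order_le_T)

lemma Delta_eq:
  assumes "x \<in> I"
  shows "Delta n \<alpha> u z x j = Delta_jet x j"
proof -
  have t: "transform_fun (new_z z) (new_w n \<alpha> u) (\<lambda>z w. w n) x j = T n x j" if "x \<in> I" for x j
    using transformed_jet_eq_T[OF that] by (simp add: transform_fun_def)
  have "partial_jet n (transform_fun (new_z z) (new_w n \<alpha> u) (\<lambda>z w. w n)) x j = tc n n x"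
    using partial_jet_cong[of "transform_fun (new_z z) (new_w n \<alpha> u) (\<lambda>z w. w n)" "T n", OF t assms]
      partial_jet_T[OF assms] by simp
  also have "\<dots> = \<alpha> * u x ^ (n + 1)"
  proof -
    have "iu x ^ (n - 1) * (u x ^ (n - 1) * u x ^ (n + 1)) = u x ^ (n + 1)"
      by (simp only: mult.assoc[symmetric] power_mult_distrib[symmetric] mult.commute[of "iu x" "u x"]
          u_iu[OF assms] power_one mult_1)
    moreover have "(u x ^ 2) ^ n = u x ^ (n - 1) * u x ^ (n + 1)"
    proof -
      have "2 * n = (n - 1) + (n + 1)" using n_ge_2 by simp
      then show ?thesis by (simp only: power_add power_mult[symmetric])
    qed
    ultimately show ?thesis by (simp only: tc_lead[OF assms] p_def mult.assoc)
  qed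
  finally show ?thesis
    by (simp add: Delta_def monic_def t[OF assms] Delta_jet_def iu_def power_inverse divide_inverse)
qed

lemma partial_jet_Delta_jet:
  assumes "x \<in> I"
  shows "partial_jet k Delta_jet x j = iu x ^ (n + 1) / \<alpha> * tc n k x"
proof -
  have "((\<lambda>t. T n x (j(k := t))) has_real_derivative tc n k x) (at (j k))"
    using jet_alg_partial_jet[OF jet_alg_T assms] partial_jet_T[OF assms] by simp
  then show ?thesis unfolding partial_jet_def Delta_jet_def by (rule DERIV_imp_deriv[OF DERIV_cmult])
qed

lemma D_Delta_jet:
  assumes "x \<in> I"
  shows "D Delta_jet x j = iu x ^ (n + 1) / \<alpha> * ((iu x)\<^sup>2 * T (Suc n) x j - real (n + 1) * deriv u x * iu x * T n x j)"
proof -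
  have "((\<lambda>x. iu x ^ (n + 1) / \<alpha>) has_real_derivative - real (n + 1) * deriv u x * iu x * iu x ^ (n + 1) / \<alpha>) (at x)"
    by (rule DERIV_cdivide[OF has_deriv_iu_power[OF assms]])
  then have d: "deriv (\<lambda>x. iu x ^ (n + 1) / \<alpha>) x = - real (n + 1) * deriv u x * iu x * iu x ^ (n + 1) / \<alpha>"
    by (rule DERIV_imp_deriv)
  have t: "D (T n) x j = (iu x)\<^sup>2 * T (Suc n) x j"
    using iu2_u2[OF assms] by (simp add: T_Suc Dz_def)
  have "D Delta_jet x j = deriv (\<lambda>x. iu x ^ (n + 1) / \<alpha>) x * T n x j + iu x ^ (n + 1) / \<alpha> * D (T n) x j"
    unfolding Delta_jet_def
    using assms by (simp only: D_mult[OF jet_alg_fun[OF smooth_Delta_jet_factor] jet_alg_T] D_fun[OF smooth_Delta_jet_factor] if_True)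
  then show ?thesis unfolding d t
    using \<alpha>_nonzero by (simp add: field_simps del: of_nat_add of_nat_Suc power_Suc)
qed

lemma prolong_Delta:
  assumes a: "smooth2 I (xcomp X)" and b: "smooth2 I (ycomp X)" and x: "x \<in> I"
  shows "prolong X (Delta n \<alpha> u z) x j = iu x ^ (n + 1) / \<alpha> *
    ((Dz ^^ n) (zw_char (xcomp X) (ycomp X)) x j - lift (z_neg (xcomp X)) x j * T (Suc n) x j
     - real (n + 1) * deriv u x * iu x * fst (X (x, j 0)) * T n x j)"
proof -
  note ch = characteristic_eq[of X]
  note pj = partial_jet_Delta_jet[OF x]
  have "prolong X (Delta n \<alpha> u z) x j = fst (X (x, j 0)) * D Delta_jet x j +
      (\<Sum>k\<le>n. (D ^^ k) (characteristic X) x j * partial_jet k Delta_jet x j)"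
    by (rule prolong_eq[OF Delta_eq order_le_Delta_jet x])
  also have "(\<Sum>k\<le>n. (D ^^ k) (characteristic X) x j * partial_jet k Delta_jet x j) =
      iu x ^ (n + 1) / \<alpha> * (\<Sum>k\<le>n. tc n k x * (D ^^ k) (characteristic X) x j)"
    by (simp add: pj sum_distrib_left algebra_simps)
  also have "(\<Sum>k\<le>n. tc n k x * (D ^^ k) (characteristic X) x j) = (Dz ^^ n) (zw_char (xcomp X) (ycomp X)) x j"
    using Dz_iter_expand[OF jet_alg_xy_char[OF a b] x] Dz_iter_xy_char[OF x] unfolding ch by simp
  finally show ?thesis unfolding D_Delta_jet[OF x] by (simp add: lift_def z_neg_def algebra_simps)
qed

text \<open>
  By the adjoint formula, the divergence condition is, up to a factor without zeros, the divergence
  condition of \<open>w\<^sup>(\<^sup>n\<^sup>) = 0\<close>.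
\<close>

lemma divergence_condition:
  assumes X: "smooth2 I (xcomp X)" "smooth2 I (ycomp X)" and x: "x \<in> I"
  defines "a \<equiv> xcomp X" and "b \<equiv> ycomp X"
  shows "frechet_adjoint (Delta n \<alpha> u z) (characteristic X) x j
      + frechet_adjoint (characteristic X) (Delta n \<alpha> u z) x j =
    iu x ^ (n + 1) / \<alpha> * ((- 1) ^ n * (Dz ^^ n) (zw_char a b) x j - lift (z_neg a) x j * T (Suc n) x j
     + (d_w (w_comp a b) (x, j 0) - d_z (z_neg a) (x, j 0)) * T n x j)"
proof -
  note sa = X(1)[folded a_def] and sb = X(2)[folded b_def]
  have ch: "characteristic X = xy_char a b"
    unfolding a_def b_def by (rule characteristic_eq)
  define f where "f = (\<lambda>x. iu x ^ (n + 1) / \<alpha>)"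
  have f: "smooth1 I f" unfolding f_def by (rule smooth_Delta_jet_factor)
  have C: "xy_char a b \<in> jet_alg I" by (rule jet_alg_xy_char[OF sa sb])
  have pj: "partial_jet k Delta_jet x j = f x * tc n k x" if "x \<in> I" for k x j
    unfolding f_def by (rule partial_jet_Delta_jet[OF that])
  have "frechet_adjoint (Delta n \<alpha> u z) (xy_char a b) x j =
      (\<Sum>k\<le>n. (neg_D ^^ k) (\<lambda>x j. partial_jet k Delta_jet x j * xy_char a b x j) x j)"
    by (rule frechet_adjoint_eq[OF Delta_eq refl order_le_Delta_jet x])
  also have "\<dots> = (\<Sum>k\<le>n. (neg_D ^^ k) (\<lambda>x j. tc n k x * (f x * xy_char a b x j)) x j)"
    by (intro sum.cong refl neg_D_iter_cong[OF _ x]) (simp add: pj)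
  also have "\<dots> = (- 1) ^ n * \<alpha> * p x * (iu x)\<^sup>2 * (Dz ^^ n) (\<lambda>x j. (u x)\<^sup>2 * (f x * xy_char a b x j)) x j"
    by (rule adjoint_T[OF _ x]) (intro jet_alg.mult jet_alg_fun f C)
  also have "(Dz ^^ n) (\<lambda>x j. (u x)\<^sup>2 * (f x * xy_char a b x j)) x j =
      (Dz ^^ n) (\<lambda>x j. (1 / \<alpha>\<^sup>2) * (\<alpha> * p x * xy_char a b x j)) x j"
  proof (rule Dz_iter_cong[OF _ x])
    fix x :: real and j :: "nat \<Rightarrow> real" assume x: "x \<in> I"
    have "(u x)\<^sup>2 * (iu x)\<^sup>2 = 1" using u_iu[OF x] by algebra
    then have p: "(u x)\<^sup>2 * iu x ^ (n + 1) = p x"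
      by (simp only: iu_power_eq mult.assoc[symmetric] mult_1)
    have "(u x)\<^sup>2 * (f x * xy_char a b x j) = (u x)\<^sup>2 * iu x ^ (n + 1) * xy_char a b x j / \<alpha>"
      unfolding f_def by (simp only: times_divide_eq_left times_divide_eq_right mult.assoc)
    then show "(u x)\<^sup>2 * (f x * xy_char a b x j) = (1 / \<alpha>\<^sup>2) * (\<alpha> * p x * xy_char a b x j)"
      unfolding p using \<alpha>_nonzero by (simp add: power2_eq_square)
  qed
  also have "\<dots> = (1 / \<alpha>\<^sup>2) * (Dz ^^ n) (zw_char a b) x j"
    using Dz_iter_cmult[of "\<lambda>x j. \<alpha> * p x * xy_char a b x j" n "1 / \<alpha>\<^sup>2"] Dz_iter_xy_char[OF x]
      jet_alg.mult[OF jet_alg_fun[OF smooth_\<alpha>p] C] by simp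
  also have "(- 1) ^ n * \<alpha> * p x * (iu x)\<^sup>2 * ((1 / \<alpha>\<^sup>2) * (Dz ^^ n) (zw_char a b) x j) =
      iu x ^ (n + 1) / \<alpha> * ((- 1) ^ n * (Dz ^^ n) (zw_char a b) x j)"
    unfolding iu_power_eq using \<alpha>_nonzero by (simp add: power2_eq_square)
  finally have A: "frechet_adjoint (Delta n \<alpha> u z) (xy_char a b) x j =
      iu x ^ (n + 1) / \<alpha> * ((- 1) ^ n * (Dz ^^ n) (zw_char a b) x j)" .
  have p0: "partial_jet 0 (xy_char a b) x j = dy b (x, j 0) - dy a (x, j 0) * j 1" if "x \<in> I" for x j
  proof -
    have "((\<lambda>t. b (x, t) - a (x, t) * j 1) has_real_derivative dy b (x, j 0) - dy a (x, j 0) * j 1) (at (j 0))"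
      by (intro DERIV_diff DERIV_cmult_right smooth2_dy_at[OF sa that] smooth2_dy_at[OF sb that])
    from DERIV_imp_deriv[OF this] show ?thesis by (simp add: partial_jet_def xy_char_def)
  qed
  have p1: "partial_jet 1 (xy_char a b) x j = - a (x, j 0)" for x j
  proof -
    have "((\<lambda>t. b (x, j 0) - a (x, j 0) * t) has_real_derivative - a (x, j 0)) (at (j 1))"
      by (auto intro!: derivative_eq_intros)
    from DERIV_imp_deriv[OF this] show ?thesis by (simp add: partial_jet_def xy_char_def)
  qed
  have "frechet_adjoint (xy_char a b) (Delta n \<alpha> u z) x j =
      (\<Sum>k\<le>1. (neg_D ^^ k) (\<lambda>x j. partial_jet k (xy_char a b) x j * Delta_jet x j) x j)"
    by (rule frechet_adjoint_eq[OF refl Delta_eq order_le_xy_char x])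
  also have "\<dots> = partial_jet 0 (xy_char a b) x j * Delta_jet x j + neg_D (\<lambda>x j. - a (x, j 0) * Delta_jet x j) x j"
    by (simp add: p1[unfolded One_nat_def])
  also have "\<dots> = (dy b (x, j 0) - dy a (x, j 0) * j 1) * Delta_jet x j + D (\<lambda>x j. a (x, j 0) * Delta_jet x j) x j"
    using D_uminus[OF jet_alg.mult[OF jet_alg.base[OF sa] jet_alg_Delta_jet]] by (simp add: p0[OF x] neg_D_def)
  also have "\<dots> = (dy b (x, j 0) + dx a (x, j 0)) * Delta_jet x j + a (x, j 0) * D Delta_jet x j"
    using x by (simp add: D_mult[OF jet_alg.base[OF sa] jet_alg_Delta_jet] D_base[OF sa] algebra_simps)
  also have "\<dots> = iu x ^ (n + 1) / \<alpha> * ((dy b (x, j 0) + dx a (x, j 0) - real (n + 1) * deriv u x * iu x * a (x, j 0)) * T n x j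
      + a (x, j 0) * (iu x)\<^sup>2 * T (Suc n) x j)"
    unfolding D_Delta_jet[OF x] by (simp add: Delta_jet_def algebra_simps add_divide_distrib)
  also have "\<dots> = iu x ^ (n + 1) / \<alpha> * ((d_w (w_comp a b) (x, j 0) - d_z (z_neg a) (x, j 0)) * T n x j
      - lift (z_neg a) x j * T (Suc n) x j)"
    unfolding divergence_coefficient[OF sa sb x] by (simp add: lift_def z_neg_def)
  finally show ?thesis unfolding ch A by (simp add: algebra_simps)
qed

text \<open>
  The same reduction for the variational condition. Every term has the factor \<open>w\<^sup>(\<^sup>m\<^sup>)\<close>, as the
  Lagrangian is quadratic in it.
\<close>

lemma variational_condition:
  assumes X: "smooth2 I (xcomp X)" "smooth2 I (ycomp X)" and x: "x \<in> I"
  defines "a \<equiv> xcomp X" and "b \<equiv> ycomp X" and "m \<equiv> n div 2"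
  shows "prolong X (Lagrangian n \<alpha> u z) x j + Lagrangian n \<alpha> u z x j * total_deriv (vf_xi X) x j =
    (- 1) ^ m * (iu x)\<^sup>2 * T m x j *
    ((Dz ^^ m) (zw_char a b) x j - lift (z_neg a) x j * T (Suc m) x j - Dz (lift (z_neg a)) x j * T m x j / 2)"
proof -
  note sa = X(1)[folded a_def] and sb = X(2)[folded b_def]
  have ch: "characteristic X = xy_char a b"
    unfolding a_def b_def by (rule characteristic_eq)
  have C: "xy_char a b \<in> jet_alg I" by (rule jet_alg_xy_char[OF sa sb])
  define f where "f = (\<lambda>x. (- 1) ^ m / 2 * (iu x)\<^sup>2)"
  define Lg where "Lg = (\<lambda>x j. f x * (T m x j * T m x j))"
  have f: "smooth1 I f" unfolding f_def by (intro smooth1_mult smooth1_const smooth1_power open_I smooth_iu)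
  have L_eq: "Lagrangian n \<alpha> u z x j = Lg x j" if "x \<in> I" for x j
    using that
    by (simp add: Lagrangian_def transform_lagrangian_def transform_fun_def transformed_jet_eq_T
        total_deriv_new_z Lg_def f_def m_def power2_eq_square)
  have oL: "order_le m Lg" unfolding Lg_def by (intro order_le_mult order_le_fun order_le_T)
  have pj: "partial_jet k Lg x j = 2 * f x * T m x j * tc m k x" for k
  proof -
    have d: "((\<lambda>t. T m x (j(k := t))) has_real_derivative tc m k x) (at (j k))"
      using jet_alg_partial_jet[OF jet_alg_T x] partial_jet_T[OF x] by simp
    from DERIV_imp_deriv[OF DERIV_cmult[OF DERIV_mult[OF d d]]] show ?thesis
      by (simp add: partial_jet_def Lg_def algebra_simps)
  qed
  have "prolong X (Lagrangian n \<alpha> u z) x j = a (x, j 0) * D Lg x j +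
      (\<Sum>k\<le>m. (D ^^ k) (characteristic X) x j * partial_jet k Lg x j)"
    using prolong_eq[OF L_eq oL x] by (simp add: a_def)
  also have "(\<Sum>k\<le>m. (D ^^ k) (characteristic X) x j * partial_jet k Lg x j) =
      2 * f x * T m x j * (\<Sum>k\<le>m. tc m k x * (D ^^ k) (characteristic X) x j)"
    by (simp add: pj sum_distrib_left algebra_simps)
  also have "(\<Sum>k\<le>m. tc m k x * (D ^^ k) (characteristic X) x j) = (Dz ^^ m) (zw_char a b) x j"
    using Dz_iter_expand[OF C x] Dz_iter_xy_char[OF x] unfolding ch by simp
  finally have P: "prolong X (Lagrangian n \<alpha> u z) x j =
      a (x, j 0) * D Lg x j + 2 * f x * T m x j * (Dz ^^ m) (zw_char a b) x j" .
  have df: "deriv f x = - 2 * deriv u x * iu x * f x"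
  proof -
    have "(f has_real_derivative (- 1) ^ m / 2 * (- real 2 * deriv u x * iu x * (iu x)\<^sup>2)) (at x)"
      unfolding f_def by (rule DERIV_cmult[OF has_deriv_iu_power[OF x]])
    from DERIV_imp_deriv[OF this] show ?thesis by (simp add: f_def algebra_simps)
  qed
  have ui: "u x * iu x = 1" by (rule u_iu[OF x])
  have DT: "D (T m) x j = (iu x)\<^sup>2 * T (Suc m) x j"
    using iu2_u2[OF x] by (simp add: T_Suc Dz_def)
  have DL: "D Lg x j = f x * (2 * T m x j * (iu x)\<^sup>2 * T (Suc m) x j - 2 * deriv u x * iu x * (T m x j)\<^sup>2)"
    using x unfolding Lg_def
    by (simp add: D_mult jet_alg_fun f jet_alg.mult jet_alg_T D_fun DT df)
      (simp add: algebra_simps power2_eq_square)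
  have td: "total_deriv (vf_xi X) x j = dx a (x, j 0) + dy a (x, j 0) * j 1"
    using D_base[OF sa] D_inside[OF x, of "\<lambda>x j. a (x, j 0)"] x by (simp add: vf_xi_def a_def)
  have EZ: "Dz (lift (z_neg a)) x j = - (dx a (x, j 0) + dy a (x, j 0) * j 1) + 2 * deriv u x * iu x * a (x, j 0)"
  proof -
    have "Dz (lift (z_neg a)) x j = (u x)\<^sup>2 * (dx (z_neg a) (x, j 0) + dy (z_neg a) (x, j 0) * j 1)"
      using x by (simp add: Dz_def lift_def D_base[OF smooth_z_neg[OF sa]])
    then show ?thesis unfolding dx_z_neg[OF sa x] dy_z_neg[OF sa x] using ui by algebra
  qed
  have ring: "A * (F * (2 * t * i2 * t' - 2 * U * i * t\<^sup>2)) + 2 * F * t * q + F * (t * t) * s =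
      2 * F * t * (q - - (A * i2) * t' - (- s + 2 * U * i * A) * t / 2)"
    for A F t i2 t' U i q s :: real
    by (simp add: algebra_simps power2_eq_square diff_divide_distrib)
  have f2: "2 * f x = (- 1) ^ m * (iu x)\<^sup>2" by (simp add: f_def)
  have "prolong X (Lagrangian n \<alpha> u z) x j + Lagrangian n \<alpha> u z x j * total_deriv (vf_xi X) x j =
    2 * f x * T m x j *
    ((Dz ^^ m) (zw_char a b) x j - lift (z_neg a) x j * T (Suc m) x j - Dz (lift (z_neg a)) x j * T m x j / 2)"
    unfolding P L_eq[OF x] DL td EZ unfolding Lg_def lift_def z_neg_def fst_conv by (rule ring)
  then show ?thesis unfolding f2 .
qed

end

section \<open>Functions annihilated by a power of the derivation\<close>

context source_solutions
begin

lemma dz_cong: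
  assumes "\<And>x. x \<in> I \<Longrightarrow> f x = g x"
  shows "dz f = dz g"
proof -
  have "deriv f x = deriv g x" if "x \<in> I" for x
  proof -
    have "\<forall>\<^sub>F t in nhds x. f t = g t"
      using eventually_nhds_in_open[OF open_I that] by (rule eventually_mono) (rule assms)
    then show ?thesis by (rule deriv_cong_ev) simp
  qed
  then show ?thesis unfolding dz_def by auto
qed

lemma dz_iter_cong:
  assumes "\<And>x. x \<in> I \<Longrightarrow> f x = g x" "x \<in> I"
  shows "(dz ^^ k) f x = (dz ^^ k) g x"
proof (cases k)
  case (Suc l)
  then show ?thesis using dz_cong[of f g] assms(1) by (simp add: funpow_swap1)
qed (simp add: assms)

lemma deriv_eq_dz:
  assumes "smooth1 I h" "x \<in> I"
  shows "(h has_real_derivative (iu x)\<^sup>2 * dz h x) (at x)"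
  using smooth1_differentiable[OF assms] assms(2) by (simp only: dz_def if_True iu2_u2)

lemma has_deriv_\<zeta>_power:
  assumes "x \<in> I"
  shows "((\<lambda>x. \<zeta> x ^ Suc k) has_real_derivative real (Suc k) * (iu x)\<^sup>2 * \<zeta> x ^ k) (at x)"
  using DERIV_power_Suc[OF has_deriv_\<zeta>[OF assms], of k] by (simp add: mult.assoc mult.commute mult.left_commute)

lemma dz_const: "dz (\<lambda>x. c) = (\<lambda>x. 0)"
  by (auto simp: dz_def)

lemma dz_iter_Suc: "(dz ^^ Suc k) h = (dz ^^ k) (dz h)"
  by (simp add: funpow_swap1)

text \<open>
  Since \<open>dz \<zeta> = 1\<close> and \<open>I\<close> is connected, the functions annihilated by the \<open>k\<close>-th power of \<open>dz\<close> are
  the polynomials in \<open>\<zeta>\<close> of degree less than \<open>k\<close>.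
\<close>

lemma dz_iter_zero_imp_polynomial:
  assumes "smooth1 I h" "\<And>x. x \<in> I \<Longrightarrow> (dz ^^ k) h x = 0"
  shows "\<exists>c. \<forall>x\<in>I. h x = (\<Sum>i<k. c i * \<zeta> x ^ i)"
  using assms
proof (induction k arbitrary: h)
  case (Suc k)
  obtain c where c: "\<forall>x\<in>I. dz h x = (\<Sum>i<k. c i * \<zeta> x ^ i)"
    using Suc.IH[OF smooth_dz[OF Suc.prems(1)]] Suc.prems(2) unfolding dz_iter_Suc by blast
  define d where "d i = c i / real (Suc i)" for i
  have "((\<lambda>x. h x - (\<Sum>i<k. d i * \<zeta> x ^ Suc i)) has_real_derivative 0) (at x within I)" if "x \<in> I" for x
  proof -
    have "((\<lambda>x. h x - (\<Sum>i<k. d i * \<zeta> x ^ Suc i)) has_real_derivative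
        (iu x)\<^sup>2 * dz h x - (\<Sum>i<k. d i * (real (Suc i) * (iu x)\<^sup>2 * \<zeta> x ^ i))) (at x)"
      by (intro DERIV_diff DERIV_sum DERIV_cmult deriv_eq_dz Suc.prems(1) has_deriv_\<zeta>_power that)
    moreover have "(iu x)\<^sup>2 * dz h x = (\<Sum>i<k. d i * (real (Suc i) * (iu x)\<^sup>2 * \<zeta> x ^ i))"
      using c that by (auto simp: d_def sum_distrib_left intro!: sum.cong)
    ultimately show ?thesis by (simp add: has_field_derivative_at_within)
  qed
  then obtain e where e: "\<forall>x\<in>I. h x - (\<Sum>i<k. d i * \<zeta> x ^ Suc i) = e"
    using has_field_derivative_zero_constant[OF convex_I] by blast
  have "h x = (\<Sum>i<Suc k. (case i of 0 \<Rightarrow> e | Suc l \<Rightarrow> d l) * \<zeta> x ^ i)" if "x \<in> I" for x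
    unfolding sum.lessThan_Suc_shift using e that by (force simp: algebra_simps)
  then show ?case by blast
qed simp

lemma dz_polynomial:
  assumes "\<And>x. x \<in> I \<Longrightarrow> h x = (\<Sum>i<Suc k. c i * \<zeta> x ^ i)" "x \<in> I"
  shows "dz h x = (\<Sum>i<k. real (Suc i) * c (Suc i) * \<zeta> x ^ i)"
proof -
  have "((\<lambda>x. c 0 + (\<Sum>i<k. c (Suc i) * \<zeta> x ^ Suc i)) has_real_derivative
      0 + (\<Sum>i<k. c (Suc i) * (real (Suc i) * (iu x)\<^sup>2 * \<zeta> x ^ i))) (at x)"
    by (intro DERIV_add DERIV_const DERIV_sum DERIV_cmult has_deriv_\<zeta>_power assms(2))
  moreover have "h x = c 0 + (\<Sum>i<k. c (Suc i) * \<zeta> x ^ Suc i)" if "x \<in> I" for x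
    using assms(1)[OF that] unfolding sum.lessThan_Suc_shift by simp
  ultimately have "(h has_real_derivative (\<Sum>i<k. c (Suc i) * (real (Suc i) * (iu x)\<^sup>2 * \<zeta> x ^ i))) (at x)"
    using has_field_derivative_transform_within_open[OF _ open_I assms(2)] by fastforce
  from dz_eq[OF assms(2) this] show ?thesis
    unfolding sum_distrib_left
  proof (simp, intro sum.cong refl)
    fix i
    have "(u x)\<^sup>2 * (c (Suc i) * ((1 + real i) * (iu x)\<^sup>2 * \<zeta> x ^ i)) =
        (iu x)\<^sup>2 * ((u x)\<^sup>2 * ((1 + real i) * c (Suc i) * \<zeta> x ^ i))" by (simp add: algebra_simps)
    then show "(u x)\<^sup>2 * (c (Suc i) * ((1 + real i) * (iu x)\<^sup>2 * \<zeta> x ^ i)) = (1 + real i) * c (Suc i) * \<zeta> x ^ i"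
      using iu2_u2[OF assms(2)] by simp
  qed
qed

lemma dz_iter_polynomial_eq_0:
  assumes "\<And>x. x \<in> I \<Longrightarrow> h x = (\<Sum>i<k. c i * \<zeta> x ^ i)" "x \<in> I"
  shows "(dz ^^ k) h x = 0"
  using assms
proof (induction k arbitrary: h c)
  case (Suc k)
  have "(dz ^^ k) (dz h) x = 0"
    by (rule Suc.IH[OF dz_polynomial Suc.prems(2)]) (rule Suc.prems(1))
  then show ?case unfolding dz_iter_Suc .
qed simp

lemma dz_iter_zero_mono:
  assumes "\<And>x. x \<in> I \<Longrightarrow> (dz ^^ k) h x = 0" "k \<le> l" "x \<in> I"
  shows "(dz ^^ l) h x = 0"
proof -
  obtain i where l: "l = i + k" using assms(2) le_Suc_ex add.commute by metis
  have "(dz ^^ i) ((dz ^^ k) h) x = (dz ^^ i) (\<lambda>x. 0) x"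
    by (rule dz_iter_cong[OF _ assms(3)]) (rule assms(1))
  also have "(dz ^^ i) (\<lambda>x. 0) = (\<lambda>x. 0)" by (induction i) (simp_all add: dz_const)
  finally show ?thesis by (simp add: l funpow_add)
qed

section \<open>Vector fields that are affine in the dependent variable\<close>

lemma constant_in_y:
  assumes "smooth2 I c" "\<And>y. dy c (x, y) = 0" "x \<in> I"
  shows "c (x, y) = c (x, 0)"
  using DERIV_isconst_all[of "\<lambda>t. c (x, t)" y 0] smooth2_dy_at[OF assms(1,3)] assms(2) by simp

lemma affine_in_y:
  assumes "smooth2 I c" "\<And>y. dy c (x, y) = k" "x \<in> I"
  shows "c (x, y) = c (x, 0) + k * y"
proof -
  have "((\<lambda>t. c (x, t) - k * t) has_real_derivative k - k) (at y)" for y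
    using smooth2_dy_at[OF assms(1,3), of y] assms(2) by (auto intro!: derivative_eq_intros)
  then have "c (x, y) - k * y = c (x, 0) - k * 0"
    using DERIV_isconst_all[of "\<lambda>t. c (x, t) - k * t" y 0] by simp
  then show ?thesis by simp
qed

lemma d_w_eq_0_iff: "x \<in> I \<Longrightarrow> d_w c (x, y) = 0 \<longleftrightarrow> dy c (x, y) = 0"
  using \<alpha>_nonzero p_nonzero by (simp add: d_w_def)

lemma d_z_constant_in_y:
  assumes "smooth2 I c" "\<And>x y. x \<in> I \<Longrightarrow> d_w c (x, y) = 0" "x \<in> I"
  shows "d_z c (x, y) = d_z c (x, 0)"
proof -
  have d: "dy c (x, y) = 0" if "x \<in> I" for x y using assms(2)[OF that] d_w_eq_0_iff[OF that] by simp
  have "((\<lambda>t. c (t, y)) has_real_derivative dx c (x, 0)) (at x)"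
    by (rule has_field_derivative_transform_within_open[OF smooth2_dx_at[OF assms(1,3)] open_I assms(3)])
      (simp add: constant_in_y[OF assms(1) d, where y = y])
  then have "dx c (x, y) = dx c (x, 0)"
    using smooth2_dx_at[OF assms(1,3)] DERIV_unique by blast
  then show ?thesis using assms(3) by (simp add: d_z_def d)
qed

text \<open>
  The components \<open>a, b\<close> of a vector field are \<open>\<xi>(x)\<close> and \<open>A(x) y + \<beta>(x)\<close> over \<open>I\<close>, with smooth \<open>\<xi>, A, \<beta>\<close>.
\<close>

definition affine_comp ::
  "(real \<times> real \<Rightarrow> real) \<Rightarrow> (real \<times> real \<Rightarrow> real) \<Rightarrow>
   (real \<Rightarrow> real) \<Rightarrow> (real \<Rightarrow> real) \<Rightarrow> (real \<Rightarrow> real) \<Rightarrow> bool" where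
  "affine_comp a b \<xi> A \<beta> \<longleftrightarrow> smooth1 I \<xi> \<and> smooth1 I A \<and> smooth1 I \<beta> \<and>
     (\<forall>x\<in>I. \<forall>y. a (x, y) = \<xi> x \<and> b (x, y) = A x * y + \<beta> x)"

text \<open>
  The condition on \<open>z_neg a\<close> says that \<open>\<xi>\<close> does not depend on \<open>y\<close>, the condition on \<open>w_comp a b\<close> that the
  component along \<open>w\<close> is affine in \<open>w\<close>.
\<close>

lemma affine_comp_exists:
  assumes a: "smooth2 I a" and b: "smooth2 I b"
    and Z: "\<And>x y. x \<in> I \<Longrightarrow> d_w (z_neg a) (x, y) = 0"
    and P: "\<And>x y. x \<in> I \<Longrightarrow> d_w (w_comp a b) (x, y) = d_w (w_comp a b) (x, 0)"
  shows "\<exists>\<xi> A \<beta>. affine_comp a b \<xi> A \<beta>"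
proof -
  have dya: "dy a (x, y) = 0" if "x \<in> I" for x y
    using Z[OF that, of y] iu_nonzero[OF that] by (simp add: d_w_eq_0_iff that dy_z_neg[OF a that])
  have dyb: "dy b (x, y) = dy b (x, 0)" if x: "x \<in> I" for x y
  proof -
    have nz: "\<alpha> * p x \<noteq> 0" using \<alpha>_nonzero p_nonzero[OF x] by simp
    have "dy (w_comp a b) (x, y) = dy (w_comp a b) (x, 0)"
      using P[OF x, of y] nz by (simp add: d_w_def)
    then show ?thesis
      unfolding dy_w_comp[OF a b x] using dya[OF x] constant_in_y[OF a dya[OF x] x, of y] nz by simp
  qed
  have "affine_comp a b (\<lambda>x. a (x, 0)) (\<lambda>x. b (x, 1) - b (x, 0)) (\<lambda>x. b (x, 0))"
    unfolding affine_comp_def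
  proof (intro conjI ballI allI)
    fix x y assume x: "x \<in> I"
    show "a (x, y) = a (x, 0)" by (rule constant_in_y[OF a dya[OF x] x])
    have "b (x, y) = b (x, 0) + dy b (x, 0) * y" for y
      by (rule affine_in_y[OF b _ x]) (rule dyb[OF x])
    from this[of y] this[of 1] show "b (x, y) = (b (x, 1) - b (x, 0)) * y + b (x, 0)"
      by (simp add: algebra_simps)
  qed (intro smooth1_diff smooth2_restrict a b open_I)+
  then show ?thesis by blast
qed

text \<open>In the new coordinates such a vector field has the components \<open>- Zt\<close> and \<open>At w + Bt\<close>.\<close>

definition Zt :: "(real \<Rightarrow> real) \<Rightarrow> real \<Rightarrow> real" where
  "Zt \<xi> = (\<lambda>x. - (\<xi> x * (iu x)\<^sup>2))"

definition At :: "(real \<Rightarrow> real) \<Rightarrow> (real \<Rightarrow> real) \<Rightarrow> real \<Rightarrow> real" where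
  "At \<xi> A = (\<lambda>x. A x - real (n - 1) * deriv u x * iu x * \<xi> x)"

definition Bt :: "(real \<Rightarrow> real) \<Rightarrow> real \<Rightarrow> real" where
  "Bt \<beta> = (\<lambda>x. \<alpha> * p x * \<beta> x)"

lemma smooth_Zt: "smooth1 I \<xi> \<Longrightarrow> smooth1 I (Zt \<xi>)"
  unfolding Zt_def by (intro smooth1_uminus smooth1_mult smooth1_power smooth_iu open_I)

lemma smooth_At: "smooth1 I \<xi> \<Longrightarrow> smooth1 I A \<Longrightarrow> smooth1 I (At \<xi> A)"
  unfolding At_def
  by (intro smooth1_diff smooth1_mult smooth1_const smooth1_deriv smooth_u smooth_iu open_I)

lemma smooth_Bt: "smooth1 I \<beta> \<Longrightarrow> smooth1 I (Bt \<beta>)"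
  unfolding Bt_def by (intro smooth1_mult smooth_\<alpha>p open_I)

lemma affine_z_neg: "affine_comp a b \<xi> A \<beta> \<Longrightarrow> x \<in> I \<Longrightarrow> z_neg a (x, y) = Zt \<xi> x"
  by (simp add: affine_comp_def z_neg_def Zt_def)

lemma affine_w_comp:
  assumes "affine_comp a b \<xi> A \<beta>" "x \<in> I"
  shows "w_comp a b (x, y) = At \<xi> A x * (\<alpha> * p x * y) + Bt \<beta> x"
  using assms deriv_p[OF assms(2)] by (simp add: affine_comp_def w_comp_def At_def Bt_def algebra_simps)

lemma affine_zw_char_iter:
  assumes "affine_comp a b \<xi> A \<beta>" "x \<in> I"
  shows "(Dz ^^ N) (zw_char a b) x j =
    (\<Sum>i\<le>N. real (N choose i) * (dz ^^ i) (At \<xi> A) x * T (N - i) x j) + (dz ^^ N) (Bt \<beta>) x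
    + (\<Sum>i\<le>N. real (N choose i) * (dz ^^ i) (Zt \<xi>) x * T (Suc (N - i)) x j)"
proof -
  have sm: "smooth1 I \<xi>" "smooth1 I A" "smooth1 I \<beta>" using assms(1) by (simp_all add: affine_comp_def)
  note alg = jet_alg_fun[OF smooth_At[OF sm(1,2)]] jet_alg_fun[OF smooth_Bt[OF sm(3)]]
    jet_alg_fun[OF smooth_Zt[OF sm(1)]] jet_alg_T
  have T_shift: "(Dz ^^ k) (T l) = T (k + l)" for k l by (rule T_add)
  have "(Dz ^^ N) (zw_char a b) x j =
      (Dz ^^ N) (\<lambda>x j. At \<xi> A x * T 0 x j + Bt \<beta> x + Zt \<xi> x * T 1 x j) x j"
    by (rule Dz_iter_cong[OF _ assms(2)])
      (simp add: zw_char_def lift_def affine_z_neg[OF assms(1)] affine_w_comp[OF assms(1)] T_0)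
  also have "\<dots> = (Dz ^^ N) (\<lambda>x j. At \<xi> A x * T 0 x j) x j + (Dz ^^ N) (\<lambda>x j. Bt \<beta> x) x j
      + (Dz ^^ N) (\<lambda>x j. Zt \<xi> x * T 1 x j) x j"
    by (simp only: Dz_iter_add[OF jet_alg.add jet_alg.mult] Dz_iter_add[OF jet_alg.mult] jet_alg.mult
        alg)
  finally show ?thesis
    by (simp add: Dz_iter_mult[OF alg(1) alg(4)] Dz_iter_mult[OF alg(3) alg(4)] T_shift
        Dz_iter_fun[OF smooth_At[OF sm(1,2)]] Dz_iter_fun[OF smooth_Bt[OF sm(3)]]
        Dz_iter_fun[OF smooth_Zt[OF sm(1)]])
qed

lemma affine_d_z_z_neg:
  assumes "affine_comp a b \<xi> A \<beta>" "smooth2 I a" "x \<in> I"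
  shows "d_z (z_neg a) (x, y) = dz (Zt \<xi>) x" and "d_w (z_neg a) (x, y) = 0"
proof -
  have sm: "smooth1 I \<xi>" using assms(1) by (simp add: affine_comp_def)
  have "((\<lambda>t. z_neg a (t, y)) has_real_derivative deriv (Zt \<xi>) x) (at x)"
    by (rule has_field_derivative_transform_within_open[OF smooth1_differentiable[OF smooth_Zt[OF sm] assms(3)] open_I assms(3)])
      (simp add: affine_z_neg[OF assms(1)])
  then have 1: "dx (z_neg a) (x, y) = deriv (Zt \<xi>) x"
    using smooth2_dx_at[OF smooth_z_neg[OF assms(2)] assms(3)] DERIV_unique by blast
  have "((\<lambda>t. z_neg a (x, t)) has_real_derivative 0) (at y)"
    by (simp add: affine_z_neg[OF assms(1,3)])
  then have 2: "dy (z_neg a) (x, y) = 0"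
    using smooth2_dy_at[OF smooth_z_neg[OF assms(2)] assms(3)] DERIV_unique by blast
  show "d_z (z_neg a) (x, y) = dz (Zt \<xi>) x" using 1 2 assms(3) by (simp add: d_z_def dz_def)
  show "d_w (z_neg a) (x, y) = 0" using 2 by (simp add: d_w_def)
qed

lemma affine_d_w_w_comp:
  assumes "affine_comp a b \<xi> A \<beta>" "smooth2 I a" "smooth2 I b" "x \<in> I"
  shows "d_w (w_comp a b) (x, y) = At \<xi> A x"
proof -
  have "((\<lambda>t. w_comp a b (x, t)) has_real_derivative At \<xi> A x * (\<alpha> * p x)) (at y)"
    unfolding affine_w_comp[OF assms(1,4)] by (auto intro!: derivative_eq_intros)
  then have "dy (w_comp a b) (x, y) = At \<xi> A x * (\<alpha> * p x)"
    using smooth2_dy_at[OF smooth_w_comp[OF assms(2,3)] assms(4)] DERIV_unique by blast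
  then show ?thesis using \<alpha>_nonzero p_nonzero[OF assms(4)] by (simp add: d_w_def field_simps)
qed

lemma affine_Dz_z_neg:
  assumes "affine_comp a b \<xi> A \<beta>" "smooth2 I a" "x \<in> I"
  shows "Dz (lift (z_neg a)) x j = dz (Zt \<xi>) x"
  unfolding Dz_lift[OF smooth_z_neg[OF assms(2)]] unfolding lift_def affine_d_z_z_neg[OF assms] by simp

end

text \<open>Comparison of coefficients in the determining identity of an affine vector field.\<close>

lemma linear_coefficients:
  fixes A Z :: "nat \<Rightarrow> real"
  assumes "\<And>s :: nat \<Rightarrow> real. (\<Sum>i\<le>N. real (N choose i) * A i * s (N - i)) + b
      + (\<Sum>i\<le>N. real (N choose i) * Z i * s (Suc (N - i))) - Z 0 * s (Suc N) + K * s N = 0"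
  shows "b = 0"
    and "k \<le> N \<Longrightarrow> real (N choose k) * A k + real (N choose Suc k) * Z (Suc k)
      + (if k = 0 then K else 0) = 0"
proof -
  show b: "b = 0" using assms[of "\<lambda>_. 0"] by simp
  assume k: "k \<le> N"
  \<comment> \<open>The jet in which only the coordinate of order \<open>N - k\<close> is non-zero.\<close>
  define s :: "nat \<Rightarrow> real" where "s l = (if l = N - k then 1 else 0)" for l
  have "(\<Sum>i\<le>N. real (N choose i) * A i * s (N - i)) = (\<Sum>i\<le>N. if i = k then real (N choose k) * A k else 0)"
    using k by (intro sum.cong refl) (auto simp: s_def)
  then have 1: "(\<Sum>i\<le>N. real (N choose i) * A i * s (N - i)) = real (N choose k) * A k"
    using k by simp
  have "(\<Sum>i\<le>N. real (N choose i) * Z i * s (Suc (N - i))) =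
      (\<Sum>i\<le>N. if i = Suc k then real (N choose Suc k) * Z (Suc k) else 0)"
    using k by (intro sum.cong refl) (auto simp: s_def)
  then have 2: "(\<Sum>i\<le>N. real (N choose i) * Z i * s (Suc (N - i))) = real (N choose Suc k) * Z (Suc k)"
    by (cases "Suc k \<le> N") (simp_all add: binomial_eq_0)
  have 3: "s (Suc N) = 0" "K * s N = (if k = 0 then K else 0)" using k by (auto simp: s_def)
  show "real (N choose k) * A k + real (N choose Suc k) * Z (Suc k) + (if k = 0 then K else 0) = 0"
    using assms[of s] unfolding 1 2 3 b by simp
qed

lemma real_binomial_Suc: "real (Suc k) * real (N choose Suc k) = (real N - real k) * real (N choose k)"
  using gbinomial_mult_1[of "real N" k] by (simp add: binomial_gbinomial algebra_simps)

section \<open>Solution of the determining equations\<close>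

context source_solutions
begin

lemma affine_coefficients:
  assumes aff: "affine_comp a b \<xi> A \<beta>" and x: "x \<in> I"
    and zero: "\<And>j. (Dz ^^ N) (zw_char a b) x j - lift (z_neg a) x j * T (Suc N) x j + K * T N x j = 0"
  shows "(dz ^^ N) (Bt \<beta>) x = 0"
    and "k \<le> N \<Longrightarrow> real (N choose k) * (dz ^^ k) (At \<xi> A) x
      + real (N choose Suc k) * (dz ^^ Suc k) (Zt \<xi>) x + (if k = 0 then K else 0) = 0"
proof -
  have coeffs: "(\<Sum>i\<le>N. real (N choose i) * (dz ^^ i) (At \<xi> A) x * s (N - i)) + (dz ^^ N) (Bt \<beta>) x
      + (\<Sum>i\<le>N. real (N choose i) * (dz ^^ i) (Zt \<xi>) x * s (Suc (N - i)))
      - (dz ^^ 0) (Zt \<xi>) x * s (Suc N) + K * s N = 0" for s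
  proof -
    obtain j where j: "\<And>k. k \<le> Suc N \<Longrightarrow> T k x j = s k" using T_coordinates[OF x] by blast
    have "(\<Sum>i\<le>N. real (N choose i) * (dz ^^ i) (At \<xi> A) x * s (N - i)) =
        (\<Sum>i\<le>N. real (N choose i) * (dz ^^ i) (At \<xi> A) x * T (N - i) x j)"
      by (intro sum.cong refl) (simp add: j)
    moreover have "(\<Sum>i\<le>N. real (N choose i) * (dz ^^ i) (Zt \<xi>) x * s (Suc (N - i))) =
        (\<Sum>i\<le>N. real (N choose i) * (dz ^^ i) (Zt \<xi>) x * T (Suc (N - i)) x j)"
      by (intro sum.cong refl) (simp add: j)
    ultimately show ?thesis
      using zero[of j] unfolding affine_zw_char_iter[OF aff x] by (simp add: lift_def affine_z_neg[OF aff x] j)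
  qed
  show "(dz ^^ N) (Bt \<beta>) x = 0" by (rule linear_coefficients(1)[OF coeffs])
  show "k \<le> N \<Longrightarrow> real (N choose k) * (dz ^^ k) (At \<xi> A) x
      + real (N choose Suc k) * (dz ^^ Suc k) (Zt \<xi>) x + (if k = 0 then K else 0) = 0"
    by (rule linear_coefficients(2)[OF coeffs])
qed

lemma dz_scaled:
  assumes "smooth1 I h" "\<And>x. x \<in> I \<Longrightarrow> f x = c + r * h x" "x \<in> I"
  shows "dz f x = r * dz h x"
proof -
  have "((\<lambda>x. c + r * h x) has_real_derivative 0 + r * ((iu x)\<^sup>2 * dz h x)) (at x)"
    by (intro DERIV_add DERIV_const DERIV_cmult deriv_eq_dz assms)
  then have "dz (\<lambda>x. c + r * h x) x = (u x)\<^sup>2 * (0 + r * ((iu x)\<^sup>2 * dz h x))" by (rule dz_eq[OF assms(3)])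
  also have "\<dots> = (iu x)\<^sup>2 * ((u x)\<^sup>2 * (r * dz h x))" by simp
  also have "\<dots> = r * dz h x" by (rule iu2_u2[OF assms(3)])
  finally show ?thesis using dz_cong[of f "\<lambda>x. c + r * h x"] assms(2) by simp
qed

lemma dz_iter_scaled:
  assumes "smooth1 I h" "\<And>x. x \<in> I \<Longrightarrow> f x = c + r * h x" "x \<in> I"
  shows "(dz ^^ Suc k) f x = r * (dz ^^ Suc k) h x"
  using assms(3)
proof (induction k arbitrary: x)
  case 0
  then show ?case using dz_scaled[OF assms(1,2)] by simp
next
  case (Suc k)
  have "dz ((dz ^^ Suc k) f) x = r * dz ((dz ^^ Suc k) h) x"
    by (rule dz_scaled[of "(dz ^^ Suc k) h" _ 0, OF smooth_dz_iter[OF assms(1)] _ Suc.prems])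
      (use Suc.IH in simp)
  then show ?case by simp
qed

text \<open>
  For even \<open>n\<close> the terms of order \<open>n + 1\<close> cancel. The terms of order \<open>n\<close> show that the field is affine
  and fix the linear part of its component along \<open>w\<close>. In the linear identity that remains, the
  coefficient of \<open>w\<^sup>(\<^sup>n\<^sup>-\<^sup>2\<^sup>)\<close> and the inhomogeneous term give the other two equations.
\<close>

lemma even_determining_equations:
  assumes a: "smooth2 I a" and b: "smooth2 I b"
    and zero: "\<And>x j. x \<in> I \<Longrightarrow> (Dz ^^ n) (zw_char a b) x j - lift (z_neg a) x j * T (Suc n) x j
      + (d_w (w_comp a b) (x, j 0) - d_z (z_neg a) (x, j 0)) * T n x j = 0"
  shows "\<exists>\<xi> A \<beta>. affine_comp a b \<xi> A \<beta> \<and>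
    (\<forall>x\<in>I. (dz ^^ 3) (Zt \<xi>) x = 0 \<and> 2 * At \<xi> A x + real (n - 1) * dz (Zt \<xi>) x = 0 \<and> (dz ^^ n) (Bt \<beta>) x = 0)"
proof -
  note Z = smooth_z_neg[OF a] and P = smooth_w_comp[OF a b]
  obtain m where m: "n = Suc (Suc m)" using n_ge_2 by (intro that[of "n - 2"]) simp
  have n1: "real (n - 1) = real n - 1" using n_ge_2 by simp
  have coeffs: "real (n + 1) * d_w (z_neg a) (x, y) = 0 \<and>
      2 * d_w (w_comp a b) (x, y) + real (n - 1) * d_z (z_neg a) (x, y) = 0" if x: "x \<in> I" for x y
  proof -
    obtain R where R: "order_le (Suc m) R" and e: "(Dz ^^ n) (zw_char a b) =
        (\<lambda>x j. lift (z_neg a) x j * T (Suc n) x j +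
          (real (n + 1) * lift (d_w (z_neg a)) x j * T 1 x j
            + (lift (d_w (w_comp a b)) x j + real n * lift (d_z (z_neg a)) x j)) * T n x j + R x j)"
      using Dz_iter_first_order[OF P Z, of m, folded zw_char_def[of a b] m] by (elim exE conjE) (rule that)
    define K where "K x j = real (n + 1) * lift (d_w (z_neg a)) x j * T 1 x j
        + (2 * lift (d_w (w_comp a b)) x j + real (n - 1) * lift (d_z (z_neg a)) x j)" for x j
    have K: "order_le (Suc m) K" unfolding K_def
      by (intro order_le_add order_le_mult order_le_fun order_le_lift order_le_mono[OF order_le_T]) simp
    have KR: "K x j * T (Suc (Suc m)) x j + R x j = 0" for j
      using zero[OF x, of j] unfolding e K_def m[symmetric] n1 lift_def by (simp add: algebra_simps)
    have "K x j = 0" for j by (rule conjunct1[OF top_coefficient_zero[OF x K R KR]])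
    then show ?thesis
      by (intro first_order_coefficients_zero[OF x]) (simp add: K_def lift_def)
  qed
  then have GZ: "d_w (z_neg a) (x, y) = 0" if "x \<in> I" for x y using that by simp
  have "d_w (w_comp a b) (x, y) = d_w (w_comp a b) (x, 0)" if "x \<in> I" for x y
    using coeffs[OF that, of y] coeffs[OF that, of 0] d_z_constant_in_y[OF Z GZ that, of y] by simp
  then obtain \<xi> A \<beta> where aff: "affine_comp a b \<xi> A \<beta>"
    using affine_comp_exists[OF a b GZ] by blast
  then have sm: "smooth1 I \<xi>" "smooth1 I A" by (simp_all add: affine_comp_def)
  have first: "2 * At \<xi> A x + real (n - 1) * dz (Zt \<xi>) x = 0" if "x \<in> I" for x
    using coeffs[OF that, of 0] by (simp add: affine_d_w_w_comp[OF aff a b that] affine_d_z_z_neg[OF aff a that])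
  have "(dz ^^ 3) (Zt \<xi>) x = 0 \<and> (dz ^^ n) (Bt \<beta>) x = 0" if x: "x \<in> I" for x
  proof -
    have z: "(Dz ^^ n) (zw_char a b) x j - lift (z_neg a) x j * T (Suc n) x j + (At \<xi> A x - dz (Zt \<xi>) x) * T n x j = 0" for j
      using zero[OF x, of j] by (simp only: affine_d_w_w_comp[OF aff a b x] affine_d_z_z_neg[OF aff a x])
    have B: "(dz ^^ n) (Bt \<beta>) x = 0" by (rule affine_coefficients(1)[OF aff x z])
    have "(dz ^^ Suc 1) (At \<xi> A) x = - (real (n - 1) / 2) * (dz ^^ Suc 1) (dz (Zt \<xi>)) x"
      by (rule dz_iter_scaled[OF smooth_dz[OF smooth_Zt[OF sm(1)]], of _ 0, OF _ x]) (use first in force)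
    then have A2: "(dz ^^ 2) (At \<xi> A) x = - (real (n - 1) / 2) * (dz ^^ 3) (Zt \<xi>) x"
      by (simp add: numeral_2_eq_2 numeral_3_eq_3)
    have "real (n choose 2) * (dz ^^ 2) (At \<xi> A) x + real (n choose 3) * (dz ^^ 3) (Zt \<xi>) x = 0"
      using affine_coefficients(2)[OF aff x z, of 2] n_ge_2 by (simp add: numeral_3_eq_3 numeral_2_eq_2)
    then have z3: "(3 * real (n choose 3) - 3 * (real (n - 1) / 2) * real (n choose 2)) * (dz ^^ 3) (Zt \<xi>) x = 0"
      unfolding A2 by (simp add: algebra_simps)
    have c3: "3 * real (n choose 3) = (real n - 2) * real (n choose 2)"
      using real_binomial_Suc[of 2 n] by (simp add: numeral_3_eq_3)
    have "(real n - 2) * real (n choose 2) - 3 * ((real n - 1) / 2) * real (n choose 2) =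
        - ((real n + 1) / 2) * real (n choose 2)" by (simp add: field_simps)
    then have "- ((real n + 1) / 2) * real (n choose 2) * (dz ^^ 3) (Zt \<xi>) x = 0"
      using z3 unfolding c3 n1 by simp
    moreover have "n choose 2 > 0" using n_ge_2 by (simp add: zero_less_binomial)
    ultimately show ?thesis using B by simp
  qed
  then show ?thesis using aff first by blast
qed

text \<open>
  For odd \<open>n\<close> the terms of order \<open>n + 1\<close> have the same sign instead, which forces \<open>\<xi> = 0\<close>. The terms
  of order \<open>n\<close> then cancel identically, and those of order \<open>n - 1\<close> show that the component along \<open>w\<close>
  is affine.
\<close>

lemma odd_determining_equations:
  assumes a: "smooth2 I a" and b: "smooth2 I b" and n: "odd n"
    and zero: "\<And>x j. x \<in> I \<Longrightarrow> - (Dz ^^ n) (zw_char a b) x j - lift (z_neg a) x j * T (Suc n) x j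
      + (d_w (w_comp a b) (x, j 0) - d_z (z_neg a) (x, j 0)) * T n x j = 0"
  shows "\<exists>\<xi> A \<beta>. affine_comp a b \<xi> A \<beta> \<and>
    (\<forall>x\<in>I. Zt \<xi> x = 0 \<and> dz (At \<xi> A) x = 0 \<and> (dz ^^ n) (Bt \<beta>) x = 0)"
proof -
  note Z = smooth_z_neg[OF a] and P = smooth_w_comp[OF a b]
  have "n \<ge> 3" using n n_ge_2 by (cases "n = 2") auto
  then obtain m where m: "n = Suc (Suc (Suc m))" by (intro that[of "n - 3"]) simp
  have Ze0: "z_neg a (x, y) = 0" if x: "x \<in> I" for x y
  proof -
    obtain R where R: "order_le (Suc (Suc m)) R" and e: "(Dz ^^ n) (zw_char a b) =
        (\<lambda>x j. lift (z_neg a) x j * T (Suc n) x j +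
          (real (n + 1) * lift (d_w (z_neg a)) x j * T 1 x j
            + (lift (d_w (w_comp a b)) x j + real n * lift (d_z (z_neg a)) x j)) * T n x j + R x j)"
      using Dz_iter_first_order[OF P Z, of "Suc m", folded zw_char_def[of a b] m] by (elim exE conjE) (rule that)
    define S where "S x j = (lift (d_w (w_comp a b)) x j - lift (d_z (z_neg a)) x j) * T n x j -
      ((real (n + 1) * lift (d_w (z_neg a)) x j * T 1 x j
            + (lift (d_w (w_comp a b)) x j + real n * lift (d_z (z_neg a)) x j)) * T n x j + R x j)" for x j
    have S: "order_le n S" unfolding S_def
      by (intro order_le_add order_le_diff order_le_mult order_le_fun order_le_lift
          order_le_mono[OF order_le_T] order_le_mono[OF R]) (simp_all add: m)
    have K: "order_le n (\<lambda>x j. - 2 * lift (z_neg a) x j)"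
      by (intro order_le_mult order_le_fun order_le_lift)
    have KS: "- 2 * lift (z_neg a) x j * T (Suc n) x j + S x j = 0" for j
      using zero[OF x, of j] unfolding e S_def lift_def by (simp add: algebra_simps)
    have "- 2 * lift (z_neg a) x j = 0" for j by (rule conjunct1[OF top_coefficient_zero[OF x K S KS]])
    from this[of "\<lambda>k. y"] show ?thesis by (simp add: lift_def)
  qed
  have EZ: "Dz (lift (z_neg a)) = Dz (\<lambda>x j. 0)" by (rule Dz_cong) (simp add: lift_def Ze0)
  have GR: "d_w (z_neg a) (x, y) = 0 \<and> d_z (z_neg a) (x, y) = 0" if x: "x \<in> I" for x y
  proof (rule first_order_coefficients_zero[OF x])
    fix j
    have "Dz (lift (z_neg a)) x j = 0" unfolding EZ by (simp add: Dz_def D_const)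
    then show "d_w (z_neg a) (x, j 0) * T 1 x j + d_z (z_neg a) (x, j 0) = 0"
      unfolding Dz_lift[OF Z] by (simp add: lift_def)
  qed
  have GG: "real n * d_w (d_w (w_comp a b)) (x, y) = 0" if x: "x \<in> I" for x y
  proof -
    \<comment> \<open>As \<open>\<xi> = 0\<close>, one differentiation of \<open>\<psi>\<close> leaves a function affine in \<open>w'\<close>, to be
      differentiated \<open>n - 1\<close> times.\<close>
    define N where "N = Suc (Suc m)"
    note G = smooth_d_w[OF P] and RP = smooth_d_z[OF P]
    obtain R where R: "order_le (Suc m) R" and e:
      "(Dz ^^ N) (\<lambda>x j. lift (d_z (w_comp a b)) x j + lift (d_w (w_comp a b)) x j * T 1 x j) =
        (\<lambda>x j. lift (d_w (w_comp a b)) x j * T (Suc N) x j +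
          (real (N + 1) * lift (d_w (d_w (w_comp a b))) x j * T 1 x j
            + (lift (d_w (d_z (w_comp a b))) x j + real N * lift (d_z (d_w (w_comp a b))) x j)) * T N x j + R x j)"
      using Dz_iter_first_order[OF RP G, of m, folded N_def] by (elim exE conjE) (rule that)
    define K where "K x j = real (N + 1) * lift (d_w (d_w (w_comp a b))) x j * T 1 x j
            + (lift (d_w (d_z (w_comp a b))) x j + real N * lift (d_z (d_w (w_comp a b))) x j)" for x j
    have K: "order_le (Suc m) K" unfolding K_def
      by (intro order_le_add order_le_mult order_le_fun order_le_lift order_le_mono[OF order_le_T]) simp
    have "(Dz ^^ n) (zw_char a b) x j = lift (d_w (w_comp a b)) x j * T n x j + K x j * T N x j + R x j" for j
    proof -
      have "(Dz ^^ n) (zw_char a b) x j = (Dz ^^ n) (lift (w_comp a b)) x j"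
        by (rule Dz_iter_cong[OF _ x]) (simp add: zw_char_def lift_def Ze0)
      also have "(Dz ^^ n) (lift (w_comp a b)) = (Dz ^^ N) (Dz (lift (w_comp a b)))"
        by (simp only: m N_def funpow_Suc_right o_apply)
      also have "Dz (lift (w_comp a b)) = (\<lambda>x j. lift (d_z (w_comp a b)) x j + lift (d_w (w_comp a b)) x j * T 1 x j)"
        unfolding Dz_lift[OF P] by (simp add: add.commute)
      finally show ?thesis unfolding e K_def by (simp add: N_def m)
    qed
    then have KR: "K x j * T (Suc (Suc m)) x j + R x j = 0" for j
      using zero[OF x, of j] GR[OF x] by (simp add: lift_def Ze0[OF x] N_def)
    have "K x j = 0" for j by (rule conjunct1[OF top_coefficient_zero[OF x K R KR]])
    then have "real (N + 1) * d_w (d_w (w_comp a b)) (x, y) = 0 \<and>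
        d_w (d_z (w_comp a b)) (x, y) + real N * d_z (d_w (w_comp a b)) (x, y) = 0"
      by (intro first_order_coefficients_zero[OF x]) (simp add: K_def lift_def)
    then show ?thesis by simp
  qed
  have "d_w (w_comp a b) (x, y) = d_w (w_comp a b) (x, 0)" if x: "x \<in> I" for x y
  proof (rule constant_in_y[OF smooth_d_w[OF P] _ x])
    fix y
    have "d_w (d_w (w_comp a b)) (x, y) = 0" using GG[OF x, of y] m by simp
    then show "dy (d_w (w_comp a b)) (x, y) = 0" using d_w_eq_0_iff[OF x] by simp
  qed
  then obtain \<xi> A \<beta> where aff: "affine_comp a b \<xi> A \<beta>"
    using affine_comp_exists[OF a b] GR by blast
  have Zt0: "Zt \<xi> x = 0" if "x \<in> I" for x using affine_z_neg[OF aff that, of 0] Ze0[OF that, of 0] by simp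
  have "dz (At \<xi> A) x = 0 \<and> (dz ^^ n) (Bt \<beta>) x = 0" if x: "x \<in> I" for x
  proof -
    have z: "(Dz ^^ n) (zw_char a b) x j - lift (z_neg a) x j * T (Suc n) x j + (- At \<xi> A x) * T n x j = 0" for j
      using zero[OF x, of j] GR[OF x] by (simp add: lift_def Ze0[OF x] affine_d_w_w_comp[OF aff a b x])
    have "(dz ^^ Suc 1) (Zt \<xi>) x = 0"
      by (rule dz_iter_zero_mono[of 0]) (simp_all add: Zt0 x)
    then have "real n * dz (At \<xi> A) x = 0"
      using affine_coefficients(2)[OF aff x z, of 1] n_ge_2 by simp
    then show ?thesis using affine_coefficients(1)[OF aff x z] n_ge_2 by simp
  qed
  then show ?thesis using aff Zt0 by blast
qed

text \<open>
  The same analysis at order \<open>m = n/2\<close>. For \<open>m = 1\<close> the coefficient of \<open>w\<^sup>(\<^sup>m\<^sup>)\<close> itself depends on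
  \<open>w'\<close>, and the coefficients of a quadratic polynomial in \<open>w'\<close> are compared instead.
\<close>

lemma variational_determining_equations:
  assumes a: "smooth2 I a" and b: "smooth2 I b" and n: "n = 2 * m"
    and zero: "\<And>x j. x \<in> I \<Longrightarrow> T m x j \<noteq> 0 \<Longrightarrow> (Dz ^^ m) (zw_char a b) x j - lift (z_neg a) x j * T (Suc m) x j
      - Dz (lift (z_neg a)) x j * T m x j / 2 = 0"
  shows "\<exists>\<xi> A \<beta>. affine_comp a b \<xi> A \<beta> \<and>
    (\<forall>x\<in>I. (dz ^^ 2) (Zt \<xi>) x = 0 \<and> 2 * At \<xi> A x + real (n - 1) * dz (Zt \<xi>) x = 0 \<and> (dz ^^ m) (Bt \<beta>) x = 0)"
proof -
  note Z = smooth_z_neg[OF a] and P = smooth_w_comp[OF a b]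
  have m1: "m \<ge> 1" using n n_ge_2 by simp
  have n1: "real (n - 1) = 2 * real m - 1" using m1 n by simp
  define W where "W x j = (Dz ^^ m) (zw_char a b) x j - lift (z_neg a) x j * T (Suc m) x j
      - Dz (lift (z_neg a)) x j * T m x j / 2" for x j
  have EZ: "Dz (lift (z_neg a)) x j = d_w (z_neg a) (x, j 0) * T 1 x j + d_z (z_neg a) (x, j 0)" for x j
    unfolding Dz_lift[OF Z] by (simp add: lift_def)
  have coeffs: "(\<forall>y. d_w (z_neg a) (x, y) = 0 \<and> 2 * d_w (w_comp a b) (x, y) + real (n - 1) * d_z (z_neg a) (x, y) = 0)
      \<and> (\<forall>j. W x j = 0)" if x: "x \<in> I" for x
  proof (cases "m = 1")
    case True
    have W: "W x j = d_w (z_neg a) (x, j 0) / 2 * (T 1 x j)\<^sup>2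
        + (d_w (w_comp a b) (x, j 0) + d_z (z_neg a) (x, j 0) / 2) * T 1 x j + d_z (w_comp a b) (x, j 0)" for j
    proof -
      have "Dz (zw_char a b) x j = Dz (lift (w_comp a b)) x j + (Dz (lift (z_neg a)) x j * T 1 x j + lift (z_neg a) x j * T 2 x j)"
        using T_Suc[of 1] unfolding zw_char_def
        by (simp add: Dz_add Dz_mult jet_alg.mult jet_alg_lift P Z jet_alg_T numeral_2_eq_2)
      also have "Dz (lift (w_comp a b)) x j = d_w (w_comp a b) (x, j 0) * T 1 x j + d_z (w_comp a b) (x, j 0)"
        unfolding Dz_lift[OF P] by (simp add: lift_def)
      finally show ?thesis
        unfolding W_def True EZ by (simp add: numeral_2_eq_2 field_simps)
    qed
    have q: "d_w (z_neg a) (x, y) = 0 \<and> d_w (w_comp a b) (x, y) + d_z (z_neg a) (x, y) / 2 = 0 \<and> d_z (w_comp a b) (x, y) = 0" for y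
    proof -
      have ev: "d_w (z_neg a) (x, y) / 2 * t\<^sup>2 + (d_w (w_comp a b) (x, y) + d_z (z_neg a) (x, y) / 2) * t
          + d_z (w_comp a b) (x, y) = 0" if "t \<noteq> 0" for t
      proof -
        obtain s where s: "T 1 x ((\<lambda>k. y)(1 := s)) = t" using T_update[OF x] .
        have "W x ((\<lambda>k. y)(1 := s)) = 0" using zero[OF x, of "(\<lambda>k. y)(1 := s)"] s that by (simp add: W_def True)
        then show ?thesis unfolding W s by simp
      qed
      \<comment> \<open>A quadratic polynomial with three zeros vanishes.\<close>
      show ?thesis using ev[of 1] ev[of "-1"] ev[of 2] by (simp add: algebra_simps)
    qed
    have "2 * d_w (w_comp a b) (x, y) + d_z (z_neg a) (x, y) = 0" for y using q[of y] by linarith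
    moreover have "real (n - 1) = 1" using n1 True by simp
    moreover have "W x j = 0" for j unfolding W using q[of "j 0"] by simp
    ultimately show ?thesis using q by simp
  next
    case False
    then obtain l where l: "m = Suc (Suc l)" using m1 by (intro that[of "m - 2"]) simp
    obtain R where R: "order_le (Suc l) R" and e: "(Dz ^^ m) (zw_char a b) =
        (\<lambda>x j. lift (z_neg a) x j * T (Suc m) x j +
          (real (m + 1) * lift (d_w (z_neg a)) x j * T 1 x j
            + (lift (d_w (w_comp a b)) x j + real m * lift (d_z (z_neg a)) x j)) * T m x j + R x j)"
      using Dz_iter_first_order[OF P Z, of l, folded zw_char_def[of a b] l] by (elim exE conjE) (rule that)
    define K where "K x j = (real m + 1 / 2) * lift (d_w (z_neg a)) x j * T 1 x j
        + (lift (d_w (w_comp a b)) x j + (real m - 1 / 2) * lift (d_z (z_neg a)) x j)" for x j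
    have K: "order_le (Suc l) K" unfolding K_def
      by (intro order_le_add order_le_mult order_le_fun order_le_lift order_le_mono[OF order_le_T]) simp
    have W: "W x j = K x j * T (Suc (Suc l)) x j + R x j" for j
      unfolding W_def e K_def EZ l[symmetric] unfolding lift_def by (simp add: field_simps)
    have KR: "K x j = 0 \<and> R x j = 0" for j
    proof (rule top_coefficient_zero[OF x K R])
      fix j assume "T (Suc (Suc l)) x j \<noteq> 0"
      then have "W x j = 0" using zero[OF x, of j] by (simp add: W_def l)
      then show "K x j * T (Suc (Suc l)) x j + R x j = 0" unfolding W .
    qed
    have c: "(real m + 1 / 2) * d_w (z_neg a) (x, y) = 0 \<and>
        d_w (w_comp a b) (x, y) + (real m - 1 / 2) * d_z (z_neg a) (x, y) = 0" for y
      using KR by (intro first_order_coefficients_zero[OF x]) (simp add: K_def lift_def)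
    have "real m + 1 / 2 \<noteq> 0" by linarith
    then have "d_w (z_neg a) (x, y) = 0" for y using c[of y] by simp
    moreover have "2 * d_w (w_comp a b) (x, y) + (2 * real m - 1) * d_z (z_neg a) (x, y) = 0" for y
      using c[of y] by (simp add: algebra_simps)
    ultimately show ?thesis unfolding n1 using W KR by simp
  qed
  then have GZ: "d_w (z_neg a) (x, y) = 0" if "x \<in> I" for x y using that by blast
  have "d_w (w_comp a b) (x, y) = d_w (w_comp a b) (x, 0)" if "x \<in> I" for x y
  proof -
    have "2 * d_w (w_comp a b) (x, y) + real (n - 1) * d_z (z_neg a) (x, y) = 0"
      "2 * d_w (w_comp a b) (x, 0) + real (n - 1) * d_z (z_neg a) (x, 0) = 0" using coeffs[OF that] by blast+
    then show ?thesis using d_z_constant_in_y[OF Z GZ that, of y] by simp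
  qed
  then obtain \<xi> A \<beta> where aff: "affine_comp a b \<xi> A \<beta>"
    using affine_comp_exists[OF a b GZ] by blast
  then have sm: "smooth1 I \<xi>" "smooth1 I A" by (simp_all add: affine_comp_def)
  have first: "2 * At \<xi> A x + real (n - 1) * dz (Zt \<xi>) x = 0" if "x \<in> I" for x
  proof -
    have "2 * d_w (w_comp a b) (x, 0) + real (n - 1) * d_z (z_neg a) (x, 0) = 0" using coeffs[OF that] by blast
    then show ?thesis by (simp only: affine_d_w_w_comp[OF aff a b that] affine_d_z_z_neg(1)[OF aff a that])
  qed
  have "(dz ^^ 2) (Zt \<xi>) x = 0 \<and> (dz ^^ m) (Bt \<beta>) x = 0" if x: "x \<in> I" for x
  proof -
    have z: "(Dz ^^ m) (zw_char a b) x j - lift (z_neg a) x j * T (Suc m) x j + (- dz (Zt \<xi>) x / 2) * T m x j = 0" for j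
      using coeffs[OF x] unfolding W_def affine_Dz_z_neg[OF aff a x] by simp
    have B: "(dz ^^ m) (Bt \<beta>) x = 0" by (rule affine_coefficients(1)[OF aff x z])
    have "(dz ^^ Suc 0) (At \<xi> A) x = - (real (n - 1) / 2) * (dz ^^ Suc 0) (dz (Zt \<xi>)) x"
      by (rule dz_iter_scaled[OF smooth_dz[OF smooth_Zt[OF sm(1)]], of _ 0, OF _ x]) (use first in force)
    then have A1: "dz (At \<xi> A) x = - (real (n - 1) / 2) * (dz ^^ 2) (Zt \<xi>) x"
      by (simp add: numeral_2_eq_2)
    have "real m * dz (At \<xi> A) x + real (m choose 2) * (dz ^^ 2) (Zt \<xi>) x = 0"
      using affine_coefficients(2)[OF aff x z, of 1] m1 by (simp add: numeral_2_eq_2)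
    then have "(2 * real (m choose 2) - real m * real (n - 1)) * (dz ^^ 2) (Zt \<xi>) x = 0"
      unfolding A1 by (simp add: algebra_simps)
    moreover have "2 * real (m choose 2) = (real m - 1) * real m"
      using real_binomial_Suc[of 1 m] by (simp add: numeral_2_eq_2)
    ultimately have "- (real m * real m) * (dz ^^ 2) (Zt \<xi>) x = 0"
      unfolding n1 by (simp add: algebra_simps)
    then show ?thesis using B m1 by simp
  qed
  then show ?thesis using aff first by blast
qed

text \<open>
  If the two terms of order \<open>N - 1\<close> in the Leibniz expansion cancel and the \<open>N\<close>-th derivative of \<open>Bt\<close>, the
  derivatives of \<open>At\<close> from the second on and those of \<open>Zt\<close> from the third on vanish, then only the terms of
  order \<open>N\<close> and \<open>N + 1\<close> remain.
\<close>

lemma affine_zw_char_iter_eq: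
  assumes aff: "affine_comp a b \<xi> A \<beta>" and x: "x \<in> I" and N: "N \<ge> 1"
    and B: "(dz ^^ N) (Bt \<beta>) x = 0" and A2: "\<And>i. i \<ge> 2 \<Longrightarrow> (dz ^^ i) (At \<xi> A) x = 0"
    and Z3: "\<And>i. i \<ge> 3 \<Longrightarrow> (dz ^^ i) (Zt \<xi>) x = 0"
    and rel: "real N * dz (At \<xi> A) x + real (N choose 2) * (dz ^^ 2) (Zt \<xi>) x = 0"
  shows "(Dz ^^ N) (zw_char a b) x j =
    Zt \<xi> x * T (Suc N) x j + (At \<xi> A x + real N * dz (Zt \<xi>) x) * T N x j"
proof -
  have short: "(\<Sum>i\<le>N. f i) = f 0 + f 1 + f 2"
    if "\<And>i. i \<ge> 3 \<Longrightarrow> f i = 0" "\<And>i. i > N \<Longrightarrow> f i = 0" for f :: "nat \<Rightarrow> real"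
  proof -
    have "(\<Sum>i\<le>N. f i) = (\<Sum>i\<in>{..N} \<union> {..2}. f i)"
      by (rule sum.mono_neutral_left) (auto intro: that)
    also have "\<dots> = (\<Sum>i\<le>2. f i)"
      by (rule sum.mono_neutral_right) (auto intro: that)
    finally show ?thesis by (simp add: numeral_2_eq_2)
  qed
  have 1: "(\<Sum>i\<le>N. real (N choose i) * (dz ^^ i) (At \<xi> A) x * T (N - i) x j) =
      At \<xi> A x * T N x j + real N * dz (At \<xi> A) x * T (N - 1) x j"
    by (subst short) (simp_all add: A2)
  have 2: "(\<Sum>i\<le>N. real (N choose i) * (dz ^^ i) (Zt \<xi>) x * T (Suc (N - i)) x j) =
      Zt \<xi> x * T (Suc N) x j + real N * dz (Zt \<xi>) x * T N x j
      + real (N choose 2) * (dz ^^ 2) (Zt \<xi>) x * T (N - 1) x j"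
  proof -
    have "real (N choose 2) * (dz ^^ 2) (Zt \<xi>) x * T (Suc (N - 2)) x j =
        real (N choose 2) * (dz ^^ 2) (Zt \<xi>) x * T (N - 1) x j"
      by (cases "N = 1") (use N in \<open>simp_all add: Suc_diff_le numeral_2_eq_2 Suc_diff_Suc\<close>)
    then show ?thesis using N by (subst short) (simp_all add: Z3)
  qed
  have "(Dz ^^ N) (zw_char a b) x j = Zt \<xi> x * T (Suc N) x j + (At \<xi> A x + real N * dz (Zt \<xi>) x) * T N x j
      + (real N * dz (At \<xi> A) x + real (N choose 2) * (dz ^^ 2) (Zt \<xi>) x) * T (N - 1) x j"
    unfolding affine_zw_char_iter[OF aff x] 1 2 B by (simp add: algebra_simps)
  then show ?thesis unfolding rel by simp
qed

end

section \<open>Linear combinations of the generators\<close>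

context source_solutions
begin

text \<open>The vector field \<open>\<xi> \<partial>\<^sub>x + (A y + \<beta>) \<partial>\<^sub>y\<close> over \<open>I\<close>.\<close>

definition aff :: "(real \<Rightarrow> real) \<Rightarrow> (real \<Rightarrow> real) \<Rightarrow> (real \<Rightarrow> real) \<Rightarrow> vfield" where
  "aff \<xi> A \<beta> = mk_vfield I (\<lambda>x y. \<xi> x) (\<lambda>x y. A x * y + \<beta> x)"

lemma aff_apply: "aff \<xi> A \<beta> (x, y) = (if x \<in> I then (\<xi> x, A x * y + \<beta> x) else 0)"
  by (simp add: aff_def mk_vfield_def)

lemma vfield_eqI: "(\<And>x y. X (x, y) = Y (x, y)) \<Longrightarrow> X = (Y :: vfield)"
  by (intro ext) (metis surj_pair)

lemma aff_cong:
  assumes "\<And>x. x \<in> I \<Longrightarrow> \<xi>1 x = \<xi>2 x" "\<And>x. x \<in> I \<Longrightarrow> A1 x = A2 x" "\<And>x. x \<in> I \<Longrightarrow> \<beta>1 x = \<beta>2 x"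
  shows "aff \<xi>1 A1 \<beta>1 = aff \<xi>2 A2 \<beta>2"
  by (rule vfield_eqI) (simp add: aff_apply assms)

lemma vf_add_aff: "vf_add (aff \<xi>1 A1 \<beta>1) (aff \<xi>2 A2 \<beta>2) =
    aff (\<lambda>x. \<xi>1 x + \<xi>2 x) (\<lambda>x. A1 x + A2 x) (\<lambda>x. \<beta>1 x + \<beta>2 x)"
  by (rule vfield_eqI) (simp add: vf_add_def aff_apply algebra_simps)

lemma vf_scale_aff: "vf_scale c (aff \<xi> A \<beta>) = aff (\<lambda>x. c * \<xi> x) (\<lambda>x. c * A x) (\<lambda>x. c * \<beta> x)"
  by (rule vfield_eqI) (simp add: vf_scale_def aff_apply algebra_simps)

lemma vf_zero_aff: "vf_zero = aff (\<lambda>x. 0) (\<lambda>x. 0) (\<lambda>x. 0)"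
  by (rule vfield_eqI) (simp add: vf_zero_def aff_apply zero_prod_def)

lemma aff_smooth:
  assumes "smooth1 I \<xi>" "smooth1 I A" "smooth1 I \<beta>"
  shows "smooth2 I (xcomp (aff \<xi> A \<beta>))" "smooth2 I (ycomp (aff \<xi> A \<beta>))"
    "aff \<xi> A \<beta> \<in> vfields I"
    "affine_comp (xcomp (aff \<xi> A \<beta>)) (ycomp (aff \<xi> A \<beta>)) \<xi> A \<beta>"
proof -
  show 1: "smooth2 I (xcomp (aff \<xi> A \<beta>))"
    by (rule smooth2_cong[OF open_I _ smooth1_imp_smooth2[OF assms(1)]]) (simp add: aff_apply)
  have "smooth2 I (\<lambda>q. A (fst q) * snd q + \<beta> (fst q))"
    by (intro smooth2_add smooth2_mult smooth2_snd smooth1_imp_smooth2 assms open_I)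
  then show 2: "smooth2 I (ycomp (aff \<xi> A \<beta>))"
    by (rule smooth2_cong[OF open_I, rotated]) (simp add: aff_apply)
  show "aff \<xi> A \<beta> \<in> vfields I"
    using 1 2 by (simp add: vfields_def smooth_on_pair[OF open_I] aff_apply)
  show "affine_comp (xcomp (aff \<xi> A \<beta>)) (ycomp (aff \<xi> A \<beta>)) \<xi> A \<beta>"
    by (simp add: affine_comp_def assms aff_apply)
qed

lemma vf_bracket_aff:
  assumes 1: "smooth1 I \<xi>1" "smooth1 I A1" "smooth1 I \<beta>1"
    and 2: "smooth1 I \<xi>2" "smooth1 I A2" "smooth1 I \<beta>2"
  shows "vf_bracket (aff \<xi>1 A1 \<beta>1) (aff \<xi>2 A2 \<beta>2) =
    aff (\<lambda>x. \<xi>1 x * deriv \<xi>2 x - \<xi>2 x * deriv \<xi>1 x) (\<lambda>x. \<xi>1 x * deriv A2 x - \<xi>2 x * deriv A1 x)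
      (\<lambda>x. \<xi>1 x * deriv \<beta>2 x + \<beta>1 x * A2 x - \<xi>2 x * deriv \<beta>1 x - \<beta>2 x * A1 x)"
proof (rule vfield_eqI)
  fix x y
  have vx: "vector_derivative (\<lambda>t. aff \<xi> A \<beta> (t, y)) (at x) = (deriv \<xi> x, deriv A x * y + deriv \<beta> x)"
    and vy: "vector_derivative (\<lambda>t. aff \<xi> A \<beta> (x, t)) (at y) = (0, A x)"
    if sm: "smooth1 I \<xi>" "smooth1 I A" "smooth1 I \<beta>" and x: "x \<in> I" for \<xi> A \<beta>
  proof -
    have "((\<lambda>t. (\<xi> t, A t * y + \<beta> t)) has_vector_derivative (deriv \<xi> x, deriv A x * y + deriv \<beta> x)) (at x)"
      using smooth1_differentiable[OF sm(1) x] smooth1_differentiable[OF sm(2) x] smooth1_differentiable[OF sm(3) x]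
      by (intro has_vector_derivative_Pair)
        (auto simp: has_real_derivative_iff_has_vector_derivative[symmetric] intro!: derivative_eq_intros)
    then have "((\<lambda>t. aff \<xi> A \<beta> (t, y)) has_vector_derivative (deriv \<xi> x, deriv A x * y + deriv \<beta> x)) (at x)"
      by (rule has_vector_derivative_transform_within_open[OF _ open_I x]) (simp add: aff_apply)
    then show "vector_derivative (\<lambda>t. aff \<xi> A \<beta> (t, y)) (at x) = (deriv \<xi> x, deriv A x * y + deriv \<beta> x)"
      by (rule vector_derivative_at)
    have "((\<lambda>t. (\<xi> x, A x * t + \<beta> x)) has_vector_derivative (0, A x)) (at y)"
      by (intro has_vector_derivative_Pair)
        (auto simp: has_real_derivative_iff_has_vector_derivative[symmetric] intro!: derivative_eq_intros)
    then show "vector_derivative (\<lambda>t. aff \<xi> A \<beta> (x, t)) (at y) = (0, A x)"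
      using x by (simp add: aff_apply vector_derivative_at)
  qed
  show "vf_bracket (aff \<xi>1 A1 \<beta>1) (aff \<xi>2 A2 \<beta>2) (x, y) =
    aff (\<lambda>x. \<xi>1 x * deriv \<xi>2 x - \<xi>2 x * deriv \<xi>1 x) (\<lambda>x. \<xi>1 x * deriv A2 x - \<xi>2 x * deriv A1 x)
      (\<lambda>x. \<xi>1 x * deriv \<beta>2 x + \<beta>1 x * A2 x - \<xi>2 x * deriv \<beta>1 x - \<beta>2 x * A1 x) (x, y)"
  proof (cases "x \<in> I")
    case True
    then show ?thesis
      by (simp add: vf_bracket_def vf_apply_def vx[OF 1] vx[OF 2] vy[OF 1] vy[OF 2])
        (simp add: aff_apply algebra_simps)
  next
    case False
    then show ?thesis by (simp add: vf_bracket_def vf_apply_def aff_apply)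
  qed
qed

text \<open>
  The quadratic form in \<open>u, v\<close> with coefficients \<open>a\<^sub>0, a\<^sub>1, a\<^sub>2\<close> is the \<open>x\<close>-component of
  \<open>a\<^sub>0 F + a\<^sub>1 G + a\<^sub>2 H\<close>, \<open>dquad\<close> is its derivative, and \<open>V_sum\<close> is the component of a combination of the
  first \<open>N\<close> of the fields \<open>V\<close>.
\<close>

definition quad :: "real \<Rightarrow> real \<Rightarrow> real \<Rightarrow> real \<Rightarrow> real" where
  "quad a0 a1 a2 = (\<lambda>x. a0 * (u x)\<^sup>2 + 2 * a1 * (u x * v x) - a2 * (v x)\<^sup>2)"

definition dquad :: "real \<Rightarrow> real \<Rightarrow> real \<Rightarrow> real \<Rightarrow> real" where
  "dquad a0 a1 a2 = (\<lambda>x. a0 * (2 * u x * deriv u x) + 2 * a1 * (u x * deriv v x + deriv u x * v x)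
     - a2 * (2 * v x * deriv v x))"

definition V_sum :: "nat \<Rightarrow> (nat \<Rightarrow> real) \<Rightarrow> real \<Rightarrow> real" where
  "V_sum N \<beta> = (\<lambda>x. \<Sum>k<N. \<beta> k * (u x ^ (n - (k + 1)) * v x ^ k))"

text \<open>
  The coefficient of \<open>y\<close> in the second component of \<open>a\<^sub>0 F + a\<^sub>1 G + a\<^sub>2 H + c W\<close>.
\<close>

definition y_coeff :: "real \<Rightarrow> real \<Rightarrow> real \<Rightarrow> real \<Rightarrow> real \<Rightarrow> real" where
  "y_coeff a0 a1 a2 c = (\<lambda>x. (real n - 1) / 2 * dquad a0 a1 a2 x + c)"

text \<open>
  The vector field \<open>a\<^sub>0 F + a\<^sub>1 G + a\<^sub>2 H + c W + \<Sum>\<^sub>k \<beta>\<^sub>k V\<^sub>k\<close>, with the sum over \<open>k < N\<close>.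
\<close>

definition sym_field :: "nat \<Rightarrow> real \<Rightarrow> real \<Rightarrow> real \<Rightarrow> real \<Rightarrow> (nat \<Rightarrow> real) \<Rightarrow> vfield" where
  "sym_field N a0 a1 a2 c \<beta> = aff (quad a0 a1 a2) (y_coeff a0 a1 a2 c) (V_sum N \<beta>)"

lemma smooth_quad: "smooth1 I (quad a0 a1 a2)"
  unfolding quad_def
  by (intro smooth1_diff smooth1_add smooth1_mult smooth1_const smooth1_power smooth_u smooth_v open_I)

lemma smooth_dquad: "smooth1 I (dquad a0 a1 a2)"
  unfolding dquad_def
  by (intro smooth1_diff smooth1_add smooth1_mult smooth1_const smooth1_deriv smooth_u smooth_v open_I)

lemma smooth_y_coeff: "smooth1 I (y_coeff a0 a1 a2 c)"
  unfolding y_coeff_def by (intro smooth1_add smooth1_mult smooth1_const smooth_dquad open_I)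

lemma smooth_V_sum: "smooth1 I (V_sum N \<beta>)"
  unfolding V_sum_def
  by (intro smooth1_sum smooth1_mult smooth1_const smooth1_power smooth_u smooth_v open_I)

lemma sym_field_smooth:
  shows "smooth2 I (xcomp (sym_field N a0 a1 a2 c \<beta>))" "smooth2 I (ycomp (sym_field N a0 a1 a2 c \<beta>))"
    "sym_field N a0 a1 a2 c \<beta> \<in> vfields I"
    "affine_comp (xcomp (sym_field N a0 a1 a2 c \<beta>)) (ycomp (sym_field N a0 a1 a2 c \<beta>))
      (quad a0 a1 a2) (y_coeff a0 a1 a2 c) (V_sum N \<beta>)"
  unfolding sym_field_def by (rule aff_smooth[OF smooth_quad smooth_y_coeff smooth_V_sum])+

lemma has_deriv_quad: "x \<in> I \<Longrightarrow> (quad a0 a1 a2 has_real_derivative dquad a0 a1 a2 x) (at x)"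
  unfolding quad_def dquad_def using deriv_u deriv_v
  by (auto intro!: derivative_eq_intros simp: algebra_simps power2_eq_square)

lemma deriv_quad: "x \<in> I \<Longrightarrow> deriv (quad a0 a1 a2) x = dquad a0 a1 a2 x"
  by (rule DERIV_imp_deriv[OF has_deriv_quad])

lemma uv_\<zeta>: "x \<in> I \<Longrightarrow> v x = u x * \<zeta> x"
  using u_iu[of x] by (simp add: \<zeta>_def mult.left_commute)

lemma Zt_quad: "x \<in> I \<Longrightarrow> Zt (quad a0 a1 a2) x = - a0 + - (2 * a1) * \<zeta> x + a2 * (\<zeta> x)\<^sup>2"
proof -
  assume x: "x \<in> I"
  have "Zt (quad a0 a1 a2) x = (iu x)\<^sup>2 * ((u x)\<^sup>2 * (- a0 + - (2 * a1) * \<zeta> x + a2 * (\<zeta> x)\<^sup>2))"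
    unfolding Zt_def quad_def uv_\<zeta>[OF x] by (simp add: algebra_simps power2_eq_square)
  then show ?thesis unfolding iu2_u2[OF x] .
qed

lemma dz_Zt:
  assumes "smooth1 I \<xi>" "x \<in> I"
  shows "dz (Zt \<xi>) x = - deriv \<xi> x + 2 * deriv u x * iu x * \<xi> x"
proof -
  have "(Zt \<xi> has_real_derivative - (deriv \<xi> x * (iu x)\<^sup>2 + (- real 2 * deriv u x * iu x * (iu x)\<^sup>2) * \<xi> x)) (at x)"
    unfolding Zt_def
    by (intro DERIV_minus DERIV_mult smooth1_differentiable[OF assms] has_deriv_iu_power[OF assms(2)])
  from dz_eq[OF assms(2) this]
  have "dz (Zt \<xi>) x = (iu x)\<^sup>2 * ((u x)\<^sup>2 * (- deriv \<xi> x + 2 * deriv u x * iu x * \<xi> x))"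
    by (simp add: algebra_simps)
  then show ?thesis unfolding iu2_u2[OF assms(2)] .
qed

lemma At_relation:
  assumes "smooth1 I \<xi>" "x \<in> I"
  shows "2 * At \<xi> A x + real (n - 1) * dz (Zt \<xi>) x = 2 * (A x - (real n - 1) / 2 * deriv \<xi> x)"
proof -
  have n1: "real (n - 1) = real n - 1" using n_ge_2 by simp
  show ?thesis unfolding dz_Zt[OF assms] At_def n1 by (simp add: field_simps)
qed

lemma p_u_power:
  assumes "x \<in> I" "k < n"
  shows "p x * (u x ^ (n - (k + 1)) * v x ^ k) = \<zeta> x ^ k"
proof -
  have "u x ^ (n - (k + 1)) * u x ^ k = u x ^ (n - 1)"
    using assms(2) by (simp add: power_add[symmetric])
  then have "u x ^ (n - (k + 1)) * v x ^ k = u x ^ (n - 1) * \<zeta> x ^ k"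
    unfolding uv_\<zeta>[OF assms(1)] by (simp only: power_mult_distrib mult.assoc[symmetric])
  moreover have "p x * u x ^ (n - 1) = 1"
    unfolding p_def power_mult_distrib[symmetric] using u_iu[OF assms(1)] by (simp add: mult.commute)
  ultimately show ?thesis by (simp add: mult.assoc[symmetric])
qed

lemma Bt_V_sum:
  assumes "x \<in> I" "N \<le> n"
  shows "Bt (V_sum N \<beta>) x = (\<Sum>k<N. \<alpha> * \<beta> k * \<zeta> x ^ k)"
  unfolding Bt_def V_sum_def sum_distrib_left
proof (intro sum.cong refl)
  fix k assume "k \<in> {..<N}"
  then have "p x * (u x ^ (n - (k + 1)) * v x ^ k) = \<zeta> x ^ k" using p_u_power[OF assms(1)] assms(2) by simp
  then show "\<alpha> * p x * (\<beta> k * (u x ^ (n - (k + 1)) * v x ^ k)) = \<alpha> * \<beta> k * \<zeta> x ^ k"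
    by (metis (no_types, opaque_lifting) mult.assoc mult.left_commute)
qed

text \<open>
  An affine field whose components in the new coordinates are polynomials in \<open>\<zeta>\<close> of the degrees that
  the determining equations allow is a combination of the generators.
\<close>

lemma sym_field_exists:
  assumes X: "X \<in> vfields I" and aff: "affine_comp (xcomp X) (ycomp X) \<xi> A \<beta>"
    and N: "N \<le> n"
    and Z: "\<And>x. x \<in> I \<Longrightarrow> Zt \<xi> x = c0 + c1 * \<zeta> x + c2 * (\<zeta> x)\<^sup>2"
    and A: "\<And>x. x \<in> I \<Longrightarrow> 2 * At \<xi> A x + real (n - 1) * dz (Zt \<xi>) x = 2 * c"
    and B: "\<And>x. x \<in> I \<Longrightarrow> (dz ^^ N) (Bt \<beta>) x = 0"
  shows "\<exists>\<beta>'. X = sym_field N (- c0) (- c1 / 2) c2 c \<beta>'"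
proof -
  have sm: "smooth1 I \<xi>" "smooth1 I \<beta>" using aff by (simp_all add: affine_comp_def)
  have \<xi>: "\<xi> x = quad (- c0) (- c1 / 2) c2 x" if x: "x \<in> I" for x
  proof -
    have "Zt \<xi> x = Zt (quad (- c0) (- c1 / 2) c2) x" unfolding Z[OF x] Zt_quad[OF x] by simp
    then show ?thesis using iu_nonzero[OF x] by (simp add: Zt_def)
  qed
  have d\<xi>: "deriv \<xi> x = dquad (- c0) (- c1 / 2) c2 x" if x: "x \<in> I" for x
    by (rule DERIV_imp_deriv, rule has_field_derivative_transform_within_open[OF has_deriv_quad[OF x] open_I x])
      (simp add: \<xi>)
  have A': "A x = y_coeff (- c0) (- c1 / 2) c2 c x" if x: "x \<in> I" for x
    using A[OF x] unfolding At_relation[OF sm(1) x] d\<xi>[OF x] y_coeff_def by simp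
  obtain d where d: "\<forall>x\<in>I. Bt \<beta> x = (\<Sum>i<N. d i * \<zeta> x ^ i)"
    using dz_iter_zero_imp_polynomial[OF smooth_Bt[OF sm(2)] B] by blast
  have B': "\<beta> x = V_sum N (\<lambda>i. d i / \<alpha>) x" if x: "x \<in> I" for x
  proof -
    have "Bt \<beta> x = Bt (V_sum N (\<lambda>i. d i / \<alpha>)) x"
      using d x \<alpha>_nonzero by (simp add: Bt_V_sum[OF x N])
    then show ?thesis using p_nonzero[OF x] \<alpha>_nonzero by (simp add: Bt_def)
  qed
  have "X = sym_field N (- c0) (- c1 / 2) c2 c (\<lambda>i. d i / \<alpha>)"
  proof (rule vfield_eqI)
    fix x y
    show "X (x, y) = sym_field N (- c0) (- c1 / 2) c2 c (\<lambda>i. d i / \<alpha>) (x, y)"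
    proof (cases "x \<in> I")
      case True
      then have "fst (X (x, y)) = \<xi> x" "snd (X (x, y)) = A x * y + \<beta> x"
        using aff by (simp_all add: affine_comp_def)
      then show ?thesis using True \<xi> A' B' by (simp add: sym_field_def aff_apply prod_eq_iff)
    next
      case False
      then show ?thesis using X by (simp add: sym_field_def aff_apply vfields_def)
    qed
  qed
  then show ?thesis by blast
qed

lemma sym_field_zw_char_iter:
  fixes N :: nat and a0 a1 a2 c :: real and \<beta> :: "nat \<Rightarrow> real"
  defines "X \<equiv> sym_field N a0 a1 a2 c \<beta>"
  assumes N: "1 \<le> M" "N \<le> M" "N \<le> n" and x: "x \<in> I"
    and M: "real M * (real n - 1) = real M * (real M - 1) \<or> a2 = 0"
  shows "(Dz ^^ M) (zw_char (xcomp X) (ycomp X)) x j =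
    lift (z_neg (xcomp X)) x j * T (Suc M) x j
    + (c - (real n - 1) / 2 * dz (Zt (quad a0 a1 a2)) x + real M * dz (Zt (quad a0 a1 a2)) x) * T M x j"
proof -
  note aff = sym_field_smooth(4)[of N a0 a1 a2 c \<beta>, folded X_def]
  have n1: "real (n - 1) = real n - 1" using n_ge_2 by simp
  have A: "At (quad a0 a1 a2) (y_coeff a0 a1 a2 c) x = c + - ((real n - 1) / 2) * dz (Zt (quad a0 a1 a2)) x"
    if "x \<in> I" for x
    using At_relation[OF smooth_quad that, of a0 a1 a2 "y_coeff a0 a1 a2 c"]
    unfolding deriv_quad[OF that] y_coeff_def n1 by (simp add: field_simps)
  have Z3: "(dz ^^ i) (Zt (quad a0 a1 a2)) x = 0" if "3 \<le> i" for i
  proof (rule dz_iter_zero_mono[OF _ that x])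
    fix x assume "x \<in> I"
    then show "(dz ^^ 3) (Zt (quad a0 a1 a2)) x = 0"
      by (intro dz_iter_polynomial_eq_0[of _ "\<lambda>i. if i = 0 then - a0 else if i = 1 then - (2 * a1) else a2" 3])
        (simp_all add: Zt_quad numeral_3_eq_3 power2_eq_square)
  qed
  have Z2: "(dz ^^ 2) (Zt (quad a0 a1 a2)) x = 0" if "a2 = 0"
    using x that
    by (intro dz_iter_polynomial_eq_0[of _ "\<lambda>i. if i = 0 then - a0 else - (2 * a1)" 2])
      (simp_all add: Zt_quad numeral_2_eq_2)
  have As: "(dz ^^ Suc i) (At (quad a0 a1 a2) (y_coeff a0 a1 a2 c)) x =
      - ((real n - 1) / 2) * (dz ^^ Suc (Suc i)) (Zt (quad a0 a1 a2)) x" for i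
    using dz_iter_scaled[OF smooth_dz[OF smooth_Zt[OF smooth_quad]] A x, of i]
    by (simp only: dz_iter_Suc[of "Suc i"])
  have B: "(dz ^^ M) (Bt (V_sum N \<beta>)) x = 0"
  proof (rule dz_iter_zero_mono[OF _ N(2) x])
    fix x assume "x \<in> I"
    then show "(dz ^^ N) (Bt (V_sum N \<beta>)) x = 0"
      by (intro dz_iter_polynomial_eq_0[of _ "\<lambda>k. \<alpha> * \<beta> k" N]) (simp_all add: Bt_V_sum N(3))
  qed
  have A2: "(dz ^^ i) (At (quad a0 a1 a2) (y_coeff a0 a1 a2 c)) x = 0" if "2 \<le> i" for i
  proof -
    obtain l where "i = Suc l" "1 \<le> l" using \<open>2 \<le> i\<close> by (cases i) auto
    then show ?thesis using As[of l] Z3[of "Suc (Suc l)"] by simp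
  qed
  have b2: "2 * real (M choose 2) = (real M - 1) * real M"
    using real_binomial_Suc[of 1 M] by (simp add: numeral_2_eq_2)
  have rel: "real M * dz (At (quad a0 a1 a2) (y_coeff a0 a1 a2 c)) x
      + real (M choose 2) * (dz ^^ 2) (Zt (quad a0 a1 a2)) x = 0"
  proof -
    have A1: "dz (At (quad a0 a1 a2) (y_coeff a0 a1 a2 c)) x = - ((real n - 1) / 2) * (dz ^^ 2) (Zt (quad a0 a1 a2)) x"
      using As[of 0] by (simp add: numeral_2_eq_2)
    have "2 * (real M * dz (At (quad a0 a1 a2) (y_coeff a0 a1 a2 c)) x
        + real (M choose 2) * (dz ^^ 2) (Zt (quad a0 a1 a2)) x) =
        (2 * real (M choose 2) - real M * (real n - 1)) * (dz ^^ 2) (Zt (quad a0 a1 a2)) x"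
      unfolding A1 by (simp add: field_simps)
    also have "\<dots> = 0" using M Z2 unfolding b2 by (auto simp: algebra_simps)
    finally show ?thesis by simp
  qed
  have "(Dz ^^ M) (zw_char (xcomp X) (ycomp X)) x j = Zt (quad a0 a1 a2) x * T (Suc M) x j
      + (At (quad a0 a1 a2) (y_coeff a0 a1 a2 c) x + real M * dz (Zt (quad a0 a1 a2)) x) * T M x j"
    by (rule affine_zw_char_iter_eq[OF aff x N(1) B A2 Z3 rel])
  then show ?thesis
    unfolding lift_def affine_z_neg[OF aff x] A[OF x] by (simp add: algebra_simps)
qed

end

section \<open>Generated Lie algebras and symmetry algebras\<close>

lemma lie_span_eqI:
  assumes "G \<subseteq> S" "vf_zero \<in> S"
    and "\<And>X Y. X \<in> S \<Longrightarrow> Y \<in> S \<Longrightarrow> vf_add X Y \<in> S"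
    and "\<And>c X. X \<in> S \<Longrightarrow> vf_scale c X \<in> S"
    and "\<And>X Y. X \<in> S \<Longrightarrow> Y \<in> S \<Longrightarrow> vf_bracket X Y \<in> S"
    and "S \<subseteq> lie_span G"
  shows "lie_span G = S"
proof
  show "lie_span G \<subseteq> S"
  proof
    fix X assume "X \<in> lie_span G"
    then show "X \<in> S" by induction (use assms in auto)
  qed
qed (rule assms(6))

context source_solutions
begin

lemma quad_zero: "quad 0 0 0 = (\<lambda>x. 0)"
  by (simp add: quad_def)

lemma y_coeff_zero: "y_coeff 0 0 0 c = (\<lambda>x. c)"
  by (simp add: y_coeff_def dquad_def)

lemma V_sum_zero: "V_sum N (\<lambda>k. 0) = (\<lambda>x. 0)"
  by (simp add: V_sum_def)

lemma vf_zero_sym_field: "vf_zero = sym_field N 0 0 0 0 (\<lambda>k. 0)"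
  by (simp add: sym_field_def quad_zero y_coeff_zero V_sum_zero vf_zero_aff)

lemma sym_field_add: "vf_add (sym_field N a0 a1 a2 c \<beta>) (sym_field N b0 b1 b2 d \<gamma>) =
    sym_field N (a0 + b0) (a1 + b1) (a2 + b2) (c + d) (\<lambda>k. \<beta> k + \<gamma> k)"
  unfolding sym_field_def vf_add_aff
  by (rule aff_cong)
    (simp_all add: quad_def y_coeff_def dquad_def V_sum_def algebra_simps sum.distrib add_divide_distrib diff_divide_distrib)

lemma sym_field_scale: "vf_scale r (sym_field N a0 a1 a2 c \<beta>) =
    sym_field N (r * a0) (r * a1) (r * a2) (r * c) (\<lambda>k. r * \<beta> k)"
  unfolding sym_field_def vf_scale_aff
  by (rule aff_cong)
    (simp_all add: quad_def y_coeff_def dquad_def V_sum_def algebra_simps sum_distrib_left)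

lemma sym_field_sum: "vf_add (sym_field N 0 0 0 0 \<beta>) (sym_field 0 a0 a1 a2 c \<gamma>) = sym_field N a0 a1 a2 c \<beta>"
  unfolding sym_field_def vf_add_aff
  by (rule aff_cong) (simp_all add: quad_zero y_coeff_zero V_sum_def)

lemma sym_field_no_V: "sym_field N a0 a1 a2 c (\<lambda>k. 0) = sym_field 0 a0 a1 a2 c \<gamma>"
  by (simp add: sym_field_def V_sum_def)

lemma vf_W_sym_field: "vf_W I = sym_field N 0 0 0 1 (\<lambda>k. 0)"
  by (simp add: vf_W_def sym_field_def quad_zero y_coeff_zero V_sum_zero aff_def)

lemma vf_V_sym_field:
  assumes "k < N"
  shows "vf_V I n u v k = sym_field N 0 0 0 0 (\<lambda>i. if i = k then 1 else 0)"
proof -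
  have "V_sum N (\<lambda>i. if i = k then 1 else 0) x = u x ^ (n - (k + 1)) * v x ^ k" for x
  proof -
    have "V_sum N (\<lambda>i. if i = k then 1 else 0) x =
        (\<Sum>i<N. if i = k then u x ^ (n - (k + 1)) * v x ^ k else 0)"
      unfolding V_sum_def by (rule sum.cong) auto
    then show ?thesis using assms by simp
  qed
  then have "V_sum N (\<lambda>i. if i = k then 1 else 0) = (\<lambda>x. u x ^ (n - (k + 1)) * v x ^ k)" by (rule ext)
  then show ?thesis by (simp add: vf_V_def sym_field_def quad_zero y_coeff_zero aff_def)
qed

lemma vf_F_sym_field: "vf_F I n u = sym_field 0 1 0 0 0 (\<lambda>k. 0)"
  by (rule vfield_eqI) (simp add: vf_F_def sym_field_def aff_def quad_def y_coeff_def dquad_def V_sum_def mk_vfield_def)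

lemma vf_G_sym_field: "vf_G I n u v = sym_field 0 0 1 0 0 (\<lambda>k. 0)"
  by (rule vfield_eqI)
    (simp add: vf_G_def sym_field_def aff_def quad_def y_coeff_def dquad_def V_sum_def mk_vfield_def field_simps)

lemma vf_H_sym_field: "vf_H I n v = sym_field 0 0 0 1 0 (\<lambda>k. 0)"
  by (rule vfield_eqI) (simp add: vf_H_def sym_field_def aff_def quad_def y_coeff_def dquad_def V_sum_def mk_vfield_def)

lemma bracket_VW: "vf_bracket (sym_field N 0 0 0 c \<beta>) (sym_field N 0 0 0 d \<gamma>) =
    sym_field N 0 0 0 0 (\<lambda>k. d * \<beta> k - c * \<gamma> k)"
  unfolding sym_field_def vf_bracket_aff[OF smooth_quad smooth_y_coeff smooth_V_sum smooth_quad smooth_y_coeff smooth_V_sum]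
  by (rule aff_cong)
    (simp_all add: quad_zero y_coeff_zero V_sum_def algebra_simps sum_subtractf sum_distrib_left)

lemma quad_wronskian:
  assumes "x \<in> I"
  shows "quad a0 a1 a2 x * dquad b0 b1 b2 x - quad b0 b1 b2 x * dquad a0 a1 a2 x =
    quad (2 * (a0 * b1 - b0 * a1)) (b0 * a2 - a0 * b2) (2 * (a1 * b2 - b1 * a2)) x"
proof -
  have "quad a0 a1 a2 x * dquad b0 b1 b2 x - quad b0 b1 b2 x * dquad a0 a1 a2 x =
    quad (2 * (a0 * b1 - b0 * a1)) (b0 * a2 - a0 * b2) (2 * (a1 * b2 - b1 * a2)) x
    * (u x * deriv v x - deriv u x * v x)"
    unfolding quad_def dquad_def by (simp add: algebra_simps power2_eq_square)
  then show ?thesis unfolding wronskian[OF assms] by simp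
qed

text \<open>The bracket of \<open>sl(2)\<close>, which comes from the bracket of quadratic vector fields in \<open>z\<close>.\<close>

lemma bracket_s: "vf_bracket (sym_field 0 a0 a1 a2 0 \<beta>) (sym_field 0 b0 b1 b2 0 \<gamma>) =
    sym_field 0 (2 * (a0 * b1 - b0 * a1)) (b0 * a2 - a0 * b2) (2 * (a1 * b2 - b1 * a2)) 0 \<delta>"
  unfolding sym_field_def vf_bracket_aff[OF smooth_quad smooth_y_coeff smooth_V_sum smooth_quad smooth_y_coeff smooth_V_sum]
proof (rule aff_cong)
  fix x assume x: "x \<in> I"
  let ?c0 = "2 * (a0 * b1 - b0 * a1)" and ?c1 = "b0 * a2 - a0 * b2" and ?c2 = "2 * (a1 * b2 - b1 * a2)"
  show "quad a0 a1 a2 x * deriv (quad b0 b1 b2) x - quad b0 b1 b2 x * deriv (quad a0 a1 a2) x = quad ?c0 ?c1 ?c2 x"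
    unfolding deriv_quad[OF x] by (rule quad_wronskian[OF x])
  have dl: "deriv (y_coeff c0 c1 c2 0) x = (real n - 1) / 2 * deriv (dquad c0 c1 c2) x" for c0 c1 c2
    unfolding y_coeff_def add_0_right
    by (rule DERIV_imp_deriv[OF DERIV_cmult[OF smooth1_differentiable[OF smooth_dquad x]]])
  have "((\<lambda>x. quad a0 a1 a2 x * dquad b0 b1 b2 x - quad b0 b1 b2 x * dquad a0 a1 a2 x) has_real_derivative
      (dquad a0 a1 a2 x * dquad b0 b1 b2 x + deriv (dquad b0 b1 b2) x * quad a0 a1 a2 x)
      - (dquad b0 b1 b2 x * dquad a0 a1 a2 x + deriv (dquad a0 a1 a2) x * quad b0 b1 b2 x)) (at x)"
    by (intro DERIV_diff DERIV_mult has_deriv_quad[OF x] smooth1_differentiable[OF smooth_dquad x])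
  moreover have "((\<lambda>x. quad a0 a1 a2 x * dquad b0 b1 b2 x - quad b0 b1 b2 x * dquad a0 a1 a2 x) has_real_derivative
      dquad ?c0 ?c1 ?c2 x) (at x)"
    by (rule has_field_derivative_transform_within_open[OF has_deriv_quad[OF x] open_I x])
      (rule quad_wronskian[symmetric])
  ultimately have d: "dquad ?c0 ?c1 ?c2 x =
      (dquad a0 a1 a2 x * dquad b0 b1 b2 x + deriv (dquad b0 b1 b2) x * quad a0 a1 a2 x)
      - (dquad b0 b1 b2 x * dquad a0 a1 a2 x + deriv (dquad a0 a1 a2) x * quad b0 b1 b2 x)"
    using DERIV_unique by blast
  show "quad a0 a1 a2 x * deriv (y_coeff b0 b1 b2 0) x - quad b0 b1 b2 x * deriv (y_coeff a0 a1 a2 0) x = y_coeff ?c0 ?c1 ?c2 0 x"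
    unfolding dl unfolding y_coeff_def d by (simp add: field_simps)
qed (simp add: V_sum_def)

lemma sym_field_in_span:
  assumes "\<And>k. k < N \<Longrightarrow> vf_V I n u v k \<in> lie_span G"
  shows "sym_field N 0 0 0 0 \<beta> \<in> lie_span G"
  using assms
proof (induction N)
  case 0
  have "sym_field 0 0 0 0 0 \<beta> = vf_zero" using sym_field_no_V[of 0] vf_zero_sym_field by metis
  then show ?case using lie_span.zero by simp
next
  case (Suc N)
  have "sym_field (Suc N) 0 0 0 0 \<beta> = vf_add (sym_field N 0 0 0 0 \<beta>) (vf_scale (\<beta> N) (vf_V I n u v N))"
  proof -
    have "vf_V I n u v N = aff (\<lambda>x. 0) (\<lambda>x. 0) (\<lambda>x. u x ^ (n - (N + 1)) * v x ^ N)"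
      by (simp add: vf_V_def aff_def)
    then show ?thesis
      by (simp add: sym_field_def quad_zero y_coeff_zero vf_scale_aff vf_add_aff V_sum_def)
  qed
  then show ?case using Suc by (simp add: lie_span.add lie_span.scale)
qed

lemma lie_span_V: "lie_span {vf_V I n u v k | k. k < N} = {sym_field N 0 0 0 0 \<beta> | \<beta>. True}"
proof (rule lie_span_eqI)
  show "{vf_V I n u v k | k. k < N} \<subseteq> {sym_field N 0 0 0 0 \<beta> | \<beta>. True}" using vf_V_sym_field by blast
  show "vf_zero \<in> {sym_field N 0 0 0 0 \<beta> | \<beta>. True}" using vf_zero_sym_field by blast
  show "{sym_field N 0 0 0 0 \<beta> | \<beta>. True} \<subseteq> lie_span {vf_V I n u v k | k. k < N}"
  proof
    fix X assume "X \<in> {sym_field N 0 0 0 0 \<beta> | \<beta>. True}"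
    then obtain \<beta> where X: "X = sym_field N 0 0 0 0 \<beta>" by blast
    show "X \<in> lie_span {vf_V I n u v k | k. k < N}"
      unfolding X by (rule sym_field_in_span, rule lie_span.gen) blast
  qed
next
  fix X Y assume "X \<in> {sym_field N 0 0 0 0 \<beta> | \<beta>. True}" "Y \<in> {sym_field N 0 0 0 0 \<beta> | \<beta>. True}"
  then obtain \<beta> \<gamma> where XY: "X = sym_field N 0 0 0 0 \<beta>" "Y = sym_field N 0 0 0 0 \<gamma>" by blast
  show "vf_add X Y \<in> {sym_field N 0 0 0 0 \<beta> | \<beta>. True}" unfolding XY sym_field_add add_0_right by blast
  show "vf_bracket X Y \<in> {sym_field N 0 0 0 0 \<beta> | \<beta>. True}" unfolding XY bracket_VW by blast
next
  fix c X assume "X \<in> {sym_field N 0 0 0 0 \<beta> | \<beta>. True}"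
  then obtain \<beta> where X: "X = sym_field N 0 0 0 0 \<beta>" by blast
  show "vf_scale c X \<in> {sym_field N 0 0 0 0 \<beta> | \<beta>. True}" unfolding X sym_field_scale mult_zero_right by blast
qed

lemma lie_span_VW: "lie_span ({vf_V I n u v k | k. k < N} \<union> {vf_W I}) = {sym_field N 0 0 0 c \<beta> | c \<beta>. True}"
    (is "lie_span ?G = ?S")
proof (rule lie_span_eqI)
  show "?G \<subseteq> ?S" using vf_V_sym_field vf_W_sym_field by blast
  show "vf_zero \<in> ?S" using vf_zero_sym_field by blast
  show "?S \<subseteq> lie_span ?G"
  proof
    fix X assume "X \<in> ?S"
    then obtain c \<beta> where X: "X = sym_field N 0 0 0 c \<beta>" by blast
    have "X = vf_add (sym_field N 0 0 0 0 \<beta>) (vf_scale c (vf_W I))"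
      unfolding X vf_W_sym_field[of N] sym_field_scale sym_field_add by simp
    moreover have "vf_W I \<in> lie_span ?G" by (rule lie_span.gen) simp
    moreover have "sym_field N 0 0 0 0 \<beta> \<in> lie_span ?G" by (rule sym_field_in_span, rule lie_span.gen) blast
    ultimately show "X \<in> lie_span ?G" by (simp add: lie_span.add lie_span.scale)
  qed
next
  fix X Y assume "X \<in> ?S" "Y \<in> ?S"
  then obtain c \<beta> d \<gamma> where XY: "X = sym_field N 0 0 0 c \<beta>" "Y = sym_field N 0 0 0 d \<gamma>" by blast
  show "vf_add X Y \<in> ?S" unfolding XY sym_field_add add_0_right by blast
  show "vf_bracket X Y \<in> ?S" unfolding XY bracket_VW by blast
next
  fix c X assume "X \<in> ?S"
  then obtain d \<beta> where X: "X = sym_field N 0 0 0 d \<beta>" by blast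
  show "vf_scale c X \<in> ?S" unfolding X sym_field_scale mult_zero_right by blast
qed

lemma lie_span_FGH: "lie_span {vf_F I n u, vf_G I n u v, vf_H I n v} =
    {sym_field 0 a0 a1 a2 0 (\<lambda>k. 0) | a0 a1 a2. True}" (is "lie_span ?G = ?S")
proof (rule lie_span_eqI)
  show "?G \<subseteq> ?S" using vf_F_sym_field vf_G_sym_field vf_H_sym_field by blast
  show "vf_zero \<in> ?S" using vf_zero_sym_field by blast
  show "?S \<subseteq> lie_span ?G"
  proof
    fix X assume "X \<in> ?S"
    then obtain a0 a1 a2 where X: "X = sym_field 0 a0 a1 a2 0 (\<lambda>k. 0)" by blast
    have "X = vf_add (vf_scale a0 (vf_F I n u)) (vf_add (vf_scale a1 (vf_G I n u v)) (vf_scale a2 (vf_H I n v)))"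
      unfolding X vf_F_sym_field vf_G_sym_field vf_H_sym_field sym_field_scale sym_field_add by simp
    moreover have "vf_F I n u \<in> lie_span ?G" "vf_G I n u v \<in> lie_span ?G" "vf_H I n v \<in> lie_span ?G"
      by (rule lie_span.gen, simp)+
    ultimately show "X \<in> lie_span ?G" by (simp add: lie_span.add lie_span.scale)
  qed
next
  fix X Y assume "X \<in> ?S" "Y \<in> ?S"
  then obtain a0 a1 a2 b0 b1 b2 where XY: "X = sym_field 0 a0 a1 a2 0 (\<lambda>k. 0)" "Y = sym_field 0 b0 b1 b2 0 (\<lambda>k. 0)"
    by blast
  show "vf_add X Y \<in> ?S" unfolding XY sym_field_add add_0_right by blast
  show "vf_bracket X Y \<in> ?S" unfolding XY bracket_s[where \<delta> = "\<lambda>k. 0"] by blast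
next
  fix c X assume "X \<in> ?S"
  then obtain a0 a1 a2 where X: "X = sym_field 0 a0 a1 a2 0 (\<lambda>k. 0)" by blast
  show "vf_scale c X \<in> ?S" unfolding X sym_field_scale mult_zero_right by blast
qed

lemma lie_span_FG: "lie_span {vf_F I n u, vf_G I n u v} =
    {sym_field 0 a0 a1 0 0 (\<lambda>k. 0) | a0 a1. True}" (is "lie_span ?G = ?S")
proof (rule lie_span_eqI)
  show "?G \<subseteq> ?S" using vf_F_sym_field vf_G_sym_field by blast
  show "vf_zero \<in> ?S" using vf_zero_sym_field by blast
  show "?S \<subseteq> lie_span ?G"
  proof
    fix X assume "X \<in> ?S"
    then obtain a0 a1 where X: "X = sym_field 0 a0 a1 0 0 (\<lambda>k. 0)" by blast
    have "X = vf_add (vf_scale a0 (vf_F I n u)) (vf_scale a1 (vf_G I n u v))"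
      unfolding X vf_F_sym_field vf_G_sym_field sym_field_scale sym_field_add by simp
    moreover have "vf_F I n u \<in> lie_span ?G" "vf_G I n u v \<in> lie_span ?G"
      by (rule lie_span.gen, simp)+
    ultimately show "X \<in> lie_span ?G" by (simp add: lie_span.add lie_span.scale)
  qed
next
  fix X Y assume "X \<in> ?S" "Y \<in> ?S"
  then obtain a0 a1 b0 b1 where XY: "X = sym_field 0 a0 a1 0 0 (\<lambda>k. 0)" "Y = sym_field 0 b0 b1 0 0 (\<lambda>k. 0)"
    by blast
  show "vf_add X Y \<in> ?S" unfolding XY sym_field_add add_0_right by blast
  show "vf_bracket X Y \<in> ?S" unfolding XY bracket_s[where \<delta> = "\<lambda>k. 0"] mult_zero_right diff_0_right by blast
next
  fix c X assume "X \<in> ?S"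
  then obtain a0 a1 where X: "X = sym_field 0 a0 a1 0 0 (\<lambda>k. 0)" by blast
  show "vf_scale c X \<in> ?S" unfolding X sym_field_scale mult_zero_right by blast
qed

text \<open>
  On the line \<open>y = 0\<close> the second components of \<open>F, G, H, W\<close> vanish, while a combination of the fields
  \<open>V\<close> is determined by its values there; this separates the summands.
\<close>

lemma sym_field_V_eq_zero:
  assumes "X = sym_field N 0 0 0 0 \<beta>" "\<And>x. x \<in> I \<Longrightarrow> snd (X (x, 0)) = 0"
  shows "X = vf_zero"
proof -
  have "V_sum N \<beta> x = 0" if "x \<in> I" for x
    using assms(2)[OF that] that unfolding assms(1) sym_field_def by (simp add: aff_apply)
  then have "X = aff (\<lambda>x. 0) (\<lambda>x. 0) (\<lambda>x. 0)"
    unfolding assms(1) sym_field_def by (intro aff_cong) (simp_all add: quad_zero y_coeff_zero)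
  then show ?thesis by (simp add: vf_zero_aff)
qed

lemma sym_field_0_at_0: "snd (sym_field 0 a0 a1 a2 c \<beta> (x, 0)) = 0"
  by (simp add: sym_field_def aff_apply V_sum_def)

lemma direct_sum_sym_field:
  assumes "P 0 0 0 0"
  shows "is_direct_sum {sym_field N a0 a1 a2 c \<beta> | a0 a1 a2 c \<beta>. P a0 a1 a2 c}
    {sym_field N 0 0 0 0 \<beta> | \<beta>. True} {sym_field 0 a0 a1 a2 c (\<lambda>k. 0) | a0 a1 a2 c. P a0 a1 a2 c}"
    (is "is_direct_sum ?S ?A ?B")
proof -
  have "X = vf_zero" if XA: "X \<in> ?A" and XB: "X \<in> ?B" for X
  proof -
    obtain \<beta> where X: "X = sym_field N 0 0 0 0 \<beta>" using XA by blast
    have "snd (X (x, 0)) = 0" for x using XB sym_field_0_at_0 by auto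
    then show ?thesis by (rule sym_field_V_eq_zero[OF X])
  qed
  moreover have "vf_zero \<in> ?A" "vf_zero \<in> ?B"
    using vf_zero_sym_field[of N] vf_zero_sym_field[of 0] assms by blast+
  moreover have "?S = {vf_add X Y | X Y. X \<in> ?A \<and> Y \<in> ?B}"
  proof (intro set_eqI iffI)
    fix X assume "X \<in> ?S"
    then obtain a0 a1 a2 c \<beta> where X: "X = sym_field N a0 a1 a2 c \<beta>" and P: "P a0 a1 a2 c" by blast
    have "X = vf_add (sym_field N 0 0 0 0 \<beta>) (sym_field 0 a0 a1 a2 c (\<lambda>k. 0))" unfolding X sym_field_sum ..
    then show "X \<in> {vf_add X Y | X Y. X \<in> ?A \<and> Y \<in> ?B}" using P by blast
  next
    fix X assume "X \<in> {vf_add X Y | X Y. X \<in> ?A \<and> Y \<in> ?B}"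
    then obtain a0 a1 a2 c \<beta> where "X = vf_add (sym_field N 0 0 0 0 \<beta>) (sym_field 0 a0 a1 a2 c (\<lambda>k. 0))"
      and P: "P a0 a1 a2 c" by blast
    then show "X \<in> ?S" unfolding sym_field_sum by blast
  qed
  ultimately show ?thesis unfolding is_direct_sum_def by blast
qed

end

context coordinate_change
begin

lemma vfields_components:
  assumes "X \<in> vfields I"
  shows "smooth2 I (xcomp X)" "smooth2 I (ycomp X)"
  using assms by (simp_all add: vfields_def smooth_on_pair[OF open_I])

lemma factor_nonzero: "x \<in> I \<Longrightarrow> iu x ^ (n + 1) / \<alpha> \<noteq> 0"
  using iu_nonzero \<alpha>_nonzero by simp

lemma sym_field_point_symmetry:
  assumes "N \<le> n"
  shows "sym_field N a0 a1 a2 c \<beta> \<in> point_symmetries I (Delta n \<alpha> u z)"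
proof -
  define X where "X = sym_field N a0 a1 a2 c \<beta>"
  note X = sym_field_smooth[of N a0 a1 a2 c \<beta>, folded X_def]
  have "prolong X (Delta n \<alpha> u z) x j = 0" if x: "x \<in> I" and "Delta n \<alpha> u z x j = 0" for x j
  proof -
    have n1: "1 \<le> n" using n_ge_2 by simp
    have T0: "T n x j = 0" using \<open>Delta n \<alpha> u z x j = 0\<close> factor_nonzero[OF x] iu_nonzero[OF x]
      unfolding Delta_eq[OF x] Delta_jet_def by simp
    have "\<exists>k. (Dz ^^ n) (zw_char (xcomp X) (ycomp X)) x j =
        lift (z_neg (xcomp X)) x j * T (Suc n) x j + k * T n x j"
      unfolding X_def by (rule exI, rule sym_field_zw_char_iter[OF n1 assms assms x disjI1[OF refl]])
    then show ?thesis unfolding prolong_Delta[OF X(1,2) x] by (auto simp: T0)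
  qed
  then show ?thesis using X(3) unfolding point_symmetries_def X_def by blast
qed

lemma sym_field_At:
  assumes "x \<in> I"
  shows "At (quad a0 a1 a2) (y_coeff a0 a1 a2 c) x = c - (real n - 1) / 2 * dz (Zt (quad a0 a1 a2)) x"
proof -
  have n1: "real (n - 1) = real n - 1" using n_ge_2 by simp
  show ?thesis
    using At_relation[OF smooth_quad assms, of a0 a1 a2 "y_coeff a0 a1 a2 c"]
    unfolding deriv_quad[OF assms] y_coeff_def n1 by (simp add: field_simps)
qed

lemma sym_field_divergence:
  fixes a0 a1 a2 c :: real and \<beta> :: "nat \<Rightarrow> real"
  defines "X \<equiv> sym_field n a0 a1 a2 c \<beta>"
  assumes x: "x \<in> I"
  defines "Z \<equiv> Zt (quad a0 a1 a2) x" and "d \<equiv> dz (Zt (quad a0 a1 a2)) x"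
  shows "frechet_adjoint (Delta n \<alpha> u z) (characteristic X) x j
      + frechet_adjoint (characteristic X) (Delta n \<alpha> u z) x j =
    iu x ^ (n + 1) / \<alpha> * ((- 1) ^ n * (Z * T (Suc n) x j + (c - (real n - 1) / 2 * d + real n * d) * T n x j)
      - Z * T (Suc n) x j + (c - (real n - 1) / 2 * d - d) * T n x j)"
proof -
  note X = sym_field_smooth[of n a0 a1 a2 c \<beta>, folded X_def]
  have n1: "1 \<le> n" using n_ge_2 by simp
  have "(Dz ^^ n) (zw_char (xcomp X) (ycomp X)) x j =
      lift (z_neg (xcomp X)) x j * T (Suc n) x j + (c - (real n - 1) / 2 * d + real n * d) * T n x j"
    unfolding X_def d_def by (rule sym_field_zw_char_iter[OF n1 order_refl order_refl x disjI1[OF refl]])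
  moreover have "lift (z_neg (xcomp X)) x j = Z"
    unfolding lift_def Z_def by (rule affine_z_neg[OF X(4) x])
  ultimately show ?thesis
    unfolding divergence_condition[OF X(1,2) x] affine_d_w_w_comp[OF X(4,1,2) x] affine_d_z_z_neg(1)[OF X(4,1) x]
      sym_field_At[OF x] d_def by simp
qed

lemma divergence_condition_zero:
  assumes X: "X \<in> divergence_symmetries I (Delta n \<alpha> u z)" and x: "x \<in> I"
  defines "a \<equiv> xcomp X" and "b \<equiv> ycomp X"
  shows "(- 1) ^ n * (Dz ^^ n) (zw_char a b) x j - lift (z_neg a) x j * T (Suc n) x j
     + (d_w (w_comp a b) (x, j 0) - d_z (z_neg a) (x, j 0)) * T n x j = 0"
proof -
  have V: "X \<in> vfields I" and eq: "frechet_adjoint (Delta n \<alpha> u z) (characteristic X) x j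
      + frechet_adjoint (characteristic X) (Delta n \<alpha> u z) x j = 0"
    using X x unfolding divergence_symmetries_def point_symmetries_def by blast+
  show ?thesis
    using eq factor_nonzero[OF x] unfolding divergence_condition[OF vfields_components[OF V] x] a_def b_def
    by (simp only: mult_eq_0_iff) blast
qed

lemma divergence_symmetries_odd:
  assumes "odd n"
  shows "divergence_symmetries I (Delta n \<alpha> u z) = {sym_field n 0 0 0 c \<beta> | c \<beta>. True}"
proof
  show "divergence_symmetries I (Delta n \<alpha> u z) \<subseteq> {sym_field n 0 0 0 c \<beta> | c \<beta>. True}"
  proof
    fix X assume X: "X \<in> divergence_symmetries I (Delta n \<alpha> u z)"
    then have V: "X \<in> vfields I" unfolding divergence_symmetries_def point_symmetries_def by blast
    have s: "(- 1 :: real) ^ n = - 1" using assms by simp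
    obtain \<xi> A \<beta> where aff: "affine_comp (xcomp X) (ycomp X) \<xi> A \<beta>"
      and eqs: "\<forall>x\<in>I. Zt \<xi> x = 0 \<and> dz (At \<xi> A) x = 0 \<and> (dz ^^ n) (Bt \<beta>) x = 0"
      using odd_determining_equations[OF vfields_components[OF V] assms]
        divergence_condition_zero[OF X, unfolded s] by auto
    have sm: "smooth1 I \<xi>" "smooth1 I A" using aff by (simp_all add: affine_comp_def)
    obtain c where c: "\<forall>x\<in>I. At \<xi> A x = (\<Sum>i<1. c i * \<zeta> x ^ i)"
      using dz_iter_zero_imp_polynomial[OF smooth_At[OF sm], of 1] eqs by auto
    have dZ: "dz (Zt \<xi>) x = 0" for x
      using dz_cong[of "Zt \<xi>" "\<lambda>x. 0"] eqs by (simp add: dz_const)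
    have "\<exists>\<beta>'. X = sym_field n (- 0) (- 0 / 2) 0 (c 0) \<beta>'"
      by (rule sym_field_exists[OF V aff order_refl]) (use eqs c dZ in auto)
    then show "X \<in> {sym_field n 0 0 0 c \<beta> | c \<beta>. True}" unfolding minus_zero div_0 by blast
  qed
  show "{sym_field n 0 0 0 c \<beta> | c \<beta>. True} \<subseteq> divergence_symmetries I (Delta n \<alpha> u z)"
  proof
    fix X assume "X \<in> {sym_field n 0 0 0 c \<beta> | c \<beta>. True}"
    then obtain c \<beta> where X: "X = sym_field n 0 0 0 c \<beta>" by blast
    have "Zt (quad 0 0 0) = (\<lambda>x. 0)" by (simp add: Zt_def quad_zero)
    then show "X \<in> divergence_symmetries I (Delta n \<alpha> u z)"
      unfolding divergence_symmetries_def X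
      using sym_field_point_symmetry[OF order_refl] assms by (simp add: sym_field_divergence dz_const)
  qed
qed

lemma divergence_symmetries_even:
  assumes "even n"
  shows "divergence_symmetries I (Delta n \<alpha> u z) = {sym_field n a0 a1 a2 0 \<beta> | a0 a1 a2 \<beta>. True}"
proof
  have s: "(- 1 :: real) ^ n = 1" using assms by simp
  show "divergence_symmetries I (Delta n \<alpha> u z) \<subseteq> {sym_field n a0 a1 a2 0 \<beta> | a0 a1 a2 \<beta>. True}"
  proof
    fix X assume X: "X \<in> divergence_symmetries I (Delta n \<alpha> u z)"
    then have V: "X \<in> vfields I" unfolding divergence_symmetries_def point_symmetries_def by blast
    obtain \<xi> A \<beta> where aff: "affine_comp (xcomp X) (ycomp X) \<xi> A \<beta>"
      and eqs: "\<forall>x\<in>I. (dz ^^ 3) (Zt \<xi>) x = 0 \<and> 2 * At \<xi> A x + real (n - 1) * dz (Zt \<xi>) x = 0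
        \<and> (dz ^^ n) (Bt \<beta>) x = 0"
      using even_determining_equations[OF vfields_components[OF V]]
        divergence_condition_zero[OF X, unfolded s mult_1] by auto
    have sm: "smooth1 I \<xi>" using aff by (simp add: affine_comp_def)
    obtain c where c: "\<forall>x\<in>I. Zt \<xi> x = (\<Sum>i<3. c i * \<zeta> x ^ i)"
      using dz_iter_zero_imp_polynomial[OF smooth_Zt[OF sm], of 3] eqs by auto
    have "\<exists>\<beta>'. X = sym_field n (- c 0) (- c 1 / 2) (c 2) 0 \<beta>'"
      by (rule sym_field_exists[OF V aff order_refl]) (use eqs c in \<open>auto simp: numeral_3_eq_3 numeral_2_eq_2\<close>)
    then show "X \<in> {sym_field n a0 a1 a2 0 \<beta> | a0 a1 a2 \<beta>. True}" by blast
  qed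
  show "{sym_field n a0 a1 a2 0 \<beta> | a0 a1 a2 \<beta>. True} \<subseteq> divergence_symmetries I (Delta n \<alpha> u z)"
  proof
    fix X assume "X \<in> {sym_field n a0 a1 a2 0 \<beta> | a0 a1 a2 \<beta>. True}"
    then obtain a0 a1 a2 \<beta> where X: "X = sym_field n a0 a1 a2 0 \<beta>" by blast
    have ring: "Z * t' + (0 - (r - 1) / 2 * d + r * d) * t - Z * t' + (0 - (r - 1) / 2 * d - d) * t = 0"
      for Z t t' d r :: real by (simp add: field_simps)
    have "frechet_adjoint (Delta n \<alpha> u z) (characteristic X) x j
        + frechet_adjoint (characteristic X) (Delta n \<alpha> u z) x j = 0" if "x \<in> I" for x j
      unfolding X sym_field_divergence[OF that] s mult_1 ring by simp
    then show "X \<in> divergence_symmetries I (Delta n \<alpha> u z)"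
      using sym_field_point_symmetry[OF order_refl] unfolding divergence_symmetries_def X by blast
  qed
qed

lemma variational_symmetries_even:
  assumes "even n"
  shows "variational_symmetries I (Delta n \<alpha> u z) (Lagrangian n \<alpha> u z) =
    {sym_field (n div 2) a0 a1 0 0 \<beta> | a0 a1 \<beta>. True}"
proof
  define m where "m = n div 2"
  have n: "n = 2 * m" using assms by (simp add: m_def)
  have m1: "1 \<le> m" using n n_ge_2 by simp
  show "variational_symmetries I (Delta n \<alpha> u z) (Lagrangian n \<alpha> u z) \<subseteq>
      {sym_field (n div 2) a0 a1 0 0 \<beta> | a0 a1 \<beta>. True}"
  proof
    fix X assume X: "X \<in> variational_symmetries I (Delta n \<alpha> u z) (Lagrangian n \<alpha> u z)"
    then have V: "X \<in> vfields I" unfolding variational_symmetries_def point_symmetries_def by blast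
    have cond: "(Dz ^^ m) (zw_char (xcomp X) (ycomp X)) x j
        - lift (z_neg (xcomp X)) x j * T (Suc m) x j
        - Dz (lift (z_neg (xcomp X))) x j * T m x j / 2 = 0" if x: "x \<in> I" and t: "T m x j \<noteq> 0" for x j
    proof -
      have "prolong X (Lagrangian n \<alpha> u z) x j + Lagrangian n \<alpha> u z x j * total_deriv (vf_xi X) x j = 0"
        using X x unfolding variational_symmetries_def by blast
      then show ?thesis
        using t iu_nonzero[OF x] unfolding variational_condition[OF vfields_components[OF V] x, folded m_def]
        by simp
    qed
    obtain \<xi> A \<beta> where aff: "affine_comp (xcomp X) (ycomp X) \<xi> A \<beta>"
      and eqs: "\<forall>x\<in>I. (dz ^^ 2) (Zt \<xi>) x = 0 \<and> 2 * At \<xi> A x + real (n - 1) * dz (Zt \<xi>) x = 0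
        \<and> (dz ^^ m) (Bt \<beta>) x = 0"
      using variational_determining_equations[OF vfields_components[OF V] n cond] by auto
    have sm: "smooth1 I \<xi>" using aff by (simp add: affine_comp_def)
    obtain c where c: "\<forall>x\<in>I. Zt \<xi> x = (\<Sum>i<2. c i * \<zeta> x ^ i)"
      using dz_iter_zero_imp_polynomial[OF smooth_Zt[OF sm], of 2] eqs by auto
    have mn: "m \<le> n" using n by simp
    have "\<exists>\<beta>'. X = sym_field m (- c 0) (- c 1 / 2) 0 0 \<beta>'"
      by (rule sym_field_exists[OF V aff mn]) (use eqs c in \<open>auto simp: numeral_2_eq_2\<close>)
    then show "X \<in> {sym_field (n div 2) a0 a1 0 0 \<beta> | a0 a1 \<beta>. True}" unfolding m_def by blast
  qed
  show "{sym_field (n div 2) a0 a1 0 0 \<beta> | a0 a1 \<beta>. True} \<subseteq>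
      variational_symmetries I (Delta n \<alpha> u z) (Lagrangian n \<alpha> u z)"
  proof
    fix X assume "X \<in> {sym_field (n div 2) a0 a1 0 0 \<beta> | a0 a1 \<beta>. True}"
    then obtain a0 a1 \<beta> where X: "X = sym_field m a0 a1 0 0 \<beta>" unfolding m_def by blast
    note Xs = sym_field_smooth[of m a0 a1 0 0 \<beta>, folded X]
    have mn: "m \<le> n" using n by simp
    have "prolong X (Lagrangian n \<alpha> u z) x j + Lagrangian n \<alpha> u z x j * total_deriv (vf_xi X) x j = 0"
      if x: "x \<in> I" for x j
    proof -
      define d where "d = dz (Zt (quad a0 a1 0)) x"
      have e: "(Dz ^^ m) (zw_char (xcomp X) (ycomp X)) x j =
          lift (z_neg (xcomp X)) x j * T (Suc m) x j + (0 - (real n - 1) / 2 * d + real m * d) * T m x j"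
        unfolding X d_def by (rule sym_field_zw_char_iter[OF m1 order_refl mn x disjI2[OF refl]])
      have h: "Dz (lift (z_neg (xcomp X))) x j = d"
        unfolding d_def by (rule affine_Dz_z_neg[OF Xs(4,1) x])
      have r: "real n = 2 * real m" using n by simp
      show ?thesis
        unfolding variational_condition[OF Xs(1,2) x, folded m_def] e h r by (simp add: field_simps)
    qed
    then show "X \<in> variational_symmetries I (Delta n \<alpha> u z) (Lagrangian n \<alpha> u z)"
      using sym_field_point_symmetry[OF mn] unfolding variational_symmetries_def X by blast
  qed
qed

end

theorem corollary1:
  fixes I :: "real set" and n :: nat and q u v z :: "real \<Rightarrow> real" and \<alpha> :: real
  assumes "n \<ge> 2"
    and "open I" and "is_interval I" and "I \<noteq> {}"
    and "smooth_on q I"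
    and "solves_source_eq I q u" and "solves_source_eq I q v"
    and "lin_indep_on I u v"
    and "\<And>x. x \<in> I \<Longrightarrow> u x * deriv v x - deriv u x * v x = 1"
    and "\<And>x. x \<in> I \<Longrightarrow> u x \<noteq> 0"
    and "\<And>x. x \<in> I \<Longrightarrow> (z has_real_derivative 1 / (u x)\<^sup>2) (at x)"
    and "\<alpha> \<noteq> 0"
  shows "(odd n \<longrightarrow>
            divergence_symmetries I (Delta n \<alpha> u z)
              = lie_span ({vf_V I n u v k | k. k \<le> n - 1} \<union> {vf_W I})
          \<and> is_direct_sum (divergence_symmetries I (Delta n \<alpha> u z))
              (alg_A I n u v) {vf_scale c (vf_W I) | c. True})
       \<and> (even n \<longrightarrow>
            is_direct_sum (divergence_symmetries I (Delta n \<alpha> u z))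
              (alg_A I n u v) (alg_s I n u v)
          \<and> is_direct_sum
              (variational_symmetries I (Delta n \<alpha> u z) (Lagrangian n \<alpha> u z))
              (lie_span {vf_V I n u v k | k. k \<le> (n - 2) div 2})
              (lie_span {vf_F I n u, vf_G I n u v}))"
proof -
  have q: "smooth1 I q" by (rule smooth_on_imp_smooth1[OF assms(2,5)])
  interpret coordinate_change I n u v \<alpha> z
    by unfold_locales
      (use assms q solution_smooth1[OF assms(2) q] is_interval_convex[OF assms(3)] in auto)
  have "k \<le> n - 1 \<longleftrightarrow> k < n" for k using assms(1) by auto
  then have V: "{vf_V I n u v k | k. k \<le> n - 1} = {vf_V I n u v k | k. k < n}" by simp
  have A: "alg_A I n u v = {sym_field n 0 0 0 0 \<beta> | \<beta>. True}"
    unfolding alg_A_def V by (rule lie_span_V)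
  have W: "vf_scale c (vf_W I) = sym_field 0 0 0 0 c (\<lambda>k. 0)" for c
    unfolding vf_W_sym_field[of 0] sym_field_scale by simp
  show ?thesis
  proof (intro conjI impI)
    assume odd: "odd n"
    note div = divergence_symmetries_odd[OF odd]
    show "divergence_symmetries I (Delta n \<alpha> u z)
              = lie_span ({vf_V I n u v k | k. k \<le> n - 1} \<union> {vf_W I})"
      unfolding V lie_span_VW by (rule div)
    show "is_direct_sum (divergence_symmetries I (Delta n \<alpha> u z))
              (alg_A I n u v) {vf_scale c (vf_W I) | c. True}"
      unfolding A W div
      using direct_sum_sym_field[of "\<lambda>a0 a1 a2 c. a0 = 0 \<and> a1 = 0 \<and> a2 = 0" n] by simp
  next
    assume even: "even n"
    show "is_direct_sum (divergence_symmetries I (Delta n \<alpha> u z)) (alg_A I n u v) (alg_s I n u v)"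
      unfolding A alg_s_def lie_span_FGH divergence_symmetries_even[OF even]
      using direct_sum_sym_field[of "\<lambda>a0 a1 a2 c. c = 0" n] by simp
    have "k \<le> (n - 2) div 2 \<longleftrightarrow> k < n div 2" for k using assms(1) even by auto
    then have V2: "{vf_V I n u v k | k. k \<le> (n - 2) div 2} = {vf_V I n u v k | k. k < n div 2}"
      by simp
    show "is_direct_sum (variational_symmetries I (Delta n \<alpha> u z) (Lagrangian n \<alpha> u z))
        (lie_span {vf_V I n u v k | k. k \<le> (n - 2) div 2}) (lie_span {vf_F I n u, vf_G I n u v})"
      unfolding V2 lie_span_V lie_span_FG variational_symmetries_even[OF even]
      using direct_sum_sym_field[of "\<lambda>a0 a1 a2 c. a2 = 0 \<and> c = 0" "n div 2"] by simp
  qed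
qed

end
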